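(* Let $\theta\in\mathbb{R}$, let $H_\theta=C(SU(3)_\theta)$ with coordinate elements $u_{jk}$, and let $A((S^5\times S^5)_{\theta'})$ be the algebra with generators $z_1,\dots,z_6$ associated with a real skew-symmetric matrix $\theta'=(\theta'_{jk})_{1\le j,k\le6}$. If $\theta'$ is chosen so that, for some real numbers $\lambda_1,\lambda_2,\lambda_3$, $$\theta=-\theta'_{12}=\theta'_{13}=-\theta'_{23}=-\theta'_{45}=\theta'_{46}=-\theta'_{56},$$ $$\lambda_1=\theta'_{14}=\theta'_{25}=\theta'_{36},\qquad \lambda_2=\theta'_{15}=\theta'_{26}=\theta'_{34},\qquad \lambda_3=\theta'_{16}=\theta'_{24}=\theta'_{35},$$ and $$\lambda_1-\lambda_2=-\lambda_1+\lambda_3=\theta,$$ then the map $\delta$ given on generators by $$\delta(z_s)=\sum_{k=1}^3u_{sk}\otimes z_k,\qquad \delta(z_{s+3})=\sum_{k=1}^3u_{sk}\otimes z_{k+3},\qquad s=1,2,3,$$ extends to a coaction of $H_\theta$ on $A((S^5\times S^5)_{\theta'})$. The subalgebra $B=A((S^5\times S^5)_{\theta'})^{\mathrm{co}H_\theta}$ of coinvariant elements is generated by $$\{\,1,\quad z_1^*z_4+z_2^*z_5+z_3^*z_6,\quad z_1z_4^*+z_2z_5^*+z_3z_6^*\,\}.$$ Moreover, the $*$-subalgebra $B$ is commutative.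
   Context: **The quantum group $SU(3)_\theta$.** Let $u_{ij}$ ($1\le i,j\le3$) be the matrix coordinate functions on $SU(3)$, and let $\mathbb{T}^2\subset SU(3)$ be the diagonal maximal torus of matrices $\mathrm{diag}(e^{2\pi i\varphi_1},e^{2\pi i\varphi_2},e^{-2\pi i(\varphi_1+\varphi_2)})$. For $x,s\in\mathbb{R}^2$ put $\alpha_{x,s}(f)(U)=f(\exp(-x)\,U\exp(s))$, where $\exp(x)=\mathrm{diag}(e^{2\pi i x_1},e^{2\pi i x_2},e^{-2\pi i(x_1+x_2)})$. This is an action of $\mathbb{T}^2\times\mathbb{T}^2$ on $C(SU(3))$. A function $f$ has weight $\vec n=(n_1,n_2,n_3,n_4)\in\mathbb{Z}^4$ if $\alpha_{x,s}(f)=e^{2\pi i(n_1x_1+n_2x_2+n_3s_1+n_4s_2)}f$. With $\varepsilon_1=(1,0)$, $\varepsilon_2=(0,1)$, $\varepsilon_3=(-1,-1)$, the function $u_{ij}$ has weight $(-\varepsilon_i,\varepsilon_j)$. For $\theta\in\mathbb{R}$, the deformed product of $f$ of weight $\vec n$ and $g$ of weight $\vec m$ is $$f\times_\theta g=e^{\pi i\theta(-n_1m_2+n_2m_1+n_3m_4-n_4m_3)}\,fg ,$$ extended to all smooth functions by decomposing them into weight components. The involution is complex conjugation. $C(SU(3)_\theta)$ is the completion in Rieffel's $C^*$-norm. With the unaltered coalgebra structure, $\Delta(u_{ij})=\sum_k u_{ik}\otimes u_{kj}$, $\epsilon(u_{ij})=\delta_{ij}$, $S(u_{ij})=u_{ji}^*$,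 it is a compact quantum group. **The algebra of $(S^5\times S^5)_{\theta'}$.** For a real skew-symmetric $6\times 6$ matrix $\theta'$, $A((S^5\times S^5)_{\theta'})$ is the unital $*$-algebra generated by $z_1,\dots,z_6$ (the elements $z_4,z_5,z_6$ are the coordinates $w_1,w_2,w_3$ of the second sphere) with relations $$z_jz_k=e^{2\pi i\theta'_{jk}}z_kz_j,\qquad z_jz_k^*=e^{-2\pi i\theta'_{jk}}z_k^*z_j,\qquad [z_j,z_j^*]=0,$$ $$z_1z_1^*+z_2z_2^*+z_3z_3^*=z_4z_4^*+z_5z_5^*+z_6z_6^*=1 .$$ **Coactions.** A (left) coaction of $H$ on an algebra $A$ is an algebra map $\rho:A\to H\otimes A$ with $(\Delta\otimes \mathrm{id})\circ\rho=(\mathrm{id}\otimes\rho)\circ\rho$ and $(\epsilon\otimes \mathrm{id})\circ\rho=\mathrm{id}$. Its coinvariants are $A^{\mathrm{co}H}=\{a\in A:\rho(a)=1\otimes a\}$. Since $A((S^5\times S^5)_{\theta'})$ is generated by the $z_j$ as a $*$-algebra, the extension is understood to be compatible with involutions, i.e. $\delta(z_s^* )=\sum_ku_{sk}^*\otimes z_k^*$ and $\delta(z_{s+3}^* )=\sum_ku_{sk}^*\otimes z_{k+3}^*$. *)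

theory Defs
  imports
    "HOL-Analysis.Analysis"
    "HOL-Library.Poly_Mapping"
    "HOL-Algebra.QuotRing"
    "HOL-Algebra.Module"
begin

section \<open>Unital complex star-algebras and C*-algebras\<close>

definition complex_fld :: "complex ring" where
  "complex_fld = \<lparr>carrier = UNIV, monoid.mult = (*), one = 1, zero = 0, add = (+)\<rparr>"

record 'a star_alg = "(complex, 'a) module" +
  star :: "'a \<Rightarrow> 'a"

record 'a normed_star_alg = "'a star_alg" +
  nrm :: "'a \<Rightarrow> real"

definition star_algebra :: "('a, 'm) star_alg_scheme \<Rightarrow> bool" where
  "star_algebra A \<longleftrightarrow>
     Ring.ring A \<and> Module.module complex_fld A \<and>
     (\<forall>c. \<forall>x\<in>carrier A. \<forall>y\<in>carrier A.
        (c \<odot>\<^bsub>A\<^esub> x) \<otimes>\<^bsub>A\<^esub> y = c \<odot>\<^bsub>A\<^esub> (x \<otimes>\<^bsub>A\<^esub> y) \<and>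
        x \<otimes>\<^bsub>A\<^esub> (c \<odot>\<^bsub>A\<^esub> y) = c \<odot>\<^bsub>A\<^esub> (x \<otimes>\<^bsub>A\<^esub> y)) \<and>
     (\<forall>x\<in>carrier A. star A x \<in> carrier A \<and> star A (star A x) = x) \<and>
     (\<forall>x\<in>carrier A. \<forall>y\<in>carrier A.
        star A (x \<oplus>\<^bsub>A\<^esub> y) = star A x \<oplus>\<^bsub>A\<^esub> star A y \<and>
        star A (x \<otimes>\<^bsub>A\<^esub> y) = star A y \<otimes>\<^bsub>A\<^esub> star A x) \<and>
     (\<forall>c. \<forall>x\<in>carrier A. star A (c \<odot>\<^bsub>A\<^esub> x) = cnj c \<odot>\<^bsub>A\<^esub> star A x)"

definition complex_star_alg :: "complex star_alg" where
  "complex_star_alg =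
     \<lparr>carrier = UNIV, monoid.mult = (*), one = 1, zero = 0, add = (+), smult = (*), star = cnj\<rparr>"

definition alg_hom :: "('a, 'm) star_alg_scheme \<Rightarrow> ('b, 'n) star_alg_scheme \<Rightarrow> ('a \<Rightarrow> 'b) set" where
  "alg_hom A B = {f \<in> ring_hom A B. \<forall>c. \<forall>x\<in>carrier A. f (c \<odot>\<^bsub>A\<^esub> x) = c \<odot>\<^bsub>B\<^esub> f x}"

definition star_hom :: "('a, 'm) star_alg_scheme \<Rightarrow> ('b, 'n) star_alg_scheme \<Rightarrow> ('a \<Rightarrow> 'b) set" where
  "star_hom A B = {f \<in> alg_hom A B. \<forall>x\<in>carrier A. f (star A x) = star B (f x)}"

definition subalgebra :: "('a, 'm) star_alg_scheme \<Rightarrow> 'a set \<Rightarrow> bool" where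
  "subalgebra A B \<longleftrightarrow>
     B \<subseteq> carrier A \<and> \<zero>\<^bsub>A\<^esub> \<in> B \<and>
     (\<forall>x\<in>B. \<forall>y\<in>B. x \<oplus>\<^bsub>A\<^esub> y \<in> B \<and> x \<otimes>\<^bsub>A\<^esub> y \<in> B) \<and>
     (\<forall>c. \<forall>x\<in>B. c \<odot>\<^bsub>A\<^esub> x \<in> B)"

definition gen_subalgebra :: "('a, 'm) star_alg_scheme \<Rightarrow> 'a set \<Rightarrow> 'a set" where
  "gen_subalgebra A S = \<Inter>{B. subalgebra A B \<and> S \<subseteq> B}"

definition star_subalgebra :: "('a, 'm) star_alg_scheme \<Rightarrow> 'a set \<Rightarrow> bool" where
  "star_subalgebra A B \<longleftrightarrow> subalgebra A B \<and> \<one>\<^bsub>A\<^esub> \<in> B \<and> (\<forall>x\<in>B. star A x \<in> B)"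

definition cstar_norm :: "('a, 'm) star_alg_scheme \<Rightarrow> ('a \<Rightarrow> real) \<Rightarrow> bool" where
  "cstar_norm A N \<longleftrightarrow>
     (\<forall>x\<in>carrier A. 0 \<le> N x \<and> (N x = 0 \<longleftrightarrow> x = \<zero>\<^bsub>A\<^esub>) \<and> N (star A x \<otimes>\<^bsub>A\<^esub> x) = (N x)\<^sup>2) \<and>
     (\<forall>c. \<forall>x\<in>carrier A. N (c \<odot>\<^bsub>A\<^esub> x) = cmod c * N x) \<and>
     (\<forall>x\<in>carrier A. \<forall>y\<in>carrier A.
        N (x \<oplus>\<^bsub>A\<^esub> y) \<le> N x + N y \<and> N (x \<otimes>\<^bsub>A\<^esub> y) \<le> N x * N y)"

definition cstar_algebra :: "('a, 'm) normed_star_alg_scheme \<Rightarrow> bool" where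
  "cstar_algebra A \<longleftrightarrow>
     star_algebra A \<and> cstar_norm A (nrm A) \<and>
     Metric_space.mcomplete (carrier A) (\<lambda>x y. nrm A (x \<ominus>\<^bsub>A\<^esub> y))"

definition cstar_completion ::
  "('p, 'm) star_alg_scheme \<Rightarrow> ('p \<Rightarrow> real) \<Rightarrow> ('a, 'n) normed_star_alg_scheme \<Rightarrow> ('p \<Rightarrow> 'a) \<Rightarrow> bool"
where
  "cstar_completion P N A \<iota> \<longleftrightarrow>
     cstar_algebra A \<and> \<iota> \<in> star_hom P A \<and>
     (\<forall>x\<in>carrier P. nrm A (\<iota> x) = N x) \<and>
     (\<forall>a\<in>carrier A. \<forall>e>0. \<exists>x\<in>carrier P. nrm A (a \<ominus>\<^bsub>A\<^esub> \<iota> x) < e)"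


section \<open>Monoid algebras, quotients and tensor products\<close>

text \<open>The complex algebra of a monoid \<open>M\<close>; \<open>v\<close> is an involutive anti-automorphism of \<open>M\<close>,
  extended conjugate-linearly to the involution of the algebra.\<close>

definition monoid_algebra :: "('x, 'm) monoid_scheme \<Rightarrow> ('x \<Rightarrow> 'x) \<Rightarrow> ('x \<Rightarrow>\<^sub>0 complex) star_alg" where
  "monoid_algebra M v =
     \<lparr>carrier = {p. Poly_Mapping.keys p \<subseteq> carrier M},
      monoid.mult = (\<lambda>p q. \<Sum>x\<in>Poly_Mapping.keys p. \<Sum>y\<in>Poly_Mapping.keys q.
        Poly_Mapping.single (x \<otimes>\<^bsub>M\<^esub> y) (Poly_Mapping.lookup p x * Poly_Mapping.lookup q y)),
      one = Poly_Mapping.single \<one>\<^bsub>M\<^esub> 1,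
      zero = 0,
      add = (+),
      smult = (\<lambda>c. Poly_Mapping.map ((*) c)),
      star = (\<lambda>p. \<Sum>x\<in>Poly_Mapping.keys p.
        Poly_Mapping.single (v x) (cnj (Poly_Mapping.lookup p x)))\<rparr>"

text \<open>The ring structure is that of \<^const>\<open>FactRing\<close>; \<open>I\<close> is meant to be a two-sided ideal that is
  closed under the involution.\<close>

definition quot_star_alg :: "('a, 'm) star_alg_scheme \<Rightarrow> 'a set \<Rightarrow> 'a set star_alg" where
  "quot_star_alg A I =
     \<lparr>carrier = a_rcosets\<^bsub>A\<^esub> I, monoid.mult = rcoset_mult A I, one = I +>\<^bsub>A\<^esub> \<one>\<^bsub>A\<^esub>,
      zero = I, add = set_add A,
      smult = (\<lambda>c X. \<Union>x\<in>X. I +>\<^bsub>A\<^esub> (c \<odot>\<^bsub>A\<^esub> x)),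
      star = (\<lambda>X. \<Union>x\<in>X. I +>\<^bsub>A\<^esub> star A x)\<rparr>"

definition bilinear_rels ::
  "('v, 'm) star_alg_scheme \<Rightarrow> ('w, 'n) star_alg_scheme \<Rightarrow> ('v \<times> 'w \<Rightarrow>\<^sub>0 complex) set" where
  "bilinear_rels V W =
     {Poly_Mapping.single (x \<oplus>\<^bsub>V\<^esub> x', y) 1 - Poly_Mapping.single (x, y) 1 - Poly_Mapping.single (x', y) 1
        | x x' y. x \<in> carrier V \<and> x' \<in> carrier V \<and> y \<in> carrier W} \<union>
     {Poly_Mapping.single (x, y \<oplus>\<^bsub>W\<^esub> y') 1 - Poly_Mapping.single (x, y) 1 - Poly_Mapping.single (x, y') 1
        | x y y'. x \<in> carrier V \<and> y \<in> carrier W \<and> y' \<in> carrier W} \<union>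
     {Poly_Mapping.single (c \<odot>\<^bsub>V\<^esub> x, y) 1 - Poly_Mapping.single (x, y) c
        | c x y. x \<in> carrier V \<and> y \<in> carrier W} \<union>
     {Poly_Mapping.single (x, c \<odot>\<^bsub>W\<^esub> y) 1 - Poly_Mapping.single (x, y) c
        | c x y. x \<in> carrier V \<and> y \<in> carrier W}"

text \<open>The algebraic tensor product over the complex numbers: the free vector space on
  \<open>carrier V \<times> carrier W\<close> modulo the bilinearity relations. That free space is the monoid algebra of
  the multiplicative monoid \<open>V \<times>\<times> W\<close>, and multiplying a bilinearity relation by a basis element gives
  a bilinearity relation, so the linear span of the relations is the ideal they generate.\<close>

definition free_pairs ::
  "('v, 'm) star_alg_scheme \<Rightarrow> ('w, 'n) star_alg_scheme \<Rightarrow> ('v \<times> 'w \<Rightarrow>\<^sub>0 complex) star_alg" where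
  "free_pairs V W = monoid_algebra (V \<times>\<times> W) (\<lambda>(x, y). (star V x, star W y))"

definition tensor_null ::
  "('v, 'm) star_alg_scheme \<Rightarrow> ('w, 'n) star_alg_scheme \<Rightarrow> ('v \<times> 'w \<Rightarrow>\<^sub>0 complex) set" where
  "tensor_null V W = Idl\<^bsub>free_pairs V W\<^esub> (bilinear_rels V W)"

definition tensor ::
  "('v, 'm) star_alg_scheme \<Rightarrow> ('w, 'n) star_alg_scheme \<Rightarrow> ('v \<times> 'w \<Rightarrow>\<^sub>0 complex) set star_alg" where
  "tensor V W = quot_star_alg (free_pairs V W) (tensor_null V W)"

definition tens ::
  "('v, 'm) star_alg_scheme \<Rightarrow> ('w, 'n) star_alg_scheme \<Rightarrow> 'v \<Rightarrow> 'w \<Rightarrow> ('v \<times> 'w \<Rightarrow>\<^sub>0 complex) set" where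
  "tens V W x y = tensor_null V W +>\<^bsub>free_pairs V W\<^esub> Poly_Mapping.single (x, y) 1"

text \<open>\<open>tensor_lift Z \<phi>\<close> is the linear map sending \<open>x \<otimes> y\<close> to \<open>\<phi> x y\<close>, for bilinear \<open>\<phi>\<close> with values
  in \<open>Z\<close>.\<close>

definition tensor_lift ::
  "('z, 'n) star_alg_scheme \<Rightarrow> ('v \<Rightarrow> 'w \<Rightarrow> 'z) \<Rightarrow> ('v \<times> 'w \<Rightarrow>\<^sub>0 complex) set \<Rightarrow> 'z" where
  "tensor_lift Z \<phi> X =
     (THE z. \<exists>p\<in>X. z = finsum Z (\<lambda>(x, y). Poly_Mapping.lookup p (x, y) \<odot>\<^bsub>Z\<^esub> \<phi> x y) (Poly_Mapping.keys p))"

text \<open>The minimal (spatial) C*-norm is the smallest C*-norm on the algebraic tensor product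
  (Takesaki).\<close>

definition min_cstar_norm :: "('a, 'm) star_alg_scheme \<Rightarrow> 'a \<Rightarrow> real" where
  "min_cstar_norm A x = Inf {N x | N. cstar_norm A N}"


section \<open>The deformed function algebra on SU(3)\<close>

definition SU3 :: "(complex^3^3) set" where
  "SU3 = {U. det U = 1 \<and> U ** map_matrix cnj (transpose U) = mat 1}"

definition torus_exp :: "real \<Rightarrow> real \<Rightarrow> complex^3^3" where
  "torus_exp x1 x2 = (\<chi> i j. if i = j
     then cis (2 * pi * (if i = 1 then x1 else if i = 2 then x2 else - (x1 + x2))) else 0)"

text \<open>Functions on SU(3) are represented by functions on all matrices that vanish off SU(3).\<close>

definition weight_space :: "int^4 \<Rightarrow> (complex^3^3 \<Rightarrow> complex) set" where
  "weight_space n = {f. continuous_on SU3 f \<and> (\<forall>U. U \<notin> SU3 \<longrightarrow> f U = 0) \<and>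
     (\<forall>x1 x2 s1 s2. \<forall>U\<in>SU3. f (torus_exp (- x1) (- x2) ** U ** torus_exp s1 s2) =
        cis (2 * pi * (of_int (n $ 1) * x1 + of_int (n $ 2) * x2 + of_int (n $ 3) * s1 + of_int (n $ 4) * s2)) * f U)}"

definition weight_decomp :: "(complex^3^3 \<Rightarrow> complex) \<Rightarrow> (int^4 \<Rightarrow> complex^3^3 \<Rightarrow> complex) \<Rightarrow> bool" where
  "weight_decomp f c \<longleftrightarrow>
     (\<forall>n. c n \<in> weight_space n) \<and> finite {n. c n \<noteq> (\<lambda>U. 0)} \<and>
     f = (\<lambda>U. \<Sum>n | c n \<noteq> (\<lambda>U. 0). c n U)"

definition weight_comp :: "(complex^3^3 \<Rightarrow> complex) \<Rightarrow> int^4 \<Rightarrow> complex^3^3 \<Rightarrow> complex" where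
  "weight_comp f = (THE c. weight_decomp f c)"

definition weights :: "(complex^3^3 \<Rightarrow> complex) \<Rightarrow> (int^4) set" where
  "weights f = {n. weight_comp f n \<noteq> (\<lambda>U. 0)}"

definition deform_phase :: "real \<Rightarrow> int^4 \<Rightarrow> int^4 \<Rightarrow> complex" where
  "deform_phase \<theta> n m = cis (pi * \<theta> *
     of_int (- (n $ 1) * m $ 2 + n $ 2 * m $ 1 + n $ 3 * m $ 4 - n $ 4 * m $ 3))"

definition deform_mult ::
  "real \<Rightarrow> (complex^3^3 \<Rightarrow> complex) \<Rightarrow> (complex^3^3 \<Rightarrow> complex) \<Rightarrow> complex^3^3 \<Rightarrow> complex" where
  "deform_mult \<theta> f g =
     (\<lambda>U. \<Sum>n\<in>weights f. \<Sum>m\<in>weights g. deform_phase \<theta> n m * weight_comp f n U * weight_comp g m U)"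

text \<open>The star-algebra of finite sums of continuous weight functions under the deformed product.
  It is dense in the deformation of \<open>C(SU(3))\<close>, as is the algebra of smooth functions.\<close>

definition deformed_SU3 :: "real \<Rightarrow> (complex^3^3 \<Rightarrow> complex) star_alg" where
  "deformed_SU3 \<theta> =
     \<lparr>carrier = {f. \<exists>c. weight_decomp f c},
      monoid.mult = deform_mult \<theta>,
      one = (\<lambda>U. if U \<in> SU3 then 1 else 0),
      zero = (\<lambda>U. 0),
      add = (\<lambda>f g U. f U + g U),
      smult = (\<lambda>c f U. c * f U),
      star = (\<lambda>f U. cnj (f U))\<rparr>"

text \<open>At a point \<open>U\<close>, the restriction of \<open>f\<close> to the torus orbit of \<open>U\<close> has Fourier coefficients
  \<open>weight_comp f n U\<close>. Left deformed multiplication by this restriction acts on the square-summable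
  Fourier coefficients \<open>\<xi>\<close> of functions on the torus as below. Rieffel's norm is the supremum over
  \<open>U\<close> of the operator norms. (Rieffel lets the same operators act on functions on \<open>\<real>\<^sup>4\<close> instead of
  \<open>\<real>\<^sup>4/\<int>\<^sup>4\<close>; for an action of the torus this gives the same norm.)\<close>

definition left_mult_coeff ::
  "real \<Rightarrow> (complex^3^3 \<Rightarrow> complex) \<Rightarrow> complex^3^3 \<Rightarrow> (int^4 \<Rightarrow> complex) \<Rightarrow> int^4 \<Rightarrow> complex" where
  "left_mult_coeff \<theta> f U \<xi> k =
     (\<Sum>n\<in>weights f. deform_phase \<theta> n (k - n) * weight_comp f n U * \<xi> (k - n))"

definition rieffel_norm :: "real \<Rightarrow> (complex^3^3 \<Rightarrow> complex) \<Rightarrow> real" where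
  "rieffel_norm \<theta> f = Sup {sqrt (\<Sum>\<^sub>\<infinity>k. (cmod (left_mult_coeff \<theta> f U \<xi> k))\<^sup>2) | U \<xi>.
     U \<in> SU3 \<and> finite {m. \<xi> m \<noteq> 0} \<and> (\<Sum>m | \<xi> m \<noteq> 0. (cmod (\<xi> m))\<^sup>2) \<le> 1}"

text \<open>The indices range over \<open>1, 2, 3\<close>; note that \<open>of_nat 3 = 0\<close> in the index type \<open>3\<close>.\<close>

definition SU3_coord :: "nat \<Rightarrow> nat \<Rightarrow> complex^3^3 \<Rightarrow> complex" where
  "SU3_coord i j = (\<lambda>U. if U \<in> SU3 then U $ of_nat i $ of_nat j else 0)"

text \<open>\<open>H\<close> is the C*-algebra \<open>C(SU(3)\<^sub>\<theta>)\<close>, unique up to isomorphism as a completion, and \<open>K\<close> is the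
  minimal C*-tensor product of \<open>H\<close> with itself. The values on the coordinates determine the
  comultiplication \<open>\<Delta>\<close> and the counit \<open>\<epsilon>\<close>, because the coordinates generate a dense
  star-subalgebra. A coaction does not involve the antipode.\<close>

locale quantum_SU3 =
  fixes \<theta> :: real
    and H :: "('h, 'm) normed_star_alg_scheme"
    and \<iota> :: "(complex^3^3 \<Rightarrow> complex) \<Rightarrow> 'h"
    and K :: "('k, 'n) normed_star_alg_scheme"
    and \<kappa> :: "('h \<times> 'h \<Rightarrow>\<^sub>0 complex) set \<Rightarrow> 'k"
    and \<Delta> :: "'h \<Rightarrow> 'k"
    and \<epsilon> :: "'h \<Rightarrow> complex"
  assumes H_completion: "cstar_completion (deformed_SU3 \<theta>) (rieffel_norm \<theta>) H \<iota>"
    and K_completion: "cstar_completion (tensor H H) (min_cstar_norm (tensor H H)) K \<kappa>"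
    and comult_hom: "\<Delta> \<in> star_hom H K"
    and comult_coord: "\<And>i j. i \<in> {1..3} \<Longrightarrow> j \<in> {1..3} \<Longrightarrow>
      \<Delta> (\<iota> (SU3_coord i j)) =
        finsum K (\<lambda>k. \<kappa> (tens H H (\<iota> (SU3_coord i k)) (\<iota> (SU3_coord k j)))) {1..3}"
    and counit_hom: "\<epsilon> \<in> star_hom H complex_star_alg"
    and counit_coord: "\<And>i j. i \<in> {1..3} \<Longrightarrow> j \<in> {1..3} \<Longrightarrow>
      \<epsilon> (\<iota> (SU3_coord i j)) = (if i = j then 1 else 0)"


section \<open>Coactions\<close>

text \<open>The target \<open>H \<otimes> A\<close> is the algebraic tensor product. As \<open>\<Delta>\<close> takes values in the completion
  \<open>K\<close> of \<open>H \<otimes> H\<close>, coassociativity is an equation in \<open>K \<otimes> A\<close>, which contains \<open>H \<otimes> H \<otimes> A\<close> by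
  \<open>h \<otimes> h' \<otimes> b \<mapsto> \<kappa>(h \<otimes> h') \<otimes> b\<close>.\<close>

definition left_coaction ::
  "('h, 'm) star_alg_scheme \<Rightarrow> ('k, 'n) star_alg_scheme \<Rightarrow> (('h \<times> 'h \<Rightarrow>\<^sub>0 complex) set \<Rightarrow> 'k) \<Rightarrow>
   ('h \<Rightarrow> 'k) \<Rightarrow> ('h \<Rightarrow> complex) \<Rightarrow> ('a, 'l) star_alg_scheme \<Rightarrow>
   ('a \<Rightarrow> ('h \<times> 'a \<Rightarrow>\<^sub>0 complex) set) \<Rightarrow> bool" where
  "left_coaction H K \<kappa> \<Delta> \<epsilon> A \<rho> \<longleftrightarrow>
     \<rho> \<in> alg_hom A (tensor H A) \<and>
     (\<forall>a\<in>carrier A.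
        tensor_lift (tensor K A) (\<lambda>h b. tens K A (\<Delta> h) b) (\<rho> a) =
        tensor_lift (tensor K A)
          (\<lambda>h b. tensor_lift (tensor K A) (\<lambda>h' b'. tens K A (\<kappa> (tens H H h h')) b') (\<rho> b)) (\<rho> a)) \<and>
     (\<forall>a\<in>carrier A. tensor_lift A (\<lambda>h b. \<epsilon> h \<odot>\<^bsub>A\<^esub> b) (\<rho> a) = a)"

definition coinvariants ::
  "('h, 'm) star_alg_scheme \<Rightarrow> ('a, 'l) star_alg_scheme \<Rightarrow> ('a \<Rightarrow> ('h \<times> 'a \<Rightarrow>\<^sub>0 complex) set) \<Rightarrow> 'a set" where
  "coinvariants H A \<rho> = {a \<in> carrier A. \<rho> a = tens H A \<one>\<^bsub>H\<^esub> a}"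


section \<open>The algebra of the product of two noncommutative 5-spheres\<close>

text \<open>The letter \<open>(j, False)\<close> stands for \<open>z\<^sub>j\<close> and \<open>(j, True)\<close> for its adjoint.\<close>

type_synonym sphere_poly = "(6 \<times> bool) list \<Rightarrow>\<^sub>0 complex"

definition free_sphere_alg :: "sphere_poly star_alg" where
  "free_sphere_alg =
     monoid_algebra \<lparr>carrier = UNIV, monoid.mult = (@), one = []\<rparr> (\<lambda>w. rev (map (\<lambda>(j, b). (j, \<not> b)) w))"

definition free_z :: "6 \<Rightarrow> sphere_poly" where
  "free_z j = Poly_Mapping.single [(j, False)] 1"

definition free_zs :: "6 \<Rightarrow> sphere_poly" where
  "free_zs j = Poly_Mapping.single [(j, True)] 1"

definition sphere_rels :: "real^6^6 \<Rightarrow> sphere_poly set" where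
  "sphere_rels \<theta>' = (let F = free_sphere_alg in
     {free_z j \<otimes>\<^bsub>F\<^esub> free_z k - cis (2 * pi * \<theta>' $ j $ k) \<odot>\<^bsub>F\<^esub> (free_z k \<otimes>\<^bsub>F\<^esub> free_z j) | j k. True} \<union>
     {free_z j \<otimes>\<^bsub>F\<^esub> free_zs k - cis (- 2 * pi * \<theta>' $ j $ k) \<odot>\<^bsub>F\<^esub> (free_zs k \<otimes>\<^bsub>F\<^esub> free_z j) | j k. True} \<union>
     {free_z j \<otimes>\<^bsub>F\<^esub> free_zs j - free_zs j \<otimes>\<^bsub>F\<^esub> free_z j | j. True} \<union>
     {free_z 1 \<otimes>\<^bsub>F\<^esub> free_zs 1 + free_z 2 \<otimes>\<^bsub>F\<^esub> free_zs 2 + free_z 3 \<otimes>\<^bsub>F\<^esub> free_zs 3 - \<one>\<^bsub>F\<^esub>,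
      free_z 4 \<otimes>\<^bsub>F\<^esub> free_zs 4 + free_z 5 \<otimes>\<^bsub>F\<^esub> free_zs 5 + free_z 6 \<otimes>\<^bsub>F\<^esub> free_zs 6 - \<one>\<^bsub>F\<^esub>})"

definition sphere_ideal :: "real^6^6 \<Rightarrow> sphere_poly set" where
  "sphere_ideal \<theta>' =
     Idl\<^bsub>free_sphere_alg\<^esub> (sphere_rels \<theta>' \<union> star free_sphere_alg ` sphere_rels \<theta>')"

definition sphere_alg :: "real^6^6 \<Rightarrow> sphere_poly set star_alg" where
  "sphere_alg \<theta>' = quot_star_alg free_sphere_alg (sphere_ideal \<theta>')"

text \<open>The index ranges over \<open>1, \<dots>, 6\<close>; note that \<open>of_nat 6 = 0\<close> in the index type \<open>6\<close>.\<close>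

definition sphere_z :: "real^6^6 \<Rightarrow> nat \<Rightarrow> sphere_poly set" where
  "sphere_z \<theta>' j = sphere_ideal \<theta>' +>\<^bsub>free_sphere_alg\<^esub> free_z (of_nat j)"

text \<open>For an algebra homomorphism \<open>\<delta>\<close>, prescribing the values on the adjoints of the generators
  amounts to compatibility with the involutions.\<close>

definition extends_generators ::
  "('h, 'm) normed_star_alg_scheme \<Rightarrow> ((complex^3^3 \<Rightarrow> complex) \<Rightarrow> 'h) \<Rightarrow> real^6^6 \<Rightarrow>
   (sphere_poly set \<Rightarrow> ('h \<times> sphere_poly set \<Rightarrow>\<^sub>0 complex) set) \<Rightarrow> bool" where
  "extends_generators H \<iota> \<theta>' \<delta> \<longleftrightarrow>
     (let A = sphere_alg \<theta>'; z = sphere_z \<theta>'; u = (\<lambda>i j. \<iota> (SU3_coord i j)) in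
      \<forall>s\<in>{1..3}.
        \<delta> (z s) = finsum (tensor H A) (\<lambda>k. tens H A (u s k) (z k)) {1..3} \<and>
        \<delta> (z (s + 3)) = finsum (tensor H A) (\<lambda>k. tens H A (u s k) (z (k + 3))) {1..3} \<and>
        \<delta> (star A (z s)) = finsum (tensor H A) (\<lambda>k. tens H A (star H (u s k)) (star A (z k))) {1..3} \<and>
        \<delta> (star A (z (s + 3))) =
          finsum (tensor H A) (\<lambda>k. tens H A (star H (u s k)) (star A (z (k + 3)))) {1..3})"

end

theory Submission
  imports Defs
begin

text \<open>
  In blocks, \<open>\<theta>'\<close> is \<open>lam b b' - \<theta> (e\<^sub>i \<and> e\<^sub>k)\<close>, and the wedge term is also the phase of the deformed
  product of the \<open>u\<^sub>i\<^sub>j\<close>. So the phases cancel: after a suitable normalisation of the words in the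
  \<open>z\<^sub>j\<close>, the coaction is dual to the classical action \<open>x \<mapsto> U x\<close> on \<open>S\<^sup>5 \<times> S\<^sup>5\<close>. The same normalisation
  turns elements of the algebra into polynomial functions on \<open>S\<^sup>5 \<times> S\<^sup>5\<close>, and this map is injective
  because the reduced monomials are independent (independence of characters, used twice). The
  completion map \<open>\<iota>\<close> is injective because Rieffel's norm dominates all Fourier coefficients. Hence a
  coinvariant gives an \<open>SU(3)\<close>-invariant polynomial \<open>f\<close>. Moving \<open>(z, w)\<close> to \<open>(e\<^sub>1, p e\<^sub>1 + r e\<^sub>2)\<close>, where
  \<open>p = \<langle>z, w\<rangle>\<close> and \<open>r\<^sup>2 = 1 - |p|\<^sup>2\<close> with either sign of \<open>r\<close>, shows that \<open>f\<close> is a polynomial in \<open>p\<close> and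
  its conjugate. These are the images of the two generators, on which the normalisation is
  multiplicative up to constants.
\<close>

section \<open>Complex algebras and their tensor products\<close>

text \<open>The conditions \<lambda>1 - \<lambda>2 = -\<lambda>1 + \<lambda>3 = \<theta> say that
  the block coupling the two spheres is a constant minus the same wedge form that occurs inside each
  sphere; one phase identity for pairs of letters therefore covers all commutation relations.
  Evaluation at a point of the spheres is linear but not multiplicative, so every product has to be
  followed together with its phase. For the two invariant generators the phase against a word
  depends only on the number of plain minus adjoint letters, and their products contain only words
  for which this number is 0. The coaction lives in an algebraic tensor product with a completed
  algebra. Pairing its second factor with an evaluation gives an element of H of the form
  \<open>\<iota> f\<close>, so coinvariance is tested on functions on SU(3). Monomials on the
  spheres are not characters of one group, because the modulus of the third coordinate is determined
  by the other two; this is why independence takes two rounds. In the normal form r is not a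
  polynomial in p, but r and -r belong to the same orbit, and averaging removes the odd
  part.\<close>

locale calg = ring A for A :: "('a, 'm) star_alg_scheme" (structure) +
  assumes smult_closed [simp, intro]: "x \<in> carrier A \<Longrightarrow> c \<odot> x \<in> carrier A"
    and smult_l_distr: "x \<in> carrier A \<Longrightarrow> (c + d) \<odot> x = c \<odot> x \<oplus> d \<odot> x"
    and smult_r_distr: "x \<in> carrier A \<Longrightarrow> y \<in> carrier A \<Longrightarrow> c \<odot> (x \<oplus> y) = c \<odot> x \<oplus> c \<odot> y"
    and smult_assoc: "x \<in> carrier A \<Longrightarrow> (c * d) \<odot> x = c \<odot> (d \<odot> x)"
    and smult_one [simp]: "x \<in> carrier A \<Longrightarrow> 1 \<odot> x = x"
    and smult_mult_l: "x \<in> carrier A \<Longrightarrow> y \<in> carrier A \<Longrightarrow> (c \<odot> x) \<otimes> y = c \<odot> (x \<otimes> y)"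
    and smult_mult_r: "x \<in> carrier A \<Longrightarrow> y \<in> carrier A \<Longrightarrow> x \<otimes> (c \<odot> y) = c \<odot> (x \<otimes> y)"
begin

lemma smult_zero_right [simp]: "c \<odot> \<zero> = \<zero>"
proof -
  have "c \<odot> \<zero> = (c \<odot> \<one>) \<otimes> \<zero>" by (subst smult_mult_l) auto
  then show ?thesis by simp
qed

lemma smult_zero_left [simp]: "x \<in> carrier A \<Longrightarrow> 0 \<odot> x = \<zero>"
proof -
  assume x: "x \<in> carrier A"
  have "0 \<odot> x \<oplus> 0 \<odot> x = 0 \<odot> x" using smult_l_distr[OF x, of 0 0] by simp
  then show ?thesis using x by (metis add.l_cancel_one smult_closed)
qed

lemma smult_minus_one: "x \<in> carrier A \<Longrightarrow> (- 1) \<odot> x = \<ominus> x"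
  using smult_l_distr[of x "- 1" 1] by (intro minus_equality[symmetric]) (auto simp: a_comm)

lemma minus_smult: "x \<in> carrier A \<Longrightarrow> y \<in> carrier A \<Longrightarrow> x \<ominus> y = x \<oplus> (- 1) \<odot> y"
  by (simp add: smult_minus_one a_minus_def)

end

lemma star_algebra_calg: "star_algebra A \<Longrightarrow> calg A"
  unfolding star_algebra_def calg_def calg_axioms_def
  by (auto simp: complex_fld_def module_def module_axioms_def)

lemma complex_star_alg_simps [simp]:
  "carrier complex_star_alg = UNIV" "x \<otimes>\<^bsub>complex_star_alg\<^esub> y = x * y"
  "x \<oplus>\<^bsub>complex_star_alg\<^esub> y = x + y" "\<one>\<^bsub>complex_star_alg\<^esub> = 1" "\<zero>\<^bsub>complex_star_alg\<^esub> = 0"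
  "c \<odot>\<^bsub>complex_star_alg\<^esub> x = c * x" "star complex_star_alg x = cnj x"
  by (simp_all add: complex_star_alg_def)

lemma calg_complex: "calg complex_star_alg"
proof -
  have "ring complex_star_alg"
    by (intro ringI abelian_groupI monoidI)
      (auto simp: algebra_simps intro: exI[of _ "- x" for x])
  then show ?thesis
    unfolding calg_def calg_axioms_def by (auto simp: algebra_simps)
qed

subsection \<open>Linear maps and sums of lists\<close>

definition lin_map ::
  "('a, 'm) star_alg_scheme \<Rightarrow> ('b, 'n) star_alg_scheme \<Rightarrow> ('a \<Rightarrow> 'b) set" where
  "lin_map A B = {f \<in> carrier A \<rightarrow> carrier B.
     (\<forall>x\<in>carrier A. \<forall>y\<in>carrier A. f (x \<oplus>\<^bsub>A\<^esub> y) = f x \<oplus>\<^bsub>B\<^esub> f y) \<and>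
     (\<forall>c. \<forall>x\<in>carrier A. f (c \<odot>\<^bsub>A\<^esub> x) = c \<odot>\<^bsub>B\<^esub> f x)}"

lemma lin_mapD:
  assumes "f \<in> lin_map A B" "x \<in> carrier A"
  shows lin_map_closed: "f x \<in> carrier B"
    and lin_map_add: "y \<in> carrier A \<Longrightarrow> f (x \<oplus>\<^bsub>A\<^esub> y) = f x \<oplus>\<^bsub>B\<^esub> f y"
    and lin_map_smult: "f (c \<odot>\<^bsub>A\<^esub> x) = c \<odot>\<^bsub>B\<^esub> f x"
  using assms by (auto simp: lin_map_def)

lemma lin_map_zero:
  assumes "f \<in> lin_map A B" "calg A" "calg B" shows "f \<zero>\<^bsub>A\<^esub> = \<zero>\<^bsub>B\<^esub>"
proof -
  interpret A: calg A by fact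
  interpret B: calg B by fact
  show ?thesis using lin_mapD[OF assms(1), of "\<zero>\<^bsub>A\<^esub>"] A.smult_zero_left[of "\<zero>\<^bsub>A\<^esub>"]
    by (metis A.zero_closed B.smult_zero_left)
qed

lemma lin_map_comp: "f \<in> lin_map A B \<Longrightarrow> g \<in> lin_map B C \<Longrightarrow> (\<lambda>x. g (f x)) \<in> lin_map A C"
  by (auto simp: lin_map_def Pi_def)

lemma alg_hom_lin_map: "f \<in> alg_hom A B \<Longrightarrow> f \<in> lin_map A B"
  by (auto simp: alg_hom_def lin_map_def ring_hom_def)

lemma alg_homD:
  assumes "f \<in> alg_hom A B"
  shows alg_hom_one: "f \<one>\<^bsub>A\<^esub> = \<one>\<^bsub>B\<^esub>"
    and alg_hom_mult: "x \<in> carrier A \<Longrightarrow> y \<in> carrier A \<Longrightarrow> f (x \<otimes>\<^bsub>A\<^esub> y) = f x \<otimes>\<^bsub>B\<^esub> f y"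
  using assms by (auto simp: alg_hom_def ring_hom_def)

lemma alg_homI:
  assumes "f \<in> lin_map A B" "f \<one>\<^bsub>A\<^esub> = \<one>\<^bsub>B\<^esub>"
    and "\<And>x y. x \<in> carrier A \<Longrightarrow> y \<in> carrier A \<Longrightarrow> f (x \<otimes>\<^bsub>A\<^esub> y) = f x \<otimes>\<^bsub>B\<^esub> f y"
  shows "f \<in> alg_hom A B"
  using assms by (auto simp: alg_hom_def ring_hom_def lin_map_def)

lemma alg_hom_comp: "f \<in> alg_hom A B \<Longrightarrow> g \<in> alg_hom B C \<Longrightarrow> (\<lambda>x. g (f x)) \<in> alg_hom A C"
  by (auto simp: alg_hom_def ring_hom_def Pi_def)

text \<open>Right-nested sums over lists unfold on the fixed index list of three elements and follow
  the recursion on words.\<close>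

definition lsum :: "('a, 'm) star_alg_scheme \<Rightarrow> 'a list \<Rightarrow> 'a" where
  "lsum A xs = foldr (\<oplus>\<^bsub>A\<^esub>) xs \<zero>\<^bsub>A\<^esub>"

lemma lsum_simps [simp]: "lsum A [] = \<zero>\<^bsub>A\<^esub>" "lsum A (x # xs) = x \<oplus>\<^bsub>A\<^esub> lsum A xs"
  by (simp_all add: lsum_def)

context calg
begin

lemma lsum_closed [simp, intro]: "set xs \<subseteq> carrier A \<Longrightarrow> lsum A xs \<in> carrier A"
  by (induction xs) auto

lemma lsum_append:
  "set xs \<subseteq> carrier A \<Longrightarrow> set ys \<subseteq> carrier A \<Longrightarrow> lsum A (xs @ ys) = lsum A xs \<oplus> lsum A ys"
  by (induction xs) (auto simp: a_assoc)

lemma lsum_mult_left: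
  "a \<in> carrier A \<Longrightarrow> (\<And>i. i \<in> set xs \<Longrightarrow> f i \<in> carrier A) \<Longrightarrow>
    a \<otimes> lsum A (map f xs) = lsum A (map (\<lambda>i. a \<otimes> f i) xs)"
proof (induction xs)
  case (Cons i xs)
  have "lsum A (map f xs) \<in> carrier A" using Cons.prems by (intro lsum_closed) auto
  then show ?case using Cons by (simp add: r_distr)
qed simp

end

lemma lin_map_lsum:
  assumes "F \<in> lin_map A B" "calg A" "calg B" "\<And>i. i \<in> set xs \<Longrightarrow> f i \<in> carrier A"
  shows "F (lsum A (map f xs)) = lsum B (map (\<lambda>i. F (f i)) xs)"
  using assms(4)
proof (induction xs)
  case Nil
  show ?case using lin_map_zero[OF assms(1-3)] by simp
next
  case (Cons i xs)
  have "lsum A (map f xs) \<in> carrier A" using Cons.prems by (intro calg.lsum_closed assms) auto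
  then show ?case using Cons by (simp add: lin_map_add[OF assms(1)])
qed

subsection \<open>Monoid algebras\<close>

lemma pm_induct [consumes 1, case_names zero single add]:
  fixes p :: "'x \<Rightarrow>\<^sub>0 complex"
  assumes "Poly_Mapping.keys p \<subseteq> C" and "P 0"
    and "\<And>x c. x \<in> C \<Longrightarrow> P (Poly_Mapping.single x c)"
    and "\<And>p q. Poly_Mapping.keys p \<subseteq> C \<Longrightarrow> Poly_Mapping.keys q \<subseteq> C \<Longrightarrow> P p \<Longrightarrow> P q \<Longrightarrow> P (p + q)"
  shows "P p"
proof -
  have *: "Poly_Mapping.keys (\<Sum>x\<in>S. Poly_Mapping.single x (Poly_Mapping.lookup p x)) \<subseteq> C \<and>
      P (\<Sum>x\<in>S. Poly_Mapping.single x (Poly_Mapping.lookup p x))" if "finite S" "S \<subseteq> C" for S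
    using that
  proof (induction S)
    case (insert x S)
    let ?q = "Poly_Mapping.single x (Poly_Mapping.lookup p x)"
    let ?r = "\<Sum>x\<in>S. Poly_Mapping.single x (Poly_Mapping.lookup p x)"
    have "Poly_Mapping.keys ?q \<subseteq> C" "Poly_Mapping.keys ?r \<subseteq> C" "P ?q" "P ?r"
      using insert assms(3) by simp_all
    then have "P (?q + ?r)" "Poly_Mapping.keys (?q + ?r) \<subseteq> C"
      using assms(4)[of ?q ?r] Poly_Mapping.keys_add[of ?q ?r] by auto
    then show ?case using insert by simp
  qed (use assms(2) in simp)
  have "p = (\<Sum>x\<in>Poly_Mapping.keys p. Poly_Mapping.single x (Poly_Mapping.lookup p x))"
    by (intro poly_mapping_eqI)
      (auto simp: lookup_sum lookup_single when_def sum.delta in_keys_iff)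
  then show ?thesis using *[of "Poly_Mapping.keys p"] assms(1) by simp
qed

definition linext :: "('z, 'n) star_alg_scheme \<Rightarrow> ('x \<Rightarrow> 'z) \<Rightarrow> ('x \<Rightarrow>\<^sub>0 complex) \<Rightarrow> 'z" where
  "linext Z f p = finsum Z (\<lambda>x. Poly_Mapping.lookup p x \<odot>\<^bsub>Z\<^esub> f x) (Poly_Mapping.keys p)"

context calg
begin

lemma linext_closed: "f \<in> C \<rightarrow> carrier A \<Longrightarrow> Poly_Mapping.keys p \<subseteq> C \<Longrightarrow> linext A f p \<in> carrier A"
  unfolding linext_def by (intro finsum_closed) auto

lemma linext_superset:
  assumes "f \<in> C \<rightarrow> carrier A" "Poly_Mapping.keys p \<subseteq> S" "finite S" "S \<subseteq> C"
  shows "linext A f p = finsum A (\<lambda>x. Poly_Mapping.lookup p x \<odot> f x) S"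
  unfolding linext_def
  by (rule add.finprod_mono_neutral_cong_left) (use assms in \<open>auto simp: in_keys_iff Pi_def subset_iff\<close>)

lemma linext_add:
  assumes f: "f \<in> C \<rightarrow> carrier A" and p: "Poly_Mapping.keys p \<subseteq> C" and q: "Poly_Mapping.keys q \<subseteq> C"
  shows "linext A f (p + q) = linext A f p \<oplus> linext A f q"
proof -
  let ?S = "Poly_Mapping.keys p \<union> Poly_Mapping.keys q"
  have S: "finite ?S" "?S \<subseteq> C" "Poly_Mapping.keys (p + q) \<subseteq> ?S"
    using p q Poly_Mapping.keys_add[of p q] by auto
  have "linext A f (p + q) = finsum A (\<lambda>x. Poly_Mapping.lookup (p + q) x \<odot> f x) ?S"
    using S by (intro linext_superset[OF f]) auto
  also have "\<dots> = finsum A (\<lambda>x. Poly_Mapping.lookup p x \<odot> f x \<oplus> Poly_Mapping.lookup q x \<odot> f x) ?S"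
    using S f by (intro finsum_cong') (auto simp: lookup_add smult_l_distr Pi_def subset_iff)
  also have "\<dots> = finsum A (\<lambda>x. Poly_Mapping.lookup p x \<odot> f x) ?S \<oplus>
      finsum A (\<lambda>x. Poly_Mapping.lookup q x \<odot> f x) ?S"
    using S f by (intro finsum_addf) (auto simp: Pi_def subset_iff)
  also have "\<dots> = linext A f p \<oplus> linext A f q"
    using S p q by (subst (1 2) linext_superset[OF f, of _ ?S]) auto
  finally show ?thesis .
qed

lemma linext_zero [simp]: "linext A f 0 = \<zero>"
  by (simp add: linext_def)

lemma linext_single: "f x \<in> carrier A \<Longrightarrow> linext A f (Poly_Mapping.single x c) = c \<odot> f x"
  by (cases "c = 0") (simp_all add: linext_def)

end

lemma lookup_map_times [simp]:
  "Poly_Mapping.lookup (Poly_Mapping.map ((*) (c::complex)) p) k = c * Poly_Mapping.lookup p k"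
  by (simp add: Poly_Mapping.map.rep_eq when_def)

lemma keys_map_times: "Poly_Mapping.keys (Poly_Mapping.map ((*) (c::complex)) p) \<subseteq> Poly_Mapping.keys p"
  by (auto simp: in_keys_iff)

lemma map_times_single [simp]:
  "Poly_Mapping.map ((*) (c::complex)) (Poly_Mapping.single x d) = Poly_Mapping.single x (c * d)"
  by (intro poly_mapping_eqI) (simp add: lookup_single when_def)

lemma map_times_add:
  "Poly_Mapping.map ((*) (c::complex)) (p + q) = Poly_Mapping.map ((*) c) p + Poly_Mapping.map ((*) c) q"
  by (intro poly_mapping_eqI) (simp add: lookup_add algebra_simps)

lemma map_times_zero [simp]: "Poly_Mapping.map ((*) (c::complex)) 0 = 0"
  by (intro poly_mapping_eqI) simp

locale monoid_alg = monoid M for M :: "('x, 'm) monoid_scheme" (structure) +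
  fixes v :: "'x \<Rightarrow> 'x"
begin

abbreviation R :: "('x \<Rightarrow>\<^sub>0 complex) star_alg" where "R \<equiv> monoid_algebra M v"

lemma carrier_R: "p \<in> carrier R \<longleftrightarrow> Poly_Mapping.keys p \<subseteq> carrier M"
  by (simp add: monoid_algebra_def)

lemma R_simps [simp]:
  "p \<oplus>\<^bsub>R\<^esub> q = p + q" "\<zero>\<^bsub>R\<^esub> = 0" "\<one>\<^bsub>R\<^esub> = Poly_Mapping.single \<one> 1"
  "c \<odot>\<^bsub>R\<^esub> p = Poly_Mapping.map ((*) c) p"
  by (simp_all add: monoid_algebra_def)

text \<open>Padding with zero coefficients puts the products of \<open>p\<close>, \<open>q\<close>
  and \<open>p + q\<close> over a common index set, where additivity can be read off term by
  term.\<close>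

lemma mult_superset:
  assumes "finite S" "finite T" "Poly_Mapping.keys p \<subseteq> S" "Poly_Mapping.keys q \<subseteq> T"
  shows "p \<otimes>\<^bsub>R\<^esub> q = (\<Sum>x\<in>S. \<Sum>y\<in>T.
    Poly_Mapping.single (x \<otimes> y) (Poly_Mapping.lookup p x * Poly_Mapping.lookup q y))"
proof -
  have "p \<otimes>\<^bsub>R\<^esub> q = (\<Sum>x\<in>Poly_Mapping.keys p. \<Sum>y\<in>Poly_Mapping.keys q.
      Poly_Mapping.single (x \<otimes> y) (Poly_Mapping.lookup p x * Poly_Mapping.lookup q y))"
    by (simp add: monoid_algebra_def)
  also have "\<dots> = (\<Sum>x\<in>Poly_Mapping.keys p. \<Sum>y\<in>T.
      Poly_Mapping.single (x \<otimes> y) (Poly_Mapping.lookup p x * Poly_Mapping.lookup q y))"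
    by (intro sum.cong refl sum.mono_neutral_left) (use assms in \<open>auto simp: in_keys_iff\<close>)
  also have "\<dots> = (\<Sum>x\<in>S. \<Sum>y\<in>T.
      Poly_Mapping.single (x \<otimes> y) (Poly_Mapping.lookup p x * Poly_Mapping.lookup q y))"
    by (intro sum.mono_neutral_left) (use assms in \<open>auto simp: in_keys_iff\<close>)
  finally show ?thesis .
qed

lemma mult_add_left: "(p + q) \<otimes>\<^bsub>R\<^esub> r = p \<otimes>\<^bsub>R\<^esub> r + q \<otimes>\<^bsub>R\<^esub> r"
proof -
  let ?S = "Poly_Mapping.keys p \<union> Poly_Mapping.keys q"
  have "Poly_Mapping.keys (p + q) \<subseteq> ?S" by (rule Poly_Mapping.keys_add)
  then show ?thesis
    by (subst (1 2 3) mult_superset[of ?S "Poly_Mapping.keys r"])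
      (auto simp: lookup_add distrib_right single_add sum.distrib)
qed

lemma mult_add_right: "r \<otimes>\<^bsub>R\<^esub> (p + q) = r \<otimes>\<^bsub>R\<^esub> p + r \<otimes>\<^bsub>R\<^esub> q"
proof -
  let ?S = "Poly_Mapping.keys p \<union> Poly_Mapping.keys q"
  have "Poly_Mapping.keys (p + q) \<subseteq> ?S" by (rule Poly_Mapping.keys_add)
  then show ?thesis
    by (subst (1 2 3) mult_superset[of "Poly_Mapping.keys r" ?S])
      (auto simp: lookup_add distrib_left single_add sum.distrib)
qed

lemma mult_zero [simp]: "0 \<otimes>\<^bsub>R\<^esub> p = 0" "p \<otimes>\<^bsub>R\<^esub> 0 = 0"
  by (simp_all add: monoid_algebra_def)

lemma mult_single [simp]:
  "Poly_Mapping.single x c \<otimes>\<^bsub>R\<^esub> Poly_Mapping.single y d = Poly_Mapping.single (x \<otimes> y) (c * d)"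
  by (subst mult_superset[of "{x}" "{y}"]) auto

lemma mult_diff_left: "(p - q) \<otimes>\<^bsub>R\<^esub> r = p \<otimes>\<^bsub>R\<^esub> r - q \<otimes>\<^bsub>R\<^esub> r"
  using mult_add_left[of "p - q" q r] by (simp add: algebra_simps)

lemma mult_diff_right: "r \<otimes>\<^bsub>R\<^esub> (p - q) = r \<otimes>\<^bsub>R\<^esub> p - r \<otimes>\<^bsub>R\<^esub> q"
  using mult_add_right[of r "p - q" q] by (simp add: algebra_simps)

lemma R_mult_closed:
  assumes "p \<in> carrier R" "q \<in> carrier R" shows "p \<otimes>\<^bsub>R\<^esub> q \<in> carrier R"
proof -
  have "Poly_Mapping.keys p \<subseteq> carrier M" "Poly_Mapping.keys q \<subseteq> carrier M"
    using assms by (auto simp: carrier_R)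
  then have "Poly_Mapping.keys (p \<otimes>\<^bsub>R\<^esub> q) \<subseteq> carrier M"
    unfolding mult_superset[OF finite_keys finite_keys subset_refl subset_refl]
    by (force dest!: subsetD[OF keys_sum] split: if_splits)
  then show ?thesis by (simp add: carrier_R)
qed

lemma R_add_closed: "p \<in> carrier R \<Longrightarrow> q \<in> carrier R \<Longrightarrow> p + q \<in> carrier R"
  using Poly_Mapping.keys_add[of p q] by (auto simp: carrier_R)

lemma R_induct [consumes 1, case_names zero single add]:
  assumes "p \<in> carrier R" and "P 0"
    and "\<And>x c. x \<in> carrier M \<Longrightarrow> P (Poly_Mapping.single x c)"
    and "\<And>p q. p \<in> carrier R \<Longrightarrow> q \<in> carrier R \<Longrightarrow> P p \<Longrightarrow> P q \<Longrightarrow> P (p + q)"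
  shows "P p"
proof -
  have "Poly_Mapping.keys p \<subseteq> carrier M" using assms(1) by (simp add: carrier_R)
  then show ?thesis by (rule pm_induct) (use assms(2-) in \<open>auto simp: carrier_R\<close>)
qed

lemma R_mult_assoc:
  assumes "p \<in> carrier R" "q \<in> carrier R" "r \<in> carrier R"
  shows "p \<otimes>\<^bsub>R\<^esub> q \<otimes>\<^bsub>R\<^esub> r = p \<otimes>\<^bsub>R\<^esub> (q \<otimes>\<^bsub>R\<^esub> r)"
  using assms(1)
proof (induction rule: R_induct)
  case (single x c)
  show ?case using assms(2)
  proof (induction rule: R_induct)
    case s2: (single y d)
    show ?case using assms(3)
      by (induction rule: R_induct) (use single s2 in \<open>auto simp: mult_add_right m_assoc mult.assoc\<close>)
  qed (auto simp: mult_add_left mult_add_right)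
qed (auto simp: mult_add_left)

lemma R_mult_one:
  assumes "p \<in> carrier R"
  shows "Poly_Mapping.single \<one> 1 \<otimes>\<^bsub>R\<^esub> p = p" "p \<otimes>\<^bsub>R\<^esub> Poly_Mapping.single \<one> 1 = p"
  using assms by (induction rule: R_induct) (auto simp: mult_add_right mult_add_left)

lemma R_ring: "ring R"
proof (intro ringI abelian_groupI monoidI, goal_cases)
  case (6 x)
  then show ?case by (intro bexI[of _ "- x"]) (auto simp: carrier_R)
qed (auto simp: R_mult_closed R_mult_assoc R_mult_one R_add_closed mult_add_left mult_add_right algebra_simps,
    auto simp: carrier_R)

lemma R_calg: "calg R"
proof (unfold calg_def calg_axioms_def, intro conjI allI impI R_ring, goal_cases)
  case (1 x c)
  then show ?case using keys_map_times[of c x] by (auto simp: carrier_R)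
next
  case (2 x c d)
  show ?case by (intro poly_mapping_eqI) (simp add: lookup_add algebra_simps)
next
  case (3 x y c)
  show ?case by (simp add: map_times_add)
next
  case (4 x c d)
  show ?case by (intro poly_mapping_eqI) (simp add: algebra_simps)
next
  case (5 x)
  show ?case by (intro poly_mapping_eqI) simp
next
  case (6 x y c)
  show ?case using 6(1)
  proof (induction rule: R_induct)
    case (single a e)
    show ?case using 6(2)
      by (induction rule: R_induct) (auto simp: mult_add_right map_times_add mult.assoc)
  qed (auto simp: mult_add_left map_times_add)
next
  case (7 x y c)
  show ?case using 7(1)
  proof (induction rule: R_induct)
    case (single a e)
    show ?case using 7(2)
      by (induction rule: R_induct) (auto simp: mult_add_right map_times_add algebra_simps)
  qed (auto simp: mult_add_left map_times_add)
qed

lemma single_in_R [simp]: "x \<in> carrier M \<Longrightarrow> Poly_Mapping.single x c \<in> carrier R"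
  by (auto simp: carrier_R)

lemma linext_lin_map:
  assumes "calg Z" "f \<in> carrier M \<rightarrow> carrier Z"
  shows "linext Z f \<in> lin_map R Z"
proof -
  interpret Z: calg Z by fact
  have *: "linext Z f (Poly_Mapping.map ((*) c) p) = c \<odot>\<^bsub>Z\<^esub> linext Z f p" if "p \<in> carrier R" for c p
    using that
  proof (induction rule: R_induct)
    case (single x d)
    then show ?case using assms by (auto simp: Z.linext_single Z.smult_assoc Pi_def)
  next
    case (add p q)
    have k: "Poly_Mapping.keys (Poly_Mapping.map ((*) c) p) \<subseteq> carrier M"
        "Poly_Mapping.keys (Poly_Mapping.map ((*) c) q) \<subseteq> carrier M"
        "Poly_Mapping.keys p \<subseteq> carrier M" "Poly_Mapping.keys q \<subseteq> carrier M"
      using add keys_map_times[of c] by (fastforce simp: carrier_R)+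
    then show ?case using add Z.linext_closed[OF assms(2)]
      by (simp add: map_times_add Z.linext_add[OF assms(2)] Z.smult_r_distr)
  qed auto
  show ?thesis
    using assms * unfolding lin_map_def
    by (auto simp: carrier_R Z.linext_add[OF assms(2)] intro!: Z.linext_closed[OF assms(2)])
qed

lemma linext_mult:
  assumes "calg Z" "f \<in> carrier M \<rightarrow> carrier Z"
    and "\<And>x y. x \<in> carrier M \<Longrightarrow> y \<in> carrier M \<Longrightarrow> f (x \<otimes> y) = f x \<otimes>\<^bsub>Z\<^esub> f y"
    and "p \<in> carrier R" "q \<in> carrier R"
  shows "linext Z f (p \<otimes>\<^bsub>R\<^esub> q) = linext Z f p \<otimes>\<^bsub>Z\<^esub> linext Z f q"
proof -
  interpret Z: calg Z by fact
  note L = linext_lin_map[OF assms(1,2)]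
  note add = lin_map_add[OF L, simplified]
  note cl = lin_map_closed[OF L] R_mult_closed
  show ?thesis using assms(4)
  proof (induction rule: R_induct)
    case zero
    show ?case using cl[OF assms(5)] by simp
  next
    case (single x c)
    show ?case using assms(5)
    proof (induction rule: R_induct)
      case zero
      show ?case using cl(1)[of "Poly_Mapping.single x c"] single by simp
    next
      case s2: (single y d)
      have "f x \<in> carrier Z" "f y \<in> carrier Z" using single s2 assms by auto
      then show ?case using single s2
        by (simp add: Z.linext_single assms(3) Z.smult_assoc[symmetric] Z.smult_mult_l Z.smult_mult_r mult.commute)
    next
      case a2: (add p q)
      then show ?case using single cl by (simp add: mult_add_right add Z.r_distr)
    qed
  next
    case a2: (add p r)
    then show ?case using assms(5) cl by (simp add: mult_add_left add Z.l_distr)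
  qed
qed

end

subsection \<open>Quotients of monoid algebras and tensor products\<close>

text \<open>\<open>qlift Z f\<close> is the map induced on a quotient by the linear extension of \<open>f\<close>; it generalises
  \<^const>\<open>tensor_lift\<close>.\<close>

definition qlift :: "('z, 'n) star_alg_scheme \<Rightarrow> ('x \<Rightarrow> 'z) \<Rightarrow> ('x \<Rightarrow>\<^sub>0 complex) set \<Rightarrow> 'z" where
  "qlift Z f X = (THE z. \<exists>p\<in>X. z = linext Z f p)"

lemma (in monoid_alg) star_add: "star R (p + q) = star R p + star R q"
proof -
  have st: "star R p = (\<Sum>x\<in>S. Poly_Mapping.single (v x) (cnj (Poly_Mapping.lookup p x)))"
    if "finite S" "Poly_Mapping.keys p \<subseteq> S" for p S
    unfolding monoid_algebra_def star_alg.simps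
    by (intro sum.mono_neutral_left) (use that in \<open>auto simp: in_keys_iff\<close>)
  let ?S = "Poly_Mapping.keys p \<union> Poly_Mapping.keys q"
  have "Poly_Mapping.keys (p + q) \<subseteq> ?S" by (rule Poly_Mapping.keys_add)
  then show ?thesis
    by (subst (1 2 3) st[of ?S]) (auto simp: lookup_add single_add sum.distrib)
qed

lemma (in monoid_alg) star_single [simp]:
  "star R (Poly_Mapping.single x c) = Poly_Mapping.single (v x) (cnj c)"
  by (cases "c = 0") (simp_all add: monoid_algebra_def)

lemma (in monoid_alg) star_zero [simp]: "star R 0 = 0"
  by (simp add: monoid_algebra_def)

lemma (in monoid_alg) star_diff: "star R (p - q) = star R p - star R q"
  using star_add[of "p - q" q] by simp

text \<open>One construction serves twice: the algebraic tensor product is the algebra of a monoid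
  of pairs modulo the bilinearity relations, and the sphere algebra is the algebra of words modulo
  its defining relations.\<close>

locale quot_alg = monoid_alg M v for M :: "('x, 'm) monoid_scheme" (structure) and v +
  fixes S :: "('x \<Rightarrow>\<^sub>0 complex) set"
  assumes S_carrier: "S \<subseteq> carrier (monoid_algebra M v)"
begin

sublocale R: calg R by (rule R_calg)

abbreviation I :: "('x \<Rightarrow>\<^sub>0 complex) set" where "I \<equiv> Idl\<^bsub>R\<^esub> S"
abbreviation Q :: "('x \<Rightarrow>\<^sub>0 complex) set star_alg" where "Q \<equiv> quot_star_alg R I"
abbreviation coset :: "('x \<Rightarrow>\<^sub>0 complex) \<Rightarrow> ('x \<Rightarrow>\<^sub>0 complex) set" where "coset p \<equiv> I +>\<^bsub>R\<^esub> p"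
abbreviation bas :: "'x \<Rightarrow> ('x \<Rightarrow>\<^sub>0 complex) set" where "bas x \<equiv> coset (Poly_Mapping.single x 1)"

sublocale I: ideal I R by (rule R.genideal_ideal) (rule S_carrier)

lemma R_minus: "p \<in> carrier R \<Longrightarrow> q \<in> carrier R \<Longrightarrow> p \<ominus>\<^bsub>R\<^esub> q = p - q"
proof -
  assume p: "p \<in> carrier R" "q \<in> carrier R"
  then have "p - q \<in> carrier R" by (auto simp: carrier_R) (metis (no_types) Un_iff keys_diff subset_iff)
  moreover have "(p - q) \<oplus>\<^bsub>R\<^esub> q = p" by simp
  ultimately show ?thesis using p by (metis R.add.inv_solve_right' a_minus_def a_inv_def)
qed

lemma Q_simps:
  "carrier Q = a_rcosets\<^bsub>R\<^esub> I" "X \<otimes>\<^bsub>Q\<^esub> Y = rcoset_mult R I X Y" "\<one>\<^bsub>Q\<^esub> = coset \<one>\<^bsub>R\<^esub>" "\<zero>\<^bsub>Q\<^esub> = I"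
  "X \<oplus>\<^bsub>Q\<^esub> Y = X <+>\<^bsub>R\<^esub> Y" "c \<odot>\<^bsub>Q\<^esub> X = (\<Union>x\<in>X. coset (c \<odot>\<^bsub>R\<^esub> x))"
  "star Q X = (\<Union>x\<in>X. coset (star R x))"
  by (simp_all add: quot_star_alg_def)

lemma coset_in_Q [simp, intro]: "p \<in> carrier R \<Longrightarrow> coset p \<in> carrier Q"
  unfolding Q_simps by (rule R.a_rcosetsI[OF I.a_subset])

lemma QE:
  assumes "X \<in> carrier Q" obtains p where "p \<in> carrier R" "X = coset p"
  using assms unfolding Q_simps A_RCOSETS_def RCOSETS_def a_r_coset_def by auto

lemma coset_mult: "p \<in> carrier R \<Longrightarrow> q \<in> carrier R \<Longrightarrow> coset p \<otimes>\<^bsub>Q\<^esub> coset q = coset (p \<otimes>\<^bsub>R\<^esub> q)"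
  unfolding Q_simps by (rule I.rcoset_mult_add)

lemma coset_add: "p \<in> carrier R \<Longrightarrow> q \<in> carrier R \<Longrightarrow> coset p \<oplus>\<^bsub>Q\<^esub> coset q = coset (p + q)"
  unfolding Q_simps using I.a_rcos_sum by simp

lemma coset_self: "p \<in> carrier R \<Longrightarrow> p \<in> coset p"
  by (rule I.a_rcos_self)

lemma coset_eq_iff:
  "p \<in> carrier R \<Longrightarrow> q \<in> carrier R \<Longrightarrow> coset p = coset q \<longleftrightarrow> p - q \<in> I"
  using I.a_rcos_module_minus[OF R.ring_axioms, of q p] I.a_repr_independence'[of p q]
    coset_self[of p] R_minus[of p q] by auto

lemma in_cosetD: "p \<in> carrier R \<Longrightarrow> q \<in> coset p \<Longrightarrow> q \<in> carrier R \<and> q - p \<in> I"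
  using I.a_rcos_module_minus[OF R.ring_axioms, of p q] R_minus[of q p]
    R.a_r_coset_subset_G[OF I.a_subset, of p] by auto

text \<open>Scaling by \<open>c\<close> is multiplication by the element \<open>c\<close> times 1,
  so a ring ideal is also a linear subspace.\<close>

lemma I_smult: "p \<in> I \<Longrightarrow> c \<odot>\<^bsub>R\<^esub> p \<in> I"
proof -
  assume p: "p \<in> I"
  then have "p \<in> carrier R" using I.a_subset by auto
  then have "c \<odot>\<^bsub>R\<^esub> p = (c \<odot>\<^bsub>R\<^esub> \<one>\<^bsub>R\<^esub>) \<otimes>\<^bsub>R\<^esub> p"
    by (subst R.smult_mult_l) (simp_all del: R_simps)
  then show ?thesis using I.I_l_closed[OF p] by (simp del: R_simps)
qed

text \<open>The definition forms a union over all representatives; as the ideal is a subspace, they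
  all give the same coset.\<close>

lemma coset_smult:
  assumes "p \<in> carrier R" shows "c \<odot>\<^bsub>Q\<^esub> coset p = coset (c \<odot>\<^bsub>R\<^esub> p)"
proof -
  have "coset (c \<odot>\<^bsub>R\<^esub> x) = coset (c \<odot>\<^bsub>R\<^esub> p)" if "x \<in> coset p" for x
  proof -
    from in_cosetD[OF assms that] have x: "x \<in> carrier R" "x - p \<in> I" by auto
    have "c \<odot>\<^bsub>R\<^esub> x - c \<odot>\<^bsub>R\<^esub> p = c \<odot>\<^bsub>R\<^esub> (x - p)"
      by (auto intro!: poly_mapping_eqI simp: lookup_minus right_diff_distrib)
    then show ?thesis using x assms I_smult[of "x - p" c]
      by (subst coset_eq_iff) (auto simp del: R_simps)
  qed
  then show ?thesis unfolding Q_simps using coset_self[OF assms] by blast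
qed

lemma coset_one: "coset (Poly_Mapping.single \<one> 1) = \<one>\<^bsub>Q\<^esub>"
  by (simp add: Q_simps)

text \<open>\<open>Q\<close> and \<open>R Quot I\<close> have the same carrier and the same ring
  operations, so the ring laws are transferred field by field.\<close>

lemma Q_ring: "ring Q"
proof -
  interpret F: ring "R Quot I" by (rule I.quotient_is_ring)
  have e: "carrier (R Quot I) = carrier Q" "mult (R Quot I) = mult Q" "one (R Quot I) = one Q"
    "zero (R Quot I) = zero Q" "add (R Quot I) = add Q"
    by (simp_all add: FactRing_def quot_star_alg_def)
  note [simp] = F.ring_simprules[unfolded e]
  show ?thesis
  proof (intro ringI abelian_groupI monoidI, goal_cases)
    case (6 x)
    then show ?case using F.l_neg[unfolded e] F.a_inv_closed[unfolded e] by blast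
  qed (simp_all add: F.a_assoc[unfolded e] F.a_comm[unfolded e] F.m_assoc[unfolded e]
    F.r_one[unfolded e])
qed

lemma Q_calg: "calg Q"
proof (unfold calg_def calg_axioms_def, intro conjI allI impI Q_ring)
  show "c \<odot>\<^bsub>Q\<^esub> x \<in> carrier Q" if "x \<in> carrier Q" for x c
    using that by (elim QE) (simp add: coset_smult del: R_simps)
  show "(c + d) \<odot>\<^bsub>Q\<^esub> x = c \<odot>\<^bsub>Q\<^esub> x \<oplus>\<^bsub>Q\<^esub> d \<odot>\<^bsub>Q\<^esub> x" if "x \<in> carrier Q" for x c d
    using that by (elim QE) (simp add: coset_smult coset_add R.smult_l_distr del: R_simps, simp)
  show "c \<odot>\<^bsub>Q\<^esub> (x \<oplus>\<^bsub>Q\<^esub> y) = c \<odot>\<^bsub>Q\<^esub> x \<oplus>\<^bsub>Q\<^esub> c \<odot>\<^bsub>Q\<^esub> y" if "x \<in> carrier Q" "y \<in> carrier Q" for x y c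
    using that by (elim QE) (simp add: coset_smult coset_add R_add_closed map_times_add
      R.smult_closed[simplified])
  show "(c * d) \<odot>\<^bsub>Q\<^esub> x = c \<odot>\<^bsub>Q\<^esub> (d \<odot>\<^bsub>Q\<^esub> x)" if "x \<in> carrier Q" for x c d
    using that by (elim QE) (simp add: coset_smult R.smult_assoc del: R_simps)
  show "1 \<odot>\<^bsub>Q\<^esub> x = x" if "x \<in> carrier Q" for x
    using that by (elim QE) (simp add: coset_smult del: R_simps)
  show "(c \<odot>\<^bsub>Q\<^esub> x) \<otimes>\<^bsub>Q\<^esub> y = c \<odot>\<^bsub>Q\<^esub> (x \<otimes>\<^bsub>Q\<^esub> y)" if "x \<in> carrier Q" "y \<in> carrier Q" for x y c
    using that by (elim QE) (simp add: coset_smult coset_mult R.smult_mult_l del: R_simps)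
  show "x \<otimes>\<^bsub>Q\<^esub> (c \<odot>\<^bsub>Q\<^esub> y) = c \<odot>\<^bsub>Q\<^esub> (x \<otimes>\<^bsub>Q\<^esub> y)" if "x \<in> carrier Q" "y \<in> carrier Q" for x y c
    using that by (elim QE) (simp add: coset_smult coset_mult R.smult_mult_r del: R_simps)
qed

sublocale Q: calg Q by (rule Q_calg)

lemma bas_mult: "x \<in> carrier M \<Longrightarrow> y \<in> carrier M \<Longrightarrow> bas x \<otimes>\<^bsub>Q\<^esub> bas y = bas (x \<otimes> y)"
  by (simp add: coset_mult)

lemma Q_induct [consumes 1, case_names bas add]:
  assumes "X \<in> carrier Q"
    and "\<And>x c. x \<in> carrier M \<Longrightarrow> P (c \<odot>\<^bsub>Q\<^esub> bas x)"
    and "\<And>X Y. X \<in> carrier Q \<Longrightarrow> Y \<in> carrier Q \<Longrightarrow> P X \<Longrightarrow> P Y \<Longrightarrow> P (X \<oplus>\<^bsub>Q\<^esub> Y)"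
  shows "P X"
proof -
  have single: "P (coset (Poly_Mapping.single x c))" if "x \<in> carrier M" for x c
    using assms(2)[OF that, of c] that by (simp add: coset_smult)
  have "P (coset p)" if "p \<in> carrier R" for p
    using that
  proof (induction rule: R_induct)
    case zero
    \<comment> \<open>Zero is 0 times the class of the unit, so the rule gets by without a case for
      it.\<close>
    show ?case using single[of \<one> 0] by simp
  next
    case (add p q)
    then show ?case using assms(3)[of "coset p" "coset q"] by (simp add: coset_add)
  qed (rule single)
  then show ?thesis using assms(1) by (elim QE) auto
qed

lemma lin_map_eqI:
  assumes "F \<in> lin_map Q Z" "G \<in> lin_map Q Z" "calg Z"
    and "\<And>x. x \<in> carrier M \<Longrightarrow> F (bas x) = G (bas x)" and "X \<in> carrier Q"
  shows "F X = G X"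
  using assms(5)
  by (induction rule: Q_induct)
    (simp_all add: lin_map_smult[OF assms(1)] lin_map_smult[OF assms(2)]
      lin_map_add[OF assms(1)] lin_map_add[OF assms(2)] assms(4))

text \<open>The kernel of a linear map is only a subspace. The set \<open>J\<close> of all elements
  whose two-sided multiples lie in the kernel is an ideal, and it contains \<open>S\<close>, hence
  the ideal generated by \<open>S\<close>.\<close>

lemma linext_vanishes_ideal:
  assumes Z: "calg Z" and f: "f \<in> carrier M \<rightarrow> carrier Z"
    and van: "\<And>a b s. a \<in> carrier M \<Longrightarrow> b \<in> carrier M \<Longrightarrow> s \<in> S \<Longrightarrow>
      linext Z f (Poly_Mapping.single a 1 \<otimes>\<^bsub>R\<^esub> s \<otimes>\<^bsub>R\<^esub> Poly_Mapping.single b 1) = \<zero>\<^bsub>Z\<^esub>"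
    and p: "p \<in> I"
  shows "linext Z f p = \<zero>\<^bsub>Z\<^esub>"
proof -
  interpret Z: calg Z by fact
  note L = linext_lin_map[OF Z f]
  note add = lin_map_add[OF L, simplified] and cl = lin_map_closed[OF L] R_mult_closed
    and sm = lin_map_smult[OF L]
  define J where "J = {p \<in> carrier R. \<forall>a\<in>carrier R. \<forall>b\<in>carrier R. linext Z f (a \<otimes>\<^bsub>R\<^esub> p \<otimes>\<^bsub>R\<^esub> b) = \<zero>\<^bsub>Z\<^esub>}"
  have single: "linext Z f (Poly_Mapping.single a c \<otimes>\<^bsub>R\<^esub> s \<otimes>\<^bsub>R\<^esub> Poly_Mapping.single b d) = \<zero>\<^bsub>Z\<^esub>"
    if "a \<in> carrier M" "b \<in> carrier M" "s \<in> S" for a b c d s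
  proof -
    have s: "s \<in> carrier R" using S_carrier that by auto
    have "Poly_Mapping.single a c \<otimes>\<^bsub>R\<^esub> s \<otimes>\<^bsub>R\<^esub> Poly_Mapping.single b d =
        c \<odot>\<^bsub>R\<^esub> (d \<odot>\<^bsub>R\<^esub> (Poly_Mapping.single a 1 \<otimes>\<^bsub>R\<^esub> s \<otimes>\<^bsub>R\<^esub> Poly_Mapping.single b 1))"
      using that s R.smult_mult_l[of "Poly_Mapping.single a 1" s c]
        R.smult_mult_l[of "Poly_Mapping.single a 1 \<otimes>\<^bsub>R\<^esub> s" "Poly_Mapping.single b d" c]
        R.smult_mult_r[of "Poly_Mapping.single a 1 \<otimes>\<^bsub>R\<^esub> s" "Poly_Mapping.single b 1" d]
      by (simp add: R_mult_closed)
    then show ?thesis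
      using that s van by (simp add: sm R_mult_closed R.smult_closed del: R_simps)
  qed
  have "S \<subseteq> J"
  proof
    fix s assume s: "s \<in> S"
    then have sR: "s \<in> carrier R" using S_carrier by auto
    have "linext Z f (a \<otimes>\<^bsub>R\<^esub> s \<otimes>\<^bsub>R\<^esub> b) = \<zero>\<^bsub>Z\<^esub>" if ab: "a \<in> carrier R" "b \<in> carrier R" for a b
      using ab(1)
    proof (induction rule: R_induct)
      case s1: (single x c)
      show ?case using ab(2)
        by (induction rule: R_induct)
          (use s1 s sR in \<open>auto simp: single mult_add_right add cl\<close>)
    qed (use ab sR in \<open>auto simp: mult_add_left add cl\<close>)
    then show "s \<in> J" using sR by (simp add: J_def)
  qed
  moreover have "ideal J R"
  proof (rule idealI[OF R_ring])
    show "subgroup J (add_monoid R)"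
    proof (rule R.add.subgroupI, goal_cases)
      case 1
      show ?case by (auto simp: J_def)
    next
      case 2
      have "0 \<in> J" by (simp add: J_def) (simp add: carrier_R)
      then show ?case by auto
    next
      case (3 p)
      then have pR: "p \<in> carrier R" by (simp add: J_def)
      have "\<ominus>\<^bsub>R\<^esub> p = (- 1) \<odot>\<^bsub>R\<^esub> p" using R.smult_minus_one[OF pR] by simp
      then have "\<ominus>\<^bsub>R\<^esub> p \<in> J" using 3
        by (auto simp: J_def R.smult_mult_l R.smult_mult_r R_mult_closed sm
          simp del: R_simps)
      then show ?case by (simp add: a_inv_def)
    next
      case (4 p q)
      then show ?case
        by (simp add: J_def R_add_closed mult_add_left mult_add_right add cl)
    qed
    show "x \<otimes>\<^bsub>R\<^esub> p \<in> J" if "p \<in> J" "x \<in> carrier R" for p x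
      using that by (auto simp: J_def R_mult_closed R_mult_assoc[symmetric])
    show "p \<otimes>\<^bsub>R\<^esub> x \<in> J" if "p \<in> J" "x \<in> carrier R" for p x
    proof -
      have "a \<otimes>\<^bsub>R\<^esub> (p \<otimes>\<^bsub>R\<^esub> x) \<otimes>\<^bsub>R\<^esub> b = a \<otimes>\<^bsub>R\<^esub> p \<otimes>\<^bsub>R\<^esub> (x \<otimes>\<^bsub>R\<^esub> b)"
        if "a \<in> carrier R" "b \<in> carrier R" for a b
        using that \<open>p \<in> J\<close> \<open>x \<in> carrier R\<close> by (simp add: J_def R_mult_assoc R_mult_closed)
      then show ?thesis using that by (auto simp: J_def R_mult_closed)
    qed
  qed
  ultimately have "I \<subseteq> J" by (intro R.genideal_minimal)
  then have "p \<in> J" using p by blast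
  then have "linext Z f (\<one>\<^bsub>R\<^esub> \<otimes>\<^bsub>R\<^esub> p \<otimes>\<^bsub>R\<^esub> \<one>\<^bsub>R\<^esub>) = \<zero>\<^bsub>Z\<^esub>" and pR: "p \<in> carrier R"
    using R.one_closed unfolding J_def by blast+
  then show ?thesis by (simp only: R.l_one[OF pR] R.r_one[OF pR])
qed

context
  fixes Z :: "('z, 'n) star_alg_scheme" and f :: "'x \<Rightarrow> 'z"
  assumes Z: "calg Z" and f: "f \<in> carrier M \<rightarrow> carrier Z"
    and van: "\<And>a b s. a \<in> carrier M \<Longrightarrow> b \<in> carrier M \<Longrightarrow> s \<in> S \<Longrightarrow>
      linext Z f (Poly_Mapping.single a 1 \<otimes>\<^bsub>R\<^esub> s \<otimes>\<^bsub>R\<^esub> Poly_Mapping.single b 1) = \<zero>\<^bsub>Z\<^esub>"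
begin

text \<open>The definite description in \<open>qlift\<close> is meaningful because the linear
  extension is constant on each coset.\<close>

lemma qlift_coset: "p \<in> carrier R \<Longrightarrow> qlift Z f (coset p) = linext Z f p"
proof -
  assume p: "p \<in> carrier R"
  interpret Z: calg Z by (rule Z)
  have "linext Z f q = linext Z f p" if "q \<in> coset p" for q
  proof -
    from in_cosetD[OF p that] have q: "q \<in> carrier R" "q - p \<in> I" by auto
    then have "q - p \<in> carrier R" using I.a_subset by auto
    then have "linext Z f (p + (q - p)) = linext Z f p \<oplus>\<^bsub>Z\<^esub> linext Z f (q - p)"
      using lin_map_add[OF linext_lin_map[OF Z f] p, of "q - p"] by simp
    also have "\<dots> = linext Z f p"
      using linext_vanishes_ideal[OF Z f van q(2)] lin_map_closed[OF linext_lin_map[OF Z f] p] by simp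
    finally show ?thesis by simp
  qed
  then show ?thesis unfolding qlift_def using coset_self[OF p] by (intro the_equality) (blast, metis)
qed

lemma qlift_bas: "x \<in> carrier M \<Longrightarrow> qlift Z f (bas x) = f x"
proof -
  assume x: "x \<in> carrier M"
  interpret Z: calg Z by (rule Z)
  have fx: "f x \<in> carrier Z" using f x by auto
  show ?thesis using qlift_coset[of "Poly_Mapping.single x 1"] x Z.linext_single[of f x 1] fx by simp
qed

lemma qlift_lin_map: "qlift Z f \<in> lin_map Q Z"
  unfolding lin_map_def
proof (intro CollectI conjI ballI allI funcsetI)
  note L = linext_lin_map[OF Z f]
  show "qlift Z f X \<in> carrier Z" if "X \<in> carrier Q" for X
    using that by (elim QE) (simp add: qlift_coset lin_map_closed[OF L])
  show "qlift Z f (X \<oplus>\<^bsub>Q\<^esub> Y) = qlift Z f X \<oplus>\<^bsub>Z\<^esub> qlift Z f Y"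
    if "X \<in> carrier Q" "Y \<in> carrier Q" for X Y
    using that by (elim QE) (use lin_map_add[OF L] in \<open>simp add: qlift_coset coset_add R_add_closed\<close>)
  show "qlift Z f (c \<odot>\<^bsub>Q\<^esub> X) = c \<odot>\<^bsub>Z\<^esub> qlift Z f X" if "X \<in> carrier Q" for c X
    using that
    by (elim QE) (simp add: qlift_coset coset_smult lin_map_smult[OF L] R.smult_closed del: R_simps)
qed

lemma qlift_alg_hom:
  assumes "\<And>x y. x \<in> carrier M \<Longrightarrow> y \<in> carrier M \<Longrightarrow> f (x \<otimes> y) = f x \<otimes>\<^bsub>Z\<^esub> f y"
    and "f \<one> = \<one>\<^bsub>Z\<^esub>"
  shows "qlift Z f \<in> alg_hom Q Z"
proof (rule alg_homI[OF qlift_lin_map])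
  show "qlift Z f \<one>\<^bsub>Q\<^esub> = \<one>\<^bsub>Z\<^esub>" using qlift_bas[of \<one>] assms(2) by (simp add: coset_one)
  show "qlift Z f (X \<otimes>\<^bsub>Q\<^esub> Y) = qlift Z f X \<otimes>\<^bsub>Z\<^esub> qlift Z f Y"
    if "X \<in> carrier Q" "Y \<in> carrier Q" for X Y
    using that
    by (elim QE) (simp add: qlift_coset coset_mult R_mult_closed linext_mult[OF Z f assms(1)])
qed

end

end

locale star_quot_alg = quot_alg M v S
  for M :: "('x, 'm) monoid_scheme" (structure) and v S +
  assumes v_closed: "x \<in> carrier M \<Longrightarrow> v x \<in> carrier M"
    and v_mult: "x \<in> carrier M \<Longrightarrow> y \<in> carrier M \<Longrightarrow> v (x \<otimes> y) = v y \<otimes> v x"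
    and S_star: "s \<in> S \<Longrightarrow> star (monoid_algebra M v) s \<in> Idl\<^bsub>monoid_algebra M v\<^esub> S"
begin

lemma star_closed: "p \<in> carrier R \<Longrightarrow> star R p \<in> carrier R"
  by (induction rule: R_induct) (auto simp: star_add R_add_closed v_closed carrier_R[of 0])

lemma star_mult:
  assumes "p \<in> carrier R" "q \<in> carrier R"
  shows "star R (p \<otimes>\<^bsub>R\<^esub> q) = star R q \<otimes>\<^bsub>R\<^esub> star R p"
  using assms(1)
proof (induction rule: R_induct)
  case (single x c)
  show ?case using assms(2)
    by (induction rule: R_induct)
      (simp_all add: star_add mult_add_left mult_add_right mult.commute v_mult single)
qed (simp_all add: star_add mult_add_left mult_add_right)

text \<open>The preimage of the ideal under the involution is again an ideal, so it is enough that
  it contains the generators.\<close>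

lemma I_star: "p \<in> I \<Longrightarrow> star R p \<in> I"
proof -
  define J where "J = {p \<in> carrier R. star R p \<in> I}"
  have "ideal J R"
  proof (rule idealI[OF R_ring])
    show "subgroup J (add_monoid R)"
    proof (rule R.add.subgroupI, goal_cases)
      case 1
      show ?case by (auto simp: J_def)
    next
      case 2
      have "0 \<in> J" using I.zero_closed by (simp add: J_def carrier_R[of 0])
      then show ?case by auto
    next
      case (3 p)
      then have p: "p \<in> carrier R" "star R p \<in> I" by (auto simp: J_def)
      have "star R (\<ominus>\<^bsub>R\<^esub> p) = \<ominus>\<^bsub>R\<^esub> (star R p)"
        using star_add[of "\<ominus>\<^bsub>R\<^esub> p" p] R.l_neg[of p] p star_closed
        by (intro R.minus_equality[symmetric]) auto
      then show ?case using p I.a_inv_closed[of "star R p"] by (simp add: J_def)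
    next
      case (4 p q)
      then show ?case using I.a_closed by (auto simp: J_def star_add R_add_closed)
    qed
  qed (auto simp: J_def star_mult R_mult_closed star_closed intro: I.I_l_closed I.I_r_closed)
  moreover have "S \<subseteq> J" using S_carrier S_star by (auto simp: J_def)
  ultimately have "I \<subseteq> J" by (intro R.genideal_minimal)
  then show "p \<in> I \<Longrightarrow> star R p \<in> I" by (auto simp: J_def)
qed

lemma star_coset: "p \<in> carrier R \<Longrightarrow> star Q (coset p) = coset (star R p)"
proof -
  assume p: "p \<in> carrier R"
  have "coset (star R q) = coset (star R p)" if "q \<in> coset p" for q
    using in_cosetD[OF p that] I_star[of "q - p"] p
    by (subst coset_eq_iff) (auto simp: star_diff star_closed)
  then show ?thesis unfolding Q_simps using coset_self[OF p] by blast
qed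

lemma star_bas: "x \<in> carrier M \<Longrightarrow> star Q (bas x) = bas (v x)"
  by (simp add: star_coset)

end

lemma (in calg) add_minus_minus:
  "a \<in> carrier A \<Longrightarrow> b \<in> carrier A \<Longrightarrow> (a \<oplus> b) \<ominus> a \<ominus> b = \<zero>"
proof -
  assume ab: "a \<in> carrier A" "b \<in> carrier A"
  then have "(a \<oplus> b) \<ominus> a = b \<oplus> (a \<oplus> \<ominus> a)" by (simp only: a_minus_def a_comm[OF ab] a_assoc a_inv_closed)
  then show ?thesis using ab by (simp add: a_minus_def r_neg)
qed

lemma (in calg) minus_self: "a \<in> carrier A \<Longrightarrow> a \<ominus> a = \<zero>"
  by (simp add: a_minus_def r_neg)

lemma (in quot_alg) linext_diff:
  assumes "calg Z" "f \<in> carrier M \<rightarrow> carrier Z" "p \<in> carrier R" "q \<in> carrier R"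
  shows "linext Z f (p - q) = linext Z f p \<ominus>\<^bsub>Z\<^esub> linext Z f q"
proof -
  interpret Z: calg Z by fact
  note L = linext_lin_map[OF assms(1,2)]
  have "linext Z f (p \<oplus>\<^bsub>R\<^esub> (- 1) \<odot>\<^bsub>R\<^esub> q) = linext Z f p \<oplus>\<^bsub>Z\<^esub> (- 1) \<odot>\<^bsub>Z\<^esub> linext Z f q"
    using assms by (simp add: lin_map_add[OF L] lin_map_smult[OF L] R.smult_closed del: R_simps)
  moreover have "p \<oplus>\<^bsub>R\<^esub> (- 1) \<odot>\<^bsub>R\<^esub> q = p - q"
    by (intro poly_mapping_eqI) (simp add: lookup_add lookup_minus)
  ultimately show ?thesis
    using assms lin_map_closed[OF L] by (simp add: Z.minus_smult)
qed

lemma (in monoid_alg) R_diff_closed: "p \<in> carrier R \<Longrightarrow> q \<in> carrier R \<Longrightarrow> p - q \<in> carrier R"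
  using keys_diff[of p q] by (auto simp: carrier_R)

section \<open>Universal property of the algebraic tensor product\<close>

definition bilin ::
  "('v, 'm) star_alg_scheme \<Rightarrow> ('w, 'n) star_alg_scheme \<Rightarrow> ('z, 'o) star_alg_scheme \<Rightarrow>
    ('v \<Rightarrow> 'w \<Rightarrow> 'z) \<Rightarrow> bool" where
  "bilin V W Z \<phi> \<longleftrightarrow> (\<forall>x\<in>carrier V. \<phi> x \<in> lin_map W Z) \<and> (\<forall>y\<in>carrier W. (\<lambda>x. \<phi> x y) \<in> lin_map V Z)"

locale tensor_prod = V: calg V + W: calg W
  for V :: "('v, 'm) star_alg_scheme" and W :: "('w, 'n) star_alg_scheme"
begin

sublocale quot_alg "V \<times>\<times> W" "\<lambda>(x, y). (star V x, star W y)" "bilinear_rels V W"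
proof (unfold quot_alg_def quot_alg_axioms_def monoid_alg_def, intro conjI)
  show "Group.monoid (V \<times>\<times> W)"
    using V.monoid_axioms W.monoid_axioms by (rule DirProd_monoid)
  then interpret T: monoid_alg "V \<times>\<times> W" "\<lambda>(x, y). (star V x, star W y)"
    by (simp add: monoid_alg_def)
  show "bilinear_rels V W \<subseteq> carrier T.R"
    unfolding bilinear_rels_def by (auto intro!: T.R_diff_closed)
qed

lemma tensor_eq: "tensor V W = Q" "tens V W x y = bas (x, y)"
  by (simp_all add: tensor_def tens_def tensor_null_def free_pairs_def)

lemma tens_closed: "x \<in> carrier V \<Longrightarrow> y \<in> carrier W \<Longrightarrow> tens V W x y \<in> carrier (tensor V W)"
  by (simp add: tensor_eq)

lemma I_mem: "s \<in> bilinear_rels V W \<Longrightarrow> s \<in> I"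
  using R.genideal_self[OF S_carrier] by auto

lemma tens_add_left:
  assumes "x \<in> carrier V" "x' \<in> carrier V" "y \<in> carrier W"
  shows "tens V W (x \<oplus>\<^bsub>V\<^esub> x') y = tens V W x y \<oplus>\<^bsub>tensor V W\<^esub> tens V W x' y"
proof -
  have "Poly_Mapping.single (x \<oplus>\<^bsub>V\<^esub> x', y) 1 - Poly_Mapping.single (x, y) 1 -
      Poly_Mapping.single (x', y) 1 \<in> bilinear_rels V W"
    using assms unfolding bilinear_rels_def by blast
  from I_mem[OF this] show ?thesis using assms
    by (simp add: tensor_eq coset_add) (subst coset_eq_iff, auto simp: R_add_closed diff_diff_eq)
qed

lemma tens_add_right:
  assumes "x \<in> carrier V" "y \<in> carrier W" "y' \<in> carrier W"
  shows "tens V W x (y \<oplus>\<^bsub>W\<^esub> y') = tens V W x y \<oplus>\<^bsub>tensor V W\<^esub> tens V W x y'"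
proof -
  have "Poly_Mapping.single (x, y \<oplus>\<^bsub>W\<^esub> y') 1 - Poly_Mapping.single (x, y) 1 -
      Poly_Mapping.single (x, y') 1 \<in> bilinear_rels V W"
    using assms unfolding bilinear_rels_def by blast
  from I_mem[OF this] show ?thesis using assms
    by (simp add: tensor_eq coset_add) (subst coset_eq_iff, auto simp: R_add_closed diff_diff_eq)
qed

lemma tens_smult_left:
  assumes "x \<in> carrier V" "y \<in> carrier W"
  shows "tens V W (c \<odot>\<^bsub>V\<^esub> x) y = c \<odot>\<^bsub>tensor V W\<^esub> tens V W x y"
proof -
  have "Poly_Mapping.single (c \<odot>\<^bsub>V\<^esub> x, y) 1 - Poly_Mapping.single (x, y) c \<in> bilinear_rels V W"
    using assms unfolding bilinear_rels_def by blast
  from I_mem[OF this] show ?thesis using assms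
    by (simp add: tensor_eq coset_smult) (subst coset_eq_iff, auto)
qed

lemma tens_smult_right:
  assumes "x \<in> carrier V" "y \<in> carrier W"
  shows "tens V W x (c \<odot>\<^bsub>W\<^esub> y) = c \<odot>\<^bsub>tensor V W\<^esub> tens V W x y"
proof -
  have "Poly_Mapping.single (x, c \<odot>\<^bsub>W\<^esub> y) 1 - Poly_Mapping.single (x, y) c \<in> bilinear_rels V W"
    using assms unfolding bilinear_rels_def by blast
  from I_mem[OF this] show ?thesis using assms
    by (simp add: tensor_eq coset_smult) (subst coset_eq_iff, auto)
qed

lemma tens_mult:
  assumes "x \<in> carrier V" "y \<in> carrier W" "x' \<in> carrier V" "y' \<in> carrier W"
  shows "tens V W x y \<otimes>\<^bsub>tensor V W\<^esub> tens V W x' y' = tens V W (x \<otimes>\<^bsub>V\<^esub> x') (y \<otimes>\<^bsub>W\<^esub> y')"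
  using assms by (simp add: tensor_eq bas_mult)

lemma tens_one: "tens V W \<one>\<^bsub>V\<^esub> \<one>\<^bsub>W\<^esub> = \<one>\<^bsub>tensor V W\<^esub>"
  by (simp add: tensor_eq flip: coset_one)

text \<open>The involution maps bilinearity relations to bilinearity relations, with conjugated
  scalars, so the involution on pairs passes to the quotient.\<close>

lemma tens_star:
  assumes "star_algebra V" "star_algebra W" "x \<in> carrier V" "y \<in> carrier W"
  shows "star (tensor V W) (tens V W x y) = tens V W (star V x) (star W y)"
proof -
  note V_star = assms(1)[unfolded star_algebra_def]
  note W_star = assms(2)[unfolded star_algebra_def]
  interpret star_quot_alg "V \<times>\<times> W" "\<lambda>(x, y). (star V x, star W y)" "bilinear_rels V W"
  proof unfold_locales
    show "star R s \<in> I" if "s \<in> bilinear_rels V W" for s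
    proof (rule I_mem)
      show "star R s \<in> bilinear_rels V W"
        using that unfolding bilinear_rels_def
      proof (elim UnE CollectE exE conjE, goal_cases)
        case (1 x x' y)
        then show ?case using V_star W_star
          by (intro UnI1 CollectI exI[of _ "star V x"] exI[of _ "star V x'"] exI[of _ "star W y"])
            (simp add: star_diff)
      next
        case (2 x y y')
        then show ?case using V_star W_star
          by (intro UnI1[OF UnI1[OF UnI2]] CollectI exI[of _ "star V x"] exI[of _ "star W y"]
              exI[of _ "star W y'"]) (simp add: star_diff)
      next
        case (3 c x y)
        then show ?case using V_star W_star
          by (intro UnI1[OF UnI2] CollectI exI[of _ "cnj c"] exI[of _ "star V x"] exI[of _ "star W y"])
            (simp add: star_diff)
      next
        case (4 c x y)
        then show ?case using V_star W_star
          by (intro UnI2 CollectI exI[of _ "cnj c"] exI[of _ "star V x"] exI[of _ "star W y"])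
            (simp add: star_diff)
      qed
    qed
  qed (use V_star W_star in auto)
  show ?thesis using assms star_bas[of "(x, y)"] by (simp add: tensor_eq)
qed

lemma tensor_calg: "calg (tensor V W)"
  unfolding tensor_eq by (rule Q_calg)

lemma bilin_tens: "bilin V W (tensor V W) (tens V W)"
  unfolding bilin_def lin_map_def
  by (auto simp: tens_closed tens_add_left tens_add_right tens_smult_left tens_smult_right)

text \<open>A scalar can be absorbed in the left factor, so pure tensors and their sums exhaust the
  tensor product.\<close>

lemma tensor_induct [consumes 1, case_names tens add]:
  assumes "X \<in> carrier (tensor V W)"
    and "\<And>x y. x \<in> carrier V \<Longrightarrow> y \<in> carrier W \<Longrightarrow> P (tens V W x y)"
    and "\<And>X Y. X \<in> carrier (tensor V W) \<Longrightarrow> Y \<in> carrier (tensor V W) \<Longrightarrow> P X \<Longrightarrow> P Y \<Longrightarrow>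
      P (X \<oplus>\<^bsub>tensor V W\<^esub> Y)"
  shows "P X"
  using assms(1) unfolding tensor_eq(1)
proof (induction rule: Q_induct)
  case (bas p c)
  then obtain x y where p: "p = (x, y)" "x \<in> carrier V" "y \<in> carrier W" by (cases p) auto
  then have "P (tens V W (c \<odot>\<^bsub>V\<^esub> x) y)" by (intro assms(2)) auto
  then show ?case using p by (simp add: tens_smult_left) (simp add: tensor_eq)
qed (use assms(3) in \<open>simp add: tensor_eq\<close>)

context
  fixes Z :: "('z, 'o) star_alg_scheme" and \<phi> :: "'v \<Rightarrow> 'w \<Rightarrow> 'z"
  assumes Z: "calg Z" and bl: "bilin V W Z \<phi>"
begin

lemma tensor_lift_eq: "tensor_lift Z \<phi> = qlift Z (\<lambda>(x, y). \<phi> x y)"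
proof -
  have "(\<lambda>(x, y). Poly_Mapping.lookup p (x, y) \<odot>\<^bsub>Z\<^esub> \<phi> x y) =
      (\<lambda>xy. Poly_Mapping.lookup p xy \<odot>\<^bsub>Z\<^esub> (\<lambda>(x, y). \<phi> x y) xy)" for p
    by (auto simp: fun_eq_iff)
  then show ?thesis by (intro ext) (simp only: tensor_lift_def qlift_def linext_def)
qed

lemma bilin_closed: "x \<in> carrier V \<Longrightarrow> y \<in> carrier W \<Longrightarrow> \<phi> x y \<in> carrier Z"
  using bl by (auto simp: bilin_def lin_map_def)

lemma bilin_fun: "(\<lambda>(x, y). \<phi> x y) \<in> carrier (V \<times>\<times> W) \<rightarrow> carrier Z"
  using bilin_closed by auto

text \<open>Multiplication is bilinear in both factors, so a bilinearity relation multiplied by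
  pairs on both sides is a relation of the same kind, and bilinearity of \<open>\<phi>\<close> sends
  it to zero.\<close>

lemma bilin_vanish:
  assumes "a \<in> carrier (V \<times>\<times> W)" "b \<in> carrier (V \<times>\<times> W)" "s \<in> bilinear_rels V W"
  shows "linext Z (\<lambda>(x, y). \<phi> x y)
    (Poly_Mapping.single a 1 \<otimes>\<^bsub>R\<^esub> s \<otimes>\<^bsub>R\<^esub> Poly_Mapping.single b 1) = \<zero>\<^bsub>Z\<^esub>"
proof -
  interpret Z: calg Z by (rule Z)
  note f = bilin_fun
  obtain a1 a2 b1 b2 where ab: "a = (a1, a2)" "b = (b1, b2)" "a1 \<in> carrier V" "a2 \<in> carrier W"
      "b1 \<in> carrier V" "b2 \<in> carrier W"
    using assms by (cases a, cases b) auto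
  have add1: "\<phi> (x \<oplus>\<^bsub>V\<^esub> x') y = \<phi> x y \<oplus>\<^bsub>Z\<^esub> \<phi> x' y"
    if "x \<in> carrier V" "x' \<in> carrier V" "y \<in> carrier W" for x x' y
    using bl that by (auto simp: bilin_def lin_map_def)
  have add2: "\<phi> x (y \<oplus>\<^bsub>W\<^esub> y') = \<phi> x y \<oplus>\<^bsub>Z\<^esub> \<phi> x y'"
    if "x \<in> carrier V" "y \<in> carrier W" "y' \<in> carrier W" for x y y'
    using bl that by (auto simp: bilin_def lin_map_def)
  have sm1: "\<phi> (c \<odot>\<^bsub>V\<^esub> x) y = c \<odot>\<^bsub>Z\<^esub> \<phi> x y" "\<phi> x (c \<odot>\<^bsub>W\<^esub> y) = c \<odot>\<^bsub>Z\<^esub> \<phi> x y"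
    if "x \<in> carrier V" "y \<in> carrier W" for x y c
    using bl that by (auto simp: bilin_def lin_map_def)
  note sms = V.smult_mult_l V.smult_mult_r W.smult_mult_l W.smult_mult_r
  from assms(3) show ?thesis
    unfolding bilinear_rels_def ab
    by (elim UnE CollectE exE conjE)
      (use ab in \<open>simp_all add: mult_diff_left mult_diff_right linext_diff[OF Z f] Z.linext_single
        R_diff_closed bilin_closed V.l_distr V.r_distr W.l_distr W.r_distr add1 add2
        Z.add_minus_minus sms sm1 Z.minus_self\<close>)
qed

lemma tensor_lift_tens: "x \<in> carrier V \<Longrightarrow> y \<in> carrier W \<Longrightarrow> tensor_lift Z \<phi> (tens V W x y) = \<phi> x y"
  unfolding tensor_lift_eq tensor_eq
  using qlift_bas[OF Z bilin_fun bilin_vanish, of "(x, y)"] by auto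

lemma tensor_lift_lin_map: "tensor_lift Z \<phi> \<in> lin_map (tensor V W) Z"
  unfolding tensor_lift_eq tensor_eq
  by (rule qlift_lin_map[OF Z bilin_fun bilin_vanish])

lemma tensor_lift_alg_hom:
  assumes "\<And>x y x' y'. x \<in> carrier V \<Longrightarrow> y \<in> carrier W \<Longrightarrow> x' \<in> carrier V \<Longrightarrow> y' \<in> carrier W \<Longrightarrow>
      \<phi> (x \<otimes>\<^bsub>V\<^esub> x') (y \<otimes>\<^bsub>W\<^esub> y') = \<phi> x y \<otimes>\<^bsub>Z\<^esub> \<phi> x' y'"
    and "\<phi> \<one>\<^bsub>V\<^esub> \<one>\<^bsub>W\<^esub> = \<one>\<^bsub>Z\<^esub>"
  shows "tensor_lift Z \<phi> \<in> alg_hom (tensor V W) Z"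
proof -
  from qlift_alg_hom[OF Z bilin_fun bilin_vanish] show ?thesis
    unfolding tensor_lift_eq tensor_eq using assms by auto
qed

end

end

section \<open>Weight functions on SU(3)\<close>

text \<open>Artin's argument: the relation at \<open>m g h\<close> minus \<open>ch j h\<close> times
  the relation at \<open>g\<close> no longer involves \<open>j\<close>. It is stated for a set
  closed under an operation because one of its uses concerns a polydisc, which is not a group. The
  point \<open>g0\<close>, where no character vanishes, finally gives the coefficient of
  \<open>j\<close>.\<close>

lemma characters_independent:
  fixes ch :: "'i \<Rightarrow> 'g \<Rightarrow> complex"
  assumes "finite I" and "g0 \<in> G"
    and "\<And>g h. g \<in> G \<Longrightarrow> h \<in> G \<Longrightarrow> m g h \<in> G"
    and "\<And>i g h. i \<in> I \<Longrightarrow> g \<in> G \<Longrightarrow> h \<in> G \<Longrightarrow> ch i (m g h) = ch i g * ch i h"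
    and "\<And>i. i \<in> I \<Longrightarrow> ch i g0 \<noteq> 0"
    and "\<And>i j. i \<in> I \<Longrightarrow> j \<in> I \<Longrightarrow> i \<noteq> j \<Longrightarrow> \<exists>g\<in>G. ch i g \<noteq> ch j g"
    and "\<And>g. g \<in> G \<Longrightarrow> (\<Sum>i\<in>I. a i * ch i g) = 0"
    and "i \<in> I"
  shows "a i = 0"
  using assms(1,4-8)
proof (induction I arbitrary: a i)
  case (insert j I)
  have eq: "a j * ch j g + (\<Sum>i\<in>I. a i * ch i g) = 0" if "g \<in> G" for g
    using insert.prems(4)[OF that] insert.hyps by simp
  have zero: "a i = 0" if i: "i \<in> I" for i
  proof -
    have "a i * (ch i h - ch j h) = 0" if h: "h \<in> G" for h
    proof (rule insert.IH[of "\<lambda>i. a i * (ch i h - ch j h)"])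
      show "(\<Sum>i\<in>I. a i * (ch i h - ch j h) * ch i g) = 0" if g: "g \<in> G" for g
      proof -
        have "(\<Sum>i\<in>I. a i * (ch i h - ch j h) * ch i g) =
            (\<Sum>i\<in>I. a i * ch i (m g h)) - ch j h * (\<Sum>i\<in>I. a i * ch i g)"
          unfolding sum_distrib_left sum_subtractf[symmetric]
          by (intro sum.cong refl) (use insert.prems(1) g h in \<open>auto simp: algebra_simps\<close>)
        also have "\<dots> = (- a j * ch j (m g h)) - ch j h * (- a j * ch j g)"
        proof -
          have "(\<Sum>i\<in>I. a i * ch i (m g h)) = - a j * ch j (m g h)"
            using eq[OF assms(3)[OF g h]] by (simp add: add_eq_0_iff)
          moreover have "(\<Sum>i\<in>I. a i * ch i g) = - a j * ch j g"
            using eq[OF g] by (simp add: add_eq_0_iff)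
          ultimately show ?thesis by simp
        qed
        also have "\<dots> = 0" using insert.prems(1) g h by simp
        finally show ?thesis .
      qed
    qed (use insert.prems i in auto)
    moreover obtain h where "h \<in> G" "ch i h \<noteq> ch j h"
      using insert.prems(3)[of i j] insert.hyps i by auto
    ultimately show ?thesis by (metis eq_iff_diff_eq_0 mult_eq_0_iff)
  qed
  moreover have "a j = 0"
    using eq[OF assms(2)] zero insert.prems(2)[of j] by simp
  ultimately show ?case using insert.prems(5) by auto
qed simp

section \<open>SU(3), the action of its maximal torus, and weight decompositions\<close>

definition adj :: "complex^3^3 \<Rightarrow> complex^3^3" where
  "adj U = map_matrix cnj (transpose U)"

lemma adj_nth [simp]: "adj U $ i $ j = cnj (U $ j $ i)"
  by (simp add: adj_def map_matrix_def transpose_def)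

lemma SU3_iff: "U \<in> SU3 \<longleftrightarrow> det U = 1 \<and> U ** adj U = mat 1"
  by (simp add: SU3_def adj_def)

lemma adj_mult: "adj (U ** V) = adj V ** adj U"
  by (simp add: vec_eq_iff matrix_matrix_mult_def mult.commute)

lemma SU3_mult: "U \<in> SU3 \<Longrightarrow> V \<in> SU3 \<Longrightarrow> U ** V \<in> SU3"
proof -
  assume U: "U \<in> SU3" and V: "V \<in> SU3"
  have "U ** V ** (adj V ** adj U) = U ** (V ** adj V) ** adj U"
    by (simp only: matrix_mul_assoc)
  then show ?thesis using U V by (simp add: SU3_iff adj_mult det_mul)
qed

lemma SU3_cols:
  assumes "U \<in> SU3"
  shows "(\<Sum>s\<in>UNIV. cnj (U $ s $ k) * U $ s $ l) = (if k = l then 1 else 0)"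
proof -
  have "adj U ** U = mat 1" using assms matrix_left_right_inverse by (auto simp: SU3_iff)
  then have "(adj U ** U) $ k $ l = mat 1 $ k $ l" by simp
  then show ?thesis by (simp add: matrix_matrix_mult_def mat_def)
qed

lemma SU3_rows:
  assumes "U \<in> SU3"
  shows "(\<Sum>k\<in>UNIV. U $ i $ k * cnj (U $ j $ k)) = (if i = j then 1 else 0)"
proof -
  have "(U ** adj U) $ i $ j = mat 1 $ i $ j" using assms by (simp add: SU3_iff)
  then show ?thesis by (simp add: matrix_matrix_mult_def mat_def)
qed

lemma torus_exp_nth:
  "torus_exp a b $ i $ j = (if i = j then
     cis (2 * pi * (if i = 1 then a else if i = 2 then b else - (a + b))) else 0)"
  by (simp add: torus_exp_def)

lemma torus_exp_SU3: "torus_exp a b \<in> SU3"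
proof -
  have "det (torus_exp a b) = 1"
    by (simp add: det_3 torus_exp_nth cis_mult algebra_simps)
  moreover have "torus_exp a b ** adj (torus_exp a b) = mat 1"
    by (simp add: vec_eq_iff matrix_matrix_mult_def mat_def torus_exp_nth if_distrib[of cnj]
        if_distrib[of "\<lambda>x. x * _"] if_distrib[of "\<lambda>x. _ * x"] cis_cnj cis_mult sum.delta' cong: if_cong)
  ultimately show ?thesis by (simp add: SU3_iff)
qed

text \<open>Compactness bounds the continuous weight components, and this makes the supremum in
  Rieffel's norm finite.\<close>

lemma compact_SU3: "compact SU3"
proof -
  have eq: "SU3 = {U. det U = 1} \<inter> (\<Inter>i. \<Inter>j. {U. (\<Sum>k\<in>UNIV. U $ i $ k * cnj (U $ j $ k)) = mat 1 $ i $ j})"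
    by (auto simp: SU3_iff vec_eq_iff matrix_matrix_mult_def)
  have "closed SU3"
    unfolding eq det_3
    by (intro closed_Int closed_INT ballI closed_Collect_eq continuous_intros)
  moreover have "bounded SU3"
  proof (rule boundedI)
    fix U assume U: "U \<in> SU3"
    have entry: "norm (U $ i $ j) \<le> 1" for i j
    proof -
      have "complex_of_real (\<Sum>k\<in>UNIV. (cmod (U $ i $ k))\<^sup>2) = 1"
        using SU3_rows[OF U, of i i] by (simp only: of_real_sum complex_norm_square) simp
      then have "(\<Sum>k\<in>UNIV. (cmod (U $ i $ k))\<^sup>2) = 1" by (simp only: of_real_eq_1_iff)
      moreover have "(cmod (U $ i $ j))\<^sup>2 \<le> (\<Sum>k\<in>UNIV. (cmod (U $ i $ k))\<^sup>2)"
        by (intro member_le_sum) auto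
      ultimately show ?thesis by (simp add: power_le_one_iff)
    qed
    have row: "norm (U $ i) \<le> 3" for i
    proof -
      have "norm (U $ i) \<le> (\<Sum>j\<in>UNIV. norm (U $ i $ j))"
        unfolding norm_vec_def by (rule L2_set_le_sum) simp
      also have "\<dots> \<le> (\<Sum>j\<in>(UNIV :: 3 set). 1)" by (intro sum_mono entry)
      finally show ?thesis by simp
    qed
    have "norm U \<le> (\<Sum>j\<in>UNIV. norm (U $ j))"
      unfolding norm_vec_def by (rule L2_set_le_sum) simp
    also have "\<dots> \<le> (\<Sum>j\<in>(UNIV :: 3 set). 3)" by (intro sum_mono row)
    finally show "norm U \<le> 9" by simp
  qed
  ultimately show ?thesis by (simp add: compact_eq_bounded_closed)
qed

definition torus_act :: "real^4 \<Rightarrow> complex^3^3 \<Rightarrow> complex^3^3" where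
  "torus_act x U = torus_exp (- (x $ 1)) (- (x $ 2)) ** U ** torus_exp (x $ 3) (x $ 4)"

definition torus_char :: "int^4 \<Rightarrow> real^4 \<Rightarrow> complex" where
  "torus_char n x = cis (2 * pi * (\<Sum>i\<in>UNIV. of_int (n $ i) * x $ i))"

lemma weight_space_iff:
  "f \<in> weight_space n \<longleftrightarrow> continuous_on SU3 f \<and> (\<forall>U. U \<notin> SU3 \<longrightarrow> f U = 0) \<and>
    (\<forall>x. \<forall>U\<in>SU3. f (torus_act x U) = torus_char n x * f U)"
proof -
  have "(\<forall>x1 x2 s1 s2. P x1 x2 s1 s2) \<longleftrightarrow> (\<forall>x :: real^4. P (x $ 1) (x $ 2) (x $ 3) (x $ 4))" for P
  proof safe
    fix x1 x2 s1 s2 assume "\<forall>x :: real^4. P (x $ 1) (x $ 2) (x $ 3) (x $ 4)"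
    then show "P x1 x2 s1 s2" by (auto dest!: spec[of _
        "(\<chi> i. if i = 1 then x1 else if i = 2 then x2 else if i = 3 then s1 else s2) :: real^4"])
  qed simp
  then show ?thesis
    unfolding weight_space_def torus_act_def torus_char_def sum_4 by simp
qed

lemma torus_act_SU3: "U \<in> SU3 \<Longrightarrow> torus_act x U \<in> SU3"
  unfolding torus_act_def by (intro SU3_mult torus_exp_SU3)

lemma torus_char_add: "torus_char n (x + y) = torus_char n x * torus_char n y"
  by (simp add: torus_char_def cis_mult distrib_left sum.distrib)

lemma torus_char_weight_add: "torus_char (n + m) x = torus_char n x * torus_char m x"
  by (simp add: torus_char_def cis_mult distrib_left distrib_right sum.distrib)

lemma torus_char_uminus: "torus_char (- n) x = cnj (torus_char n x)"
  by (simp add: torus_char_def cis_cnj sum_negf)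

lemma torus_char_distinct:
  assumes "n \<noteq> m" shows "\<exists>x. torus_char n x \<noteq> torus_char m x"
proof -
  obtain k where k: "n $ k \<noteq> m $ k" using assms by (auto simp: vec_eq_iff)
  define d where "d = real_of_int (n $ k - m $ k)"
  \<comment> \<open>For this \<open>t\<close> the two characters differ at \<open>x\<close> by the
    factor \<open>cis pi\<close>, that is, -1.\<close>
  define t where "t = 1 / (2 * d)"
  have "d \<noteq> 0" using k by (simp add: d_def)
  define x :: "real^4" where "x = axis k t"
  have c: "torus_char p x = cis (2 * pi * (of_int (p $ k) * t))" for p
  proof -
    have "(\<Sum>i\<in>UNIV. of_int (p $ i) * x $ i) = (\<Sum>i\<in>UNIV. if i = k then of_int (p $ k) * t else 0)"
      by (intro sum.cong) (auto simp: x_def axis_def)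
    then show ?thesis by (simp add: torus_char_def)
  qed
  have "torus_char n x * cnj (torus_char m x) = cis (2 * pi * t * d)"
    unfolding c by (simp add: cis_cnj cis_mult algebra_simps d_def)
  also have "\<dots> = -1" using \<open>d \<noteq> 0\<close> by (simp add: t_def)
  finally have "torus_char n x * cnj (torus_char m x) \<noteq> 1" by simp
  moreover have "torus_char m x * cnj (torus_char m x) = 1" by (simp add: c cis_cnj cis_mult)
  ultimately show ?thesis by metis
qed

lemma zero_weight_space [simp]: "(\<lambda>U. 0) \<in> weight_space n"
  by (simp add: weight_space_iff)

lemma weight_space_add:
  "f \<in> weight_space n \<Longrightarrow> g \<in> weight_space n \<Longrightarrow> (\<lambda>U. f U + g U) \<in> weight_space n"
  by (auto simp: weight_space_iff algebra_simps intro!: continuous_intros)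

lemma weight_space_smult: "f \<in> weight_space n \<Longrightarrow> (\<lambda>U. c * f U) \<in> weight_space n"
  by (auto simp: weight_space_iff intro!: continuous_intros)

lemma weight_space_mult:
  "f \<in> weight_space n \<Longrightarrow> g \<in> weight_space m \<Longrightarrow> (\<lambda>U. f U * g U) \<in> weight_space (n + m)"
  by (auto simp: weight_space_iff torus_char_weight_add intro!: continuous_intros)

lemma weight_space_cnj: "f \<in> weight_space n \<Longrightarrow> (\<lambda>U. cnj (f U)) \<in> weight_space (- n)"
  by (auto simp: weight_space_iff torus_char_uminus intro!: continuous_intros)

lemma weight_space_one: "(\<lambda>U. if U \<in> SU3 then 1 else 0) \<in> weight_space 0"
proof -
  have "continuous_on SU3 (\<lambda>U. if U \<in> SU3 then 1 else 0 :: complex)"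
    by (rule continuous_on_eq[of _ "\<lambda>_. 1"]) auto
  then show ?thesis by (auto simp: weight_space_iff torus_act_SU3 torus_char_def)
qed

lemma weight_decompI:
  assumes "finite N" "\<And>n. c n \<in> weight_space n" "\<And>n. n \<notin> N \<Longrightarrow> c n = (\<lambda>U. 0)"
    and "f = (\<lambda>U. \<Sum>n\<in>N. c n U)"
  shows "weight_decomp f c"
proof -
  have "{n. c n \<noteq> (\<lambda>U. 0)} \<subseteq> N" using assms(3) by auto
  moreover have "(\<Sum>n\<in>N. c n U) = (\<Sum>n | c n \<noteq> (\<lambda>U. 0). c n U)" for U
    using assms(1) calculation by (intro sum.mono_neutral_right) auto
  ultimately show ?thesis
    unfolding weight_decomp_def using assms finite_subset by auto
qed

lemma weight_decomp_superset:
  assumes "weight_decomp f c" "finite N" "{n. c n \<noteq> (\<lambda>U. 0)} \<subseteq> N"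
  shows "f U = (\<Sum>n\<in>N. c n U)"
proof -
  have "f U = (\<Sum>n | c n \<noteq> (\<lambda>U. 0). c n U)" using assms(1) by (simp add: weight_decomp_def)
  also have "\<dots> = (\<Sum>n\<in>N. c n U)" using assms by (intro sum.mono_neutral_left) auto
  finally show ?thesis .
qed

text \<open>Along the torus orbit of a point \<open>U\<close> a decomposition becomes a linear
  combination of distinct characters with coefficients \<open>c n U\<close>. Their independence
  gives meaning to the definite description in \<open>weight_comp\<close>.\<close>

lemma weight_decomp_unique:
  assumes "weight_decomp f c" "weight_decomp f d" shows "c = d"
proof -
  define N where "N = {n. c n \<noteq> (\<lambda>U. 0)} \<union> {n. d n \<noteq> (\<lambda>U. 0)}"
  have N: "finite N" using assms by (auto simp: N_def weight_decomp_def)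
  have ws: "c n \<in> weight_space n" "d n \<in> weight_space n" for n
    using assms by (auto simp: weight_decomp_def)
  have "c n U = d n U" for n U
  proof (cases "n \<in> N \<and> U \<in> SU3")
    case True
    have "c n U - d n U = 0"
    proof (rule characters_independent[of N 0 UNIV "(+)" torus_char])
      show "(\<Sum>i\<in>N. (c i U - d i U) * torus_char i x) = 0" for x
      proof -
        have "(\<Sum>i\<in>N. c i (torus_act x U)) = (\<Sum>i\<in>N. d i (torus_act x U))"
          using weight_decomp_superset[OF assms(1) N, of "torus_act x U"]
            weight_decomp_superset[OF assms(2) N, of "torus_act x U"] by (auto simp: N_def)
        moreover have "c i (torus_act x U) = torus_char i x * c i U"
            "d i (torus_act x U) = torus_char i x * d i U" for i
          using ws True by (auto simp: weight_space_iff)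
        ultimately show ?thesis by (simp add: algebra_simps sum_subtractf)
      qed
      show "\<exists>g\<in>UNIV. torus_char i g \<noteq> torus_char j g" if "i \<noteq> j" for i j
        using torus_char_distinct[OF that] by auto
    qed (use N True torus_char_add in \<open>auto simp: torus_char_def\<close>)
    then show ?thesis by simp
  next
    case False
    then show ?thesis using ws[of n] by (auto simp: N_def weight_space_iff)
  qed
  then show ?thesis by (intro ext) simp
qed

lemma weight_comp_eq: "weight_decomp f c \<Longrightarrow> weight_comp f = c"
  unfolding weight_comp_def by (rule the_equality) (auto dest: weight_decomp_unique)

lemma weight_decomp_weight_space:
  "f \<in> weight_space n \<Longrightarrow> weight_decomp f (\<lambda>m. if m = n then f else (\<lambda>U. 0))"
  by (rule weight_decompI[of "{n}"]) auto

lemma deform_mult_weight_space: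
  assumes "f \<in> weight_space n" "g \<in> weight_space m"
  shows "deform_mult \<theta> f g = (\<lambda>U. deform_phase \<theta> n m * (f U * g U))"
proof -
  note c = weight_comp_eq[OF weight_decomp_weight_space[OF assms(1)]]
    weight_comp_eq[OF weight_decomp_weight_space[OF assms(2)]]
  have w: "weights f = (if f = (\<lambda>U. 0) then {} else {n})" "weights g = (if g = (\<lambda>U. 0) then {} else {m})"
    unfolding weights_def c by auto
  show ?thesis unfolding deform_mult_def w c by (auto simp: mult.assoc)
qed

lemma carrier_deformed: "f \<in> carrier (deformed_SU3 \<theta>) \<longleftrightarrow> (\<exists>c. weight_decomp f c)"
  by (simp add: deformed_SU3_def)

lemma weight_space_deformed: "f \<in> weight_space n \<Longrightarrow> f \<in> carrier (deformed_SU3 \<theta>)"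
  using weight_decomp_weight_space by (auto simp: carrier_deformed)

lemma deformed_add:
  assumes "f \<in> carrier (deformed_SU3 \<theta>)" "g \<in> carrier (deformed_SU3 \<theta>)"
  shows "(\<lambda>U. f U + g U) \<in> carrier (deformed_SU3 \<theta>)"
proof -
  obtain c d where cd: "weight_decomp f c" "weight_decomp g d"
    using assms by (auto simp: carrier_deformed)
  let ?N = "{n. c n \<noteq> (\<lambda>U. 0)} \<union> {n. d n \<noteq> (\<lambda>U. 0)}"
  have N: "finite ?N" using cd by (auto simp: weight_decomp_def)
  have "weight_decomp (\<lambda>U. f U + g U) (\<lambda>n U. c n U + d n U)"
  proof (rule weight_decompI[OF N])
    show "(\<lambda>U. f U + g U) = (\<lambda>U. \<Sum>n\<in>?N. c n U + d n U)"
      using weight_decomp_superset[OF cd(1) N] weight_decomp_superset[OF cd(2) N]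
      by (simp add: sum.distrib)
  qed (use cd in \<open>auto simp: weight_decomp_def weight_space_add\<close>)
  then show ?thesis by (auto simp: carrier_deformed)
qed

lemma deformed_smult:
  assumes "f \<in> carrier (deformed_SU3 \<theta>)" shows "(\<lambda>U. a * f U) \<in> carrier (deformed_SU3 \<theta>)"
proof -
  obtain c where c: "weight_decomp f c" using assms by (auto simp: carrier_deformed)
  have "weight_decomp (\<lambda>U. a * f U) (\<lambda>n U. a * c n U)"
    by (rule weight_decompI[of "{n. c n \<noteq> (\<lambda>U. 0)}"])
      (use c in \<open>auto simp: weight_decomp_def weight_space_smult sum_distrib_left\<close>)
  then show ?thesis by (auto simp: carrier_deformed)
qed

text \<open>The operator is a sum of weighted shifts, one for each \<open>n\<close> in
  \<open>W\<close>. The Cauchy-Schwarz inequality gives a crude bound, uniform in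
  \<open>\<xi>\<close>; its value does not matter, only that the norms defining Rieffel's supremum
  are bounded.\<close>

lemma left_mult_coeff_l2_bound:
  fixes \<xi> :: "int^4 \<Rightarrow> complex"
  assumes W: "finite W" and a: "\<And>n k. n \<in> W \<Longrightarrow> cmod (a n k) \<le> B n" and \<xi>: "finite {m. \<xi> m \<noteq> 0}"
    and le: "(\<Sum>m | \<xi> m \<noteq> (0::complex). (cmod (\<xi> m))\<^sup>2) \<le> 1"
  shows "(\<Sum>\<^sub>\<infinity>k. (cmod (\<Sum>n\<in>W. a n k * \<xi> (k - n)))\<^sup>2) \<le> real (card W) * (\<Sum>n\<in>W. (B n)\<^sup>2)"
proof -
  \<comment> \<open>Outside \<open>F\<close> every shifted argument leaves the support of
    \<open>\<xi>\<close>, so the infinite sum is a finite one.\<close>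
  define F where "F = (\<Union>n\<in>W. (\<lambda>m. m + n) ` {m. \<xi> m \<noteq> 0})"
  have F: "finite F" using W \<xi> by (auto simp: F_def)
  have "(\<Sum>n\<in>W. a n k * \<xi> (k - n)) = 0" if "k \<notin> F" for k
  proof (rule sum.neutral, intro ballI)
    fix n assume n: "n \<in> W"
    have "\<xi> (k - n) = 0"
    proof (rule ccontr)
      assume "\<xi> (k - n) \<noteq> 0"
      then have "k \<in> (\<lambda>m. m + n) ` {m. \<xi> m \<noteq> 0}" by (intro image_eqI[of _ _ "k - n"]) auto
      then show False using n that by (auto simp: F_def)
    qed
    then show "a n k * \<xi> (k - n) = 0" by simp
  qed
  then have "(\<Sum>\<^sub>\<infinity>k. (cmod (\<Sum>n\<in>W. a n k * \<xi> (k - n)))\<^sup>2) =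
      (\<Sum>\<^sub>\<infinity>k\<in>F. (cmod (\<Sum>n\<in>W. a n k * \<xi> (k - n)))\<^sup>2)"
    by (intro infsum_cong_neutral) auto
  also have "\<dots> = (\<Sum>k\<in>F. (cmod (\<Sum>n\<in>W. a n k * \<xi> (k - n)))\<^sup>2)"
    using F by simp
  also have "\<dots> \<le> (\<Sum>k\<in>F. real (card W) * (\<Sum>n\<in>W. (B n)\<^sup>2 * (cmod (\<xi> (k - n)))\<^sup>2))"
  proof (rule sum_mono)
    fix k
    have "cmod (\<Sum>n\<in>W. a n k * \<xi> (k - n)) \<le> (\<Sum>n\<in>W. B n * cmod (\<xi> (k - n)))"
      using a by (intro sum_norm_le) (auto simp: norm_mult intro!: mult_right_mono)
    then have "(cmod (\<Sum>n\<in>W. a n k * \<xi> (k - n)))\<^sup>2 \<le> (\<Sum>n\<in>W. B n * cmod (\<xi> (k - n)))\<^sup>2"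
      by (intro power_mono) auto
    also have "\<dots> \<le> (\<Sum>n\<in>W. (B n * cmod (\<xi> (k - n)))\<^sup>2) * card W"
      by (rule sum_squared_le_sum_of_squares)
    finally show "(cmod (\<Sum>n\<in>W. a n k * \<xi> (k - n)))\<^sup>2 \<le>
        real (card W) * (\<Sum>n\<in>W. (B n)\<^sup>2 * (cmod (\<xi> (k - n)))\<^sup>2)"
      by (simp add: power_mult_distrib mult.commute)
  qed
  also have "\<dots> = real (card W) * (\<Sum>n\<in>W. (B n)\<^sup>2 * (\<Sum>k\<in>F. (cmod (\<xi> (k - n)))\<^sup>2))"
    unfolding sum_distrib_left[symmetric] by (subst sum.swap) (simp add: sum_distrib_left)
  also have "\<dots> \<le> real (card W) * (\<Sum>n\<in>W. (B n)\<^sup>2 * 1)"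
  proof (intro mult_left_mono sum_mono)
    fix n
    have "(\<Sum>k\<in>F. (cmod (\<xi> (k - n)))\<^sup>2) = (\<Sum>m\<in>(\<lambda>k. k - n) ` F. (cmod (\<xi> m))\<^sup>2)"
      by (subst sum.reindex) (auto simp: inj_on_def)
    also have "\<dots> = (\<Sum>m\<in>(\<lambda>k. k - n) ` F \<inter> {m. \<xi> m \<noteq> 0}. (cmod (\<xi> m))\<^sup>2)"
      using F by (intro sum.mono_neutral_right) auto
    also have "\<dots> \<le> (\<Sum>m | \<xi> m \<noteq> 0. (cmod (\<xi> m))\<^sup>2)"
      using \<xi> by (intro sum_mono2) auto
    finally show "(\<Sum>k\<in>F. (cmod (\<xi> (k - n)))\<^sup>2) \<le> 1" using le by simp
  qed auto
  finally show ?thesis by simp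
qed

text \<open>Applied to the unit vector at 0, the multiplication operator at \<open>U\<close> returns
  the components \<open>c k U\<close> up to phases. Its norm is therefore at least the square-sum
  norm of these components.\<close>

lemma rieffel_norm_ge:
  assumes c: "weight_decomp f c" and U: "U \<in> SU3"
  shows "cmod (c n U) \<le> rieffel_norm \<theta> f"
proof -
  define W where "W = {n. c n \<noteq> (\<lambda>U. 0)}"
  have W: "finite W" "weights f = W" "weight_comp f = c"
    using c by (auto simp: W_def weights_def weight_comp_eq weight_decomp_def)
  define X where "X = {sqrt (\<Sum>\<^sub>\<infinity>k. (cmod (left_mult_coeff \<theta> f U \<xi> k))\<^sup>2) | U \<xi>.
     U \<in> SU3 \<and> finite {m. \<xi> m \<noteq> 0} \<and> (\<Sum>m | \<xi> m \<noteq> 0. (cmod (\<xi> m))\<^sup>2) \<le> 1}"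
  have phase: "cmod (deform_phase \<theta> n m) = 1" for n m by (simp add: deform_phase_def)
  have "\<exists>B. \<forall>U\<in>SU3. cmod (c n U) \<le> B" for n
  proof -
    have "continuous_on SU3 (c n)" using c by (auto simp: weight_decomp_def weight_space_iff)
    then have "bounded (c n ` SU3)" by (intro compact_imp_bounded compact_continuous_image compact_SU3)
    then show ?thesis by (auto simp: bounded_iff)
  qed
  then obtain B where B: "\<And>n U. U \<in> SU3 \<Longrightarrow> cmod (c n U) \<le> B n" by metis
  \<comment> \<open>A supremum of reals is an upper bound only for a bounded set, so boundedness has
    to come before the comparison.\<close>
  have bdd: "bdd_above X"
  proof (rule bdd_aboveI)
    fix x assume "x \<in> X"
    then obtain V \<xi> where x: "x = sqrt (\<Sum>\<^sub>\<infinity>k. (cmod (left_mult_coeff \<theta> f V \<xi> k))\<^sup>2)" "V \<in> SU3"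
        "finite {m. \<xi> m \<noteq> 0}" "(\<Sum>m | \<xi> m \<noteq> 0. (cmod (\<xi> m))\<^sup>2) \<le> 1"
      by (auto simp: X_def)
    show "x \<le> sqrt (real (card W) * (\<Sum>n\<in>W. (B n)\<^sup>2))"
      unfolding x(1) left_mult_coeff_def W
      by (intro real_sqrt_le_mono left_mult_coeff_l2_bound x W(1))
        (use x(2) B in \<open>auto simp: norm_mult phase\<close>)
  qed
  \<comment> \<open>The unit vector at weight 0, that is, the constant function 1 on the
    torus.\<close>
  define \<xi> where "\<xi> = (\<lambda>m :: int^4. if m = 0 then 1 else 0 :: complex)"
  have supp: "{m. \<xi> m \<noteq> 0} = {0}" by (auto simp: \<xi>_def)
  have co: "(cmod (left_mult_coeff \<theta> f U \<xi> k))\<^sup>2 = (cmod (c k U))\<^sup>2" for k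
  proof -
    have "left_mult_coeff \<theta> f U \<xi> k =
        (\<Sum>n\<in>W. if n = k then deform_phase \<theta> n (k - n) * c n U else 0)"
      unfolding left_mult_coeff_def W by (intro sum.cong) (auto simp: \<xi>_def)
    also have "\<dots> = (if k \<in> W then deform_phase \<theta> k (k - k) * c k U else 0)"
      using W(1) by (simp add: sum.delta)
    also have "(cmod \<dots>)\<^sup>2 = (cmod (c k U))\<^sup>2"
      by (auto simp: norm_mult phase W_def)
    finally show ?thesis .
  qed
  have "(\<Sum>\<^sub>\<infinity>k. (cmod (left_mult_coeff \<theta> f U \<xi> k))\<^sup>2) = (\<Sum>\<^sub>\<infinity>k\<in>W. (cmod (c k U))\<^sup>2)"
    unfolding co by (intro infsum_cong_neutral) (auto simp: W_def)
  also have "\<dots> = (\<Sum>k\<in>W. (cmod (c k U))\<^sup>2)" using W(1) by simp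
  finally have s: "(\<Sum>\<^sub>\<infinity>k. (cmod (left_mult_coeff \<theta> f U \<xi> k))\<^sup>2) = (\<Sum>k\<in>W. (cmod (c k U))\<^sup>2)" .
  have "(\<Sum>m | \<xi> m \<noteq> 0. (cmod (\<xi> m))\<^sup>2) \<le> 1" unfolding supp by (simp add: \<xi>_def)
  then have mem: "sqrt (\<Sum>k\<in>W. (cmod (c k U))\<^sup>2) \<in> X"
    unfolding X_def s[symmetric] using U supp by (intro CollectI exI[of _ U] exI[of _ \<xi>]) auto
  have "(cmod (c n U))\<^sup>2 \<le> (\<Sum>k\<in>W. (cmod (c k U))\<^sup>2)"
  proof (cases "n \<in> W")
    case True
    then show ?thesis using W(1) by (intro member_le_sum) auto
  qed (auto simp: W_def sum_nonneg)
  then have "cmod (c n U) \<le> sqrt (\<Sum>k\<in>W. (cmod (c k U))\<^sup>2)" by (rule real_le_rsqrt)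
  also have "\<dots> \<le> rieffel_norm \<theta> f"
    unfolding rieffel_norm_def X_def[symmetric] by (rule cSup_upper[OF mem bdd])
  finally show ?thesis .
qed

lemma rieffel_norm_eq_0D:
  assumes "f \<in> carrier (deformed_SU3 \<theta>)" "rieffel_norm \<theta> f = 0" shows "f U = 0"
proof -
  obtain c where c: "weight_decomp f c" using assms(1) by (auto simp: carrier_deformed)
  have "c n U = 0" for n
  proof (cases "U \<in> SU3")
    case True
    then show ?thesis using rieffel_norm_ge[OF c True, of n \<theta>] assms(2) by simp
  next
    case False
    then show ?thesis using c by (auto simp: weight_decomp_def weight_space_iff)
  qed
  then show ?thesis using c by (simp add: weight_decomp_def)
qed

section \<open>The completion and its embedding of the weight functions\<close>

locale rieffel_completion =
  fixes \<theta> :: real and H :: "('h, 'm) normed_star_alg_scheme"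
    and \<iota> :: "(complex^3^3 \<Rightarrow> complex) \<Rightarrow> 'h"
  assumes completion: "cstar_completion (deformed_SU3 \<theta>) (rieffel_norm \<theta>) H \<iota>"
begin

abbreviation P :: "(complex^3^3 \<Rightarrow> complex) star_alg" where "P \<equiv> deformed_SU3 \<theta>"

lemma H_star_algebra: "star_algebra H" and H_cstar_norm: "cstar_norm H (nrm H)"
  and iota_star_hom: "\<iota> \<in> star_hom P H"
  and iota_norm: "f \<in> carrier P \<Longrightarrow> nrm H (\<iota> f) = rieffel_norm \<theta> f"
  using completion by (auto simp: cstar_completion_def cstar_algebra_def)

sublocale H: calg H by (rule star_algebra_calg[OF H_star_algebra])

lemma iota_lin_map: "\<iota> \<in> lin_map P H"
  using iota_star_hom by (auto simp: star_hom_def alg_hom_lin_map)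

lemma iota_closed: "f \<in> carrier P \<Longrightarrow> \<iota> f \<in> carrier H"
  using lin_map_closed[OF iota_lin_map] .

lemma iota_ws_closed: "f \<in> weight_space n \<Longrightarrow> \<iota> f \<in> carrier H"
  using iota_closed weight_space_deformed by blast

lemma iota_add: "f \<in> carrier P \<Longrightarrow> g \<in> carrier P \<Longrightarrow> \<iota> (\<lambda>U. f U + g U) = \<iota> f \<oplus>\<^bsub>H\<^esub> \<iota> g"
  using lin_map_add[OF iota_lin_map, of f g] by (simp add: deformed_SU3_def)

lemma iota_smult: "f \<in> carrier P \<Longrightarrow> \<iota> (\<lambda>U. c * f U) = c \<odot>\<^bsub>H\<^esub> \<iota> f"
  using lin_map_smult[OF iota_lin_map, of f c] by (simp add: deformed_SU3_def)

lemma iota_one: "\<iota> (\<lambda>U. if U \<in> SU3 then 1 else 0) = \<one>\<^bsub>H\<^esub>"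
  using iota_star_hom by (auto simp: star_hom_def alg_hom_def ring_hom_def deformed_SU3_def)

lemma iota_mult:
  assumes "f \<in> weight_space n" "g \<in> weight_space m"
  shows "\<iota> f \<otimes>\<^bsub>H\<^esub> \<iota> g = deform_phase \<theta> n m \<odot>\<^bsub>H\<^esub> \<iota> (\<lambda>U. f U * g U)"
proof -
  have "\<iota> (f \<otimes>\<^bsub>P\<^esub> g) = \<iota> f \<otimes>\<^bsub>H\<^esub> \<iota> g"
    using iota_star_hom assms weight_space_deformed by (auto simp: star_hom_def alg_hom_def ring_hom_def)
  then show ?thesis
    using iota_smult[OF weight_space_deformed[OF weight_space_mult[OF assms]]]
    by (simp add: deformed_SU3_def deform_mult_weight_space[OF assms])
qed

lemma iota_star: "f \<in> carrier P \<Longrightarrow> star H (\<iota> f) = \<iota> (\<lambda>U. cnj (f U))"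
  using iota_star_hom by (auto simp: star_hom_def deformed_SU3_def)

lemma iota_inj:
  assumes f: "f \<in> carrier P" and g: "g \<in> carrier P" and eq: "\<iota> f = \<iota> g"
  shows "f U = g U"
proof -
  define h where "h = (\<lambda>U. f U + (- 1) * g U)"
  have g': "(\<lambda>U. (- 1) * g U) \<in> carrier P" by (rule deformed_smult[OF g])
  have h: "h \<in> carrier P" unfolding h_def by (rule deformed_add[OF f g'])
  have "\<iota> h = \<iota> f \<ominus>\<^bsub>H\<^esub> \<iota> g"
    unfolding h_def iota_add[OF f g'] iota_smult[OF g] using iota_closed f g by (simp add: H.minus_smult)
  also have "\<dots> = \<zero>\<^bsub>H\<^esub>" using eq iota_closed[OF g] by (simp add: H.minus_self)
  finally have "nrm H (\<iota> h) = 0" using H_cstar_norm by (simp add: cstar_norm_def)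
  then have "h U = 0" using rieffel_norm_eq_0D[OF h] iota_norm[OF h] by simp
  then show ?thesis by (simp add: h_def)
qed

end

section \<open>Words in the coordinates of the two spheres\<close>

text \<open>The generator \<open>z\<^sub>j\<close> with \<open>j = mk b i\<close> is the coordinate \<open>i = ix j\<close> of the first (\<open>b = False\<close>) or second
  sphere.\<close>

definition ix :: "6 \<Rightarrow> 3" where
  "ix j = (if j = 1 \<or> j = 4 then 1 else if j = 2 \<or> j = 5 then 2 else 3)"

definition blk :: "6 \<Rightarrow> bool" where
  "blk j \<longleftrightarrow> j = 4 \<or> j = 5 \<or> j = 6"

definition mk :: "bool \<Rightarrow> 3 \<Rightarrow> 6" where
  "mk b i = (if b then if i = 1 then 4 else if i = 2 then 5 else 6
    else if i = 1 then 1 else if i = 2 then 2 else 3)"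

lemma exhaust_6: "j = 1 \<or> j = 2 \<or> j = 3 \<or> j = 4 \<or> j = 5 \<or> j = 6" for j :: 6
proof (induct j)
  case (of_int z)
  then have "z = 0 \<or> z = 1 \<or> z = 2 \<or> z = 3 \<or> z = 4 \<or> z = 5" by fastforce
  then show ?case by auto
qed

lemma ix_mk [simp]: "ix (mk b i) = i" and blk_mk [simp]: "blk (mk b i) = b"
  using exhaust_3[of i] by (auto simp: ix_def mk_def blk_def)

lemma mk_blk_ix [simp]: "mk (blk j) (ix j) = j"
  using exhaust_6[of j] by (auto simp: ix_def mk_def blk_def)

lemma mk_eq_iff [simp]: "mk b i = mk b' i' \<longleftrightarrow> b = b' \<and> i = i'"
  by (auto dest: arg_cong[of _ _ blk] arg_cong[of _ _ ix])

type_synonym letter = "6 \<times> bool"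

definition flip :: "letter \<Rightarrow> letter" where "flip l = (fst l, \<not> snd l)"

definition sg :: "letter \<Rightarrow> real" where "sg l = (if snd l then - 1 else 1)"

definition ev :: "complex^6 \<Rightarrow> letter \<Rightarrow> complex" where
  "ev x l = (if snd l then cnj (x $ fst l) else x $ fst l)"

definition spheres :: "(complex^6) set" where
  "spheres = {x. \<forall>b. (\<Sum>i\<in>UNIV. x $ mk b i * cnj (x $ mk b i)) = 1}"

abbreviation wprod :: "complex^6 \<Rightarrow> letter list \<Rightarrow> complex" where
  "wprod x w \<equiv> prod_list (map (ev x) w)"

locale sphere =
  fixes \<theta>' :: "real^6^6"
  assumes skew: "transpose \<theta>' = - \<theta>'"
begin

lemma skew_nth: "\<theta>' $ j $ k = - (\<theta>' $ k $ j)"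
proof -
  have "transpose \<theta>' $ k $ j = (- \<theta>') $ k $ j" by (simp only: skew)
  then show ?thesis by (simp add: transpose_def)
qed

lemma skew_diag [simp]: "\<theta>' $ j $ j = 0"
  using skew_nth[of j j] by simp

text \<open>A square root of the commutation constant: exchanging the letters \<open>l\<close> and
  \<open>m\<close> costs \<open>(cphase l m)\<^sup>2\<close>. The half angle matches the factor pi,
  rather than 2 pi, in the phase of the deformed product.\<close>

definition cphase :: "letter \<Rightarrow> letter \<Rightarrow> complex" where
  "cphase l m = cis (pi * (sg l * sg m * \<theta>' $ fst l $ fst m))"

lemma cmod_cphase [simp]: "cmod (cphase l m) = 1"
  by (simp add: cphase_def)

lemma cphase_swap: "cphase l m * cphase m l = 1"
  using skew_nth[of "fst l" "fst m"] by (simp add: cphase_def cis_mult algebra_simps)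

lemma cphase_cnj: "cnj (cphase l m) = cphase m l"
  using skew_nth[of "fst l" "fst m"] by (simp add: cphase_def cis_cnj algebra_simps)

lemma cphase_flip: "cphase l m * cphase (flip l) m = 1" "cphase m l * cphase m (flip l) = 1"
  by (simp_all add: cphase_def cis_mult flip_def sg_def)

lemma cphase_flip_self: "cphase l (flip l) = 1"
  by (simp add: cphase_def flip_def)

lemma cphase_flip_flip: "cphase (flip l) (flip m) = cphase l m"
  by (simp add: cphase_def flip_def sg_def)

definition cross :: "letter list \<Rightarrow> letter list \<Rightarrow> complex" where
  "cross v w = prod_list (map (\<lambda>l. prod_list (map (cphase l) w)) v)"

lemma cross_simps [simp]:
  "cross [] w = 1" "cross (l # v) w = prod_list (map (cphase l) w) * cross v w"
  "cross (u @ v) w = cross u w * cross v w" "cross v [] = 1"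
  by (simp_all add: cross_def map_replicate_const)

lemma cross_append_right: "cross v (w @ w') = cross v w * cross v w'"
  by (induction v) simp_all

text \<open>The product of \<open>cphase\<close> over all pairs of positions in their order.
  Dividing a word by it is Weyl ordering, after which the letters may be permuted freely.\<close>

fun wphase :: "letter list \<Rightarrow> complex" where
  "wphase [] = 1"
| "wphase (l # w) = prod_list (map (cphase l) w) * wphase w"

lemma wphase_append: "wphase (v @ w) = wphase v * wphase w * cross v w"
  by (induction v) simp_all

lemma cmod_prod_cphase [simp]: "cmod (prod_list (map (cphase l) w)) = 1"
  by (induction w) (simp_all add: norm_mult)

lemma cmod_cross [simp]: "cmod (cross v w) = 1"
  by (induction v) (simp_all add: norm_mult)

lemma cmod_wphase [simp]: "cmod (wphase w) = 1"
  by (induction w) (simp_all add: norm_mult)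

lemma wphase_cnj: "wphase w * cnj (wphase w) = 1" "cnj (wphase w) * wphase w = 1"
  using complex_norm_square[of "wphase w"] by (simp_all add: mult.commute)

definition pair :: "bool \<Rightarrow> 3 \<Rightarrow> letter list" where
  "pair b i = [(mk b i, False), (mk b i, True)]"

text \<open>The phases of a letter and of its adjoint against any third letter are inverse to each
  other. Hence a factor \<open>z z^*\<close> can be inserted anywhere without a phase, and the
  sphere relation is compatible with Weyl ordering.\<close>

lemma cross_pair [simp]: "cross (pair b i) w = 1" "cross w (pair b i) = 1"
proof -
  have f: "(mk b i, True) = flip (mk b i, False)" by (simp add: flip_def)
  have "prod_list (map (cphase l) w) * prod_list (map (cphase (flip l)) w) = 1" for l w
  proof (induction w)
    case (Cons m w)
    then show ?case using cphase_flip(1)[of l m] by (simp add: mult.assoc mult.left_commute)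
      (metis mult.left_commute mult_1_right)
  qed simp
  then show "cross (pair b i) w = 1" by (simp add: pair_def f)
  show "cross w (pair b i) = 1"
    by (induction w) (simp_all add: pair_def f cphase_flip)
qed

lemma wphase_pair [simp]: "wphase (pair b i) = 1"
  using cphase_flip_self[of "(mk b i, False)"] by (simp add: pair_def flip_def)

subsection \<open>The sphere algebra as a quotient\<close>

definition WM :: "letter list monoid" where
  "WM = \<lparr>carrier = UNIV, monoid.mult = (@), one = []\<rparr>"

definition wstar :: "letter list \<Rightarrow> letter list" where
  "wstar w = rev (map flip w)"

lemma free_eq: "free_sphere_alg = monoid_algebra WM wstar"
  by (simp add: free_sphere_alg_def WM_def wstar_def[abs_def] flip_def[abs_def] case_prod_unfold)

lemma WM_simps [simp]: "carrier WM = UNIV" "v \<otimes>\<^bsub>WM\<^esub> w = v @ w" "\<one>\<^bsub>WM\<^esub> = []"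
  by (simp_all add: WM_def)

definition rels :: "sphere_poly set" where
  "rels = sphere_rels \<theta>' \<union> star free_sphere_alg ` sphere_rels \<theta>'"

sublocale quot_alg WM wstar rels
  by unfold_locales (auto simp: WM_def monoid_algebra_def)

lemma A_eq: "sphere_alg \<theta>' = Q"
  by (simp add: sphere_alg_def sphere_ideal_def rels_def free_eq)

lemma sphere_z_eq: "sphere_z \<theta>' j = bas [(of_nat j, False)]"
  by (simp add: sphere_z_def sphere_ideal_def rels_def free_eq free_z_def)

lemma in_R [simp]: "p \<in> carrier R" by (simp add: carrier_R)

abbreviation sng :: "letter list \<Rightarrow> complex \<Rightarrow> sphere_poly" where
  "sng \<equiv> Poly_Mapping.single"

definition comm_rel :: "letter \<Rightarrow> letter \<Rightarrow> sphere_poly" where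
  "comm_rel l m = sng [l, m] 1 - sng [m, l] ((cphase l m)\<^sup>2)"

definition sphere_rel :: "bool \<Rightarrow> sphere_poly" where
  "sphere_rel b = sng (pair b 1) 1 + sng (pair b 2) 1 + sng (pair b 3) 1 - sng [] 1"

lemma wstar_simps [simp]: "wstar (wstar w) = w" "wstar (v @ w) = wstar w @ wstar v"
  by (simp_all add: wstar_def rev_map flip_def o_def)

lemma comm_rel_star: "star R (comm_rel l m) = comm_rel (flip m) (flip l)"
proof -
  have "cnj ((cphase l m)\<^sup>2) = (cphase (flip m) (flip l))\<^sup>2" by (simp add: cphase_cnj cphase_flip_flip)
  then show ?thesis by (simp add: comm_rel_def star_diff wstar_def)
qed

lemma sphere_rel_star: "star R (sphere_rel b) = sphere_rel b"
  by (simp add: sphere_rel_def star_diff star_add wstar_def pair_def flip_def)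

text \<open>Normality of a generator is the mixed commutation relation with equal indices, since the
  diagonal of \<open>\<theta>'\<close> vanishes. All commutation relations thus form one
  family.\<close>

lemma sphere_rels_eq:
  "sphere_rels \<theta>' = {comm_rel (j, False) (k, b) | j k b. True} \<union> {sphere_rel False, sphere_rel True}"
proof -
  have c: "(cphase (j, False) (k, False))\<^sup>2 = cis (2 * pi * \<theta>' $ j $ k)"
    "(cphase (j, False) (k, True))\<^sup>2 = cis (- 2 * pi * \<theta>' $ j $ k)" for j k
    by (simp_all add: cphase_def sg_def Complex.DeMoivre algebra_simps)
  have m: "free_z j \<otimes>\<^bsub>R\<^esub> free_z k = sng [(j, False), (k, False)] 1"
    "free_z j \<otimes>\<^bsub>R\<^esub> free_zs k = sng [(j, False), (k, True)] 1"
    "free_zs k \<otimes>\<^bsub>R\<^esub> free_z j = sng [(k, True), (j, False)] 1"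
    "d \<odot>\<^bsub>R\<^esub> sng w 1 = sng w d" for j k d w
    by (simp_all add: free_z_def free_zs_def)
  have s: "sng [(j, False), (j, True)] 1 - sng [(j, True), (j, False)] 1 = comm_rel (j, False) (j, True)" for j
    using cphase_flip_self[of "(j, False)"] by (simp add: comm_rel_def flip_def)
  have p: "pair False 1 = [(1, False), (1, True)]" "pair False 2 = [(2, False), (2, True)]"
    "pair False 3 = [(3, False), (3, True)]" "pair True 1 = [(4, False), (4, True)]"
    "pair True 2 = [(5, False), (5, True)]" "pair True 3 = [(6, False), (6, True)]"
    by (simp_all add: pair_def mk_def)
  have r: "sng [(j, False), (k, False)] 1 - sng [(k, False), (j, False)] (cis (2 * pi * \<theta>' $ j $ k)) =
      comm_rel (j, False) (k, False)"
    "sng [(j, False), (k, True)] 1 - sng [(k, True), (j, False)] (cis (- 2 * pi * \<theta>' $ j $ k)) =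
      comm_rel (j, False) (k, True)" for j k
    by (simp_all only: comm_rel_def c)
  have "sphere_rels \<theta>' = {comm_rel (j, False) (k, False) | j k. True} \<union>
      {comm_rel (j, False) (k, True) | j k. True} \<union> {comm_rel (j, False) (j, True) | j. True} \<union>
      {sphere_rel False, sphere_rel True}"
    unfolding sphere_rels_def Let_def free_eq m r s unfolding sphere_rel_def p
    by simp
  also have "\<dots> = {comm_rel (j, False) (k, b) | j k b. True} \<union> {sphere_rel False, sphere_rel True}"
    by auto (metis (full_types))+
  finally show ?thesis .
qed

lemma rels_cases:
  assumes "s \<in> rels" obtains l m where "s = comm_rel l m" | b where "s = sphere_rel b"
proof -
  have "(\<exists>l m. s = comm_rel l m) \<or> (\<exists>b. s = sphere_rel b)"
    using assms unfolding rels_def free_eq sphere_rels_eq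
    by (auto simp: comm_rel_star sphere_rel_star flip_def) blast+
  then show ?thesis using that by blast
qed

lemma sphere_rel_in: "sphere_rel b \<in> I"
  using R.genideal_self[OF S_carrier] unfolding rels_def sphere_rels_eq by (cases b) auto

text \<open>The defining relations start with a plain letter. Their adjoints supply the case of two
  adjoint letters, and an adjoint letter followed by a plain one gives a scalar multiple of a
  relation already listed.\<close>

lemma comm_rel_in: "comm_rel l m \<in> I"
proof -
  have in1: "comm_rel (j, False) (k, b) \<in> I" for j k b
    using R.genideal_self[OF S_carrier] unfolding rels_def sphere_rels_eq by auto
  have "comm_rel (k, True) (j, True) \<in> I" for j k
  proof -
    have "star R (comm_rel (j, False) (k, False)) \<in> rels"
      unfolding rels_def sphere_rels_eq free_eq by (rule UnI2, rule imageI, rule UnI1) blast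
    then show ?thesis using R.genideal_self[OF S_carrier] by (auto simp: comm_rel_star flip_def)
  qed
  moreover have "comm_rel (k, True) (j, False) \<in> I" for j k
  proof -
    let ?c = "(cphase (k, True) (j, False))\<^sup>2"
    have "?c * (cphase (j, False) (k, True))\<^sup>2 = 1"
      using cphase_swap[of "(k, True)" "(j, False)"] by (simp flip: power_mult_distrib)
    then have "comm_rel (k, True) (j, False) = (- ?c) \<odot>\<^bsub>R\<^esub> comm_rel (j, False) (k, True)"
      by (auto intro!: poly_mapping_eqI simp: comm_rel_def lookup_minus lookup_add algebra_simps lookup_single when_def)
    then show ?thesis using I_smult[OF in1] by simp
  qed
  ultimately show ?thesis using in1 by (cases l; cases m; cases "snd l"; cases "snd m") auto
qed

sublocale star_quot_alg WM wstar rels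
proof unfold_locales
  show "star R s \<in> I" if "s \<in> rels" for s
    using that by (cases rule: rels_cases)
      (auto simp: comm_rel_star sphere_rel_star comm_rel_in sphere_rel_in)
qed simp_all

lemma star_add_Q: "X \<in> carrier Q \<Longrightarrow> Y \<in> carrier Q \<Longrightarrow> star Q (X \<oplus>\<^bsub>Q\<^esub> Y) = star Q X \<oplus>\<^bsub>Q\<^esub> star Q Y"
  by (elim QE) (simp add: star_coset coset_add star_add)

lemma star_smult_bas: "star Q (c \<odot>\<^bsub>Q\<^esub> bas w) = cnj c \<odot>\<^bsub>Q\<^esub> bas (wstar w)"
  by (simp add: coset_smult star_coset)

lemma star_closed_Q: "X \<in> carrier Q \<Longrightarrow> star Q X \<in> carrier Q"
  by (elim QE) (simp add: star_coset)

end

subsection \<open>Evaluation on the spheres\<close>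

context sphere
begin

text \<open>Only the pair of \<open>l\<close> and \<open>m\<close> changes its relative order, and
  \<open>cphase m l\<close> is the inverse of \<open>cphase l m\<close>.\<close>

lemma wphase_swap: "wphase (a @ l # m # b) = (cphase l m)\<^sup>2 * wphase (a @ m # l # b)"
proof (induction a)
  case Nil
  have "wphase (l # m # b) = cphase l m * (cphase l m * cphase m l) * wphase (l # m # b)
      / cphase l m"
    by (simp add: cphase_swap)
  then show ?case
    by (simp add: power2_eq_square mult_ac)
qed (simp add: mult_ac)

lemma wphase_insert_pair: "wphase (a @ pair b i @ w) = wphase (a @ w)"
  by (simp add: wphase_append cross_append_right)

lemma wprod_pair: "wprod x (pair b i) = x $ mk b i * cnj (x $ mk b i)"
  by (simp add: pair_def ev_def)

lemma spheres_sum: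
  "x \<in> spheres \<Longrightarrow> wprod x (pair b 1) + wprod x (pair b 2) + wprod x (pair b 3) = 1"
  by (simp add: spheres_def wprod_pair sum_3)

text \<open>Evaluation at a point of the spheres, twisted by \<open>wphase\<close> so that it
  respects the noncommutative relations. It is a linear functional, but not a character.\<close>

definition Psi :: "complex^6 \<Rightarrow> sphere_poly set \<Rightarrow> complex" where
  "Psi x = qlift complex_star_alg (\<lambda>w. wphase w * wprod x w)"

context
  fixes x :: "complex^6"
  assumes x: "x \<in> spheres"
begin

text \<open>A swap of letters changes \<open>wphase\<close> by exactly the commutation constant, and
  inserting a pair leaves it unchanged. What remains are the classical identities, which hold on the
  spheres.\<close>

lemma psi_vanish:
  assumes "s \<in> rels"
  shows "linext complex_star_alg (\<lambda>w. wphase w * wprod x w) (sng a 1 \<otimes>\<^bsub>R\<^esub> s \<otimes>\<^bsub>R\<^esub> sng b 1) = 0"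
proof -
  interpret C: calg complex_star_alg by (rule calg_complex)
  let ?f = "\<lambda>w. wphase w * wprod x w"
  have f: "?f \<in> carrier WM \<rightarrow> carrier complex_star_alg" by simp
  note L = linext_lin_map[OF calg_complex f]
  have sing: "linext complex_star_alg ?f (sng w c) = c * ?f w" for w c
    using C.linext_single[of ?f w c] by simp
  have diff: "linext complex_star_alg ?f (p - q) = linext complex_star_alg ?f p - linext complex_star_alg ?f q" for p q
    using linext_diff[OF calg_complex f, of p q] by (simp add: C.minus_smult)
  have add: "linext complex_star_alg ?f (p + q) = linext complex_star_alg ?f p + linext complex_star_alg ?f q" for p q
    using lin_map_add[OF L, of p q] by simp
  from assms show ?thesis
  proof (cases rule: rels_cases)
    case (1 l m)
    then show ?thesis
      using wphase_swap[of a l m b]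
      by (simp add: comm_rel_def mult_diff_left mult_diff_right diff sing mult_ac)
  next
    case (2 d)
    have "linext complex_star_alg ?f (sng a 1 \<otimes>\<^bsub>R\<^esub> s \<otimes>\<^bsub>R\<^esub> sng b 1) =
        wphase (a @ b) * wprod x (a @ b) *
          (wprod x (pair d 1) + wprod x (pair d 2) + wprod x (pair d 3) - 1)"
      unfolding 2 sphere_rel_def
      by (simp add: mult_diff_left mult_diff_right mult_add_left mult_add_right diff add sing
          wphase_insert_pair algebra_simps)
    then show ?thesis using spheres_sum[OF x] by simp
  qed
qed

lemma Psi_lin_map: "Psi x \<in> lin_map Q complex_star_alg"
  unfolding Psi_def by (rule qlift_lin_map[OF calg_complex]) (simp_all add: psi_vanish)

lemma Psi_bas: "Psi x (bas w) = wphase w * wprod x w"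
  unfolding Psi_def by (rule qlift_bas[OF calg_complex]) (simp_all add: psi_vanish)

lemma Psi_add: "X \<in> carrier Q \<Longrightarrow> Y \<in> carrier Q \<Longrightarrow> Psi x (X \<oplus>\<^bsub>Q\<^esub> Y) = Psi x X + Psi x Y"
  using lin_map_add[OF Psi_lin_map] by simp

lemma Psi_smult: "X \<in> carrier Q \<Longrightarrow> Psi x (c \<odot>\<^bsub>Q\<^esub> X) = c * Psi x X"
  using lin_map_smult[OF Psi_lin_map] by simp

text \<open>Reversing a word and flipping its letters replaces each factor \<open>cphase l m\<close>
  by \<open>cphase m l\<close>, its conjugate; the monomial is conjugated as well.\<close>

lemma Psi_star:
  assumes "X \<in> carrier Q" shows "Psi x (star Q X) = cnj (Psi x X)"
  using assms
proof (induction rule: Q_induct)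
  case (bas w c)
  have cr: "cross (rev (map flip w)) [flip l] = cnj (prod_list (map (cphase l) w))" for l w
    by (induction w) (simp_all add: cphase_cnj cphase_flip_flip mult.commute)
  have "wphase (wstar w) = cnj (wphase w)"
    by (induction w) (simp_all add: wstar_def wphase_append cr mult.commute)
  moreover have "wprod x (wstar w) = cnj (wprod x w)"
    by (induction w) (simp_all add: wstar_def ev_def flip_def mult.commute)
  ultimately show ?case by (simp add: star_smult_bas Psi_smult Psi_bas)
qed (simp add: star_add_Q Psi_add star_closed_Q)

end

subsection \<open>Normalised monomials\<close>

text \<open>The Weyl-ordered word: it evaluates to the plain monomial and depends only on the
  multiset of its letters.\<close>

definition Qn :: "letter list \<Rightarrow> sphere_poly set" where
  "Qn w = cnj (wphase w) \<odot>\<^bsub>Q\<^esub> bas w"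

lemma Qn_closed [simp]: "Qn w \<in> carrier Q"
  by (simp add: Qn_def)

lemma bas_Qn: "bas w = wphase w \<odot>\<^bsub>Q\<^esub> Qn w"
  using Q.smult_assoc[of "bas w" "wphase w" "cnj (wphase w)"] by (simp add: Qn_def wphase_cnj)

lemma Psi_Qn: "x \<in> spheres \<Longrightarrow> Psi x (Qn w) = wprod x w"
  using wphase_cnj(2)[of w] by (simp add: Qn_def Psi_smult Psi_bas mult.assoc[symmetric])

lemma Qn_mult: "Qn v \<otimes>\<^bsub>Q\<^esub> Qn w = cross v w \<odot>\<^bsub>Q\<^esub> Qn (v @ w)"
proof -
  have "cross v w * cnj (cross v w) = 1" using complex_norm_square[of "cross v w"] by simp
  then show ?thesis
    by (simp add: Qn_def Q.smult_mult_l Q.smult_mult_r bas_mult wphase_append mult_ac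
        flip: Q.smult_assoc)
qed

lemma Qn_Nil: "Qn [] = \<one>\<^bsub>Q\<^esub>"
  using coset_one by (simp add: Qn_def)

lemma Qn_swap: "Qn (a @ l # m # b) = Qn (a @ m # l # b)"
proof -
  have "sng a 1 \<otimes>\<^bsub>R\<^esub> comm_rel l m \<otimes>\<^bsub>R\<^esub> sng b 1 \<in> I"
    by (intro I.I_l_closed I.I_r_closed comm_rel_in) simp_all
  then have "bas (a @ l # m # b) = coset (sng (a @ m # l # b) ((cphase l m)\<^sup>2))"
    by (subst coset_eq_iff) (simp_all add: comm_rel_def mult_diff_left mult_diff_right)
  then have "bas (a @ l # m # b) = (cphase l m)\<^sup>2 \<odot>\<^bsub>Q\<^esub> bas (a @ m # l # b)"
    by (simp add: coset_smult)
  then have "Qn (a @ l # m # b) =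
      (cnj ((cphase l m)\<^sup>2 * wphase (a @ m # l # b)) * (cphase l m)\<^sup>2) \<odot>\<^bsub>Q\<^esub> bas (a @ m # l # b)"
    unfolding Qn_def wphase_swap[of a l m b] by (simp only:) (subst Q.smult_assoc, simp_all)
  moreover have "cnj ((cphase l m)\<^sup>2 * W) * (cphase l m)\<^sup>2 = cnj W" for W
  proof -
    have "cnj ((cphase l m)\<^sup>2 * W) * (cphase l m)\<^sup>2 = (cphase l m * cphase m l)\<^sup>2 * cnj W"
      by (simp add: cphase_cnj power2_eq_square mult_ac)
    then show ?thesis by (simp add: cphase_swap)
  qed
  ultimately show ?thesis by (simp only: Qn_def)
qed

lemma Qn_move: "Qn (a @ u @ l # w) = Qn (a @ l # u @ w)"
proof (induction u arbitrary: a)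
  case (Cons m u)
  have "Qn (a @ (m # u) @ l # w) = Qn ((a @ [m]) @ u @ l # w)" by simp
  also have "\<dots> = Qn (a @ m # l # u @ w)" unfolding Cons.IH by simp
  also have "\<dots> = Qn (a @ l # (m # u) @ w)" by (subst Qn_swap) simp
  finally show ?case .
qed simp

text \<open>The prefix is general so that a letter moved to the front can join the part that is
  already in order.\<close>

lemma Qn_perm_append: "mset v = mset w \<Longrightarrow> Qn (a @ v) = Qn (a @ w)"
proof (induction v arbitrary: a w)
  case (Cons l v)
  then have "l \<in> set w" by (metis list.set_intros(1) mset_eq_setD)
  then obtain w1 w2 where w: "w = w1 @ l # w2" by (metis split_list)
  have "mset v = mset (w1 @ w2)" using Cons.prems by (simp add: w)
  from Cons.IH[OF this, of "a @ [l]"] show ?case by (simp add: w Qn_move)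
qed simp

lemma Qn_perm: "mset v = mset w \<Longrightarrow> Qn v = Qn w"
  using Qn_perm_append[of v w "[]"] by simp

definition QM :: "letter multiset \<Rightarrow> sphere_poly set" where
  "QM N = Qn (SOME w. mset w = N)"

lemma QM_mset: "QM (mset w) = Qn w"
  unfolding QM_def by (intro Qn_perm someI) simp

lemma QM_closed [simp]: "QM N \<in> carrier Q"
  by (simp add: QM_def)

lemma Qn_sphere: "Qn w = Qn (pair b 1 @ w) \<oplus>\<^bsub>Q\<^esub> Qn (pair b 2 @ w) \<oplus>\<^bsub>Q\<^esub> Qn (pair b 3 @ w)"
proof -
  have "sphere_rel b \<otimes>\<^bsub>R\<^esub> sng w 1 \<in> I" by (intro I.I_r_closed sphere_rel_in) simp
  then have "bas (pair b 1 @ w) \<oplus>\<^bsub>Q\<^esub> bas (pair b 2 @ w) \<oplus>\<^bsub>Q\<^esub> bas (pair b 3 @ w) = bas w"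
    by (simp add: coset_add, subst coset_eq_iff)
      (simp_all add: sphere_rel_def mult_diff_left mult_add_left)
  moreover have "wphase (pair b i @ w) = wphase w" for i
    using wphase_insert_pair[of "[]" b i w] by simp
  ultimately show ?thesis by (simp add: Qn_def flip: Q.smult_r_distr)
qed

lemma QM_sphere:
  "QM (N + mset (pair b 3)) =
    QM N \<oplus>\<^bsub>Q\<^esub> (- 1) \<odot>\<^bsub>Q\<^esub> QM (N + mset (pair b 1)) \<oplus>\<^bsub>Q\<^esub> (- 1) \<odot>\<^bsub>Q\<^esub> QM (N + mset (pair b 2))"
proof -
  obtain w where w: "N = mset w" by (metis ex_mset)
  have e: "QM (N + mset (pair b i)) = Qn (pair b i @ w)" for i
    using QM_mset[of "pair b i @ w"] by (simp add: w add.commute)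
  have *: "c = (a \<oplus>\<^bsub>Q\<^esub> b \<oplus>\<^bsub>Q\<^esub> c) \<oplus>\<^bsub>Q\<^esub> \<ominus>\<^bsub>Q\<^esub> a \<oplus>\<^bsub>Q\<^esub> \<ominus>\<^bsub>Q\<^esub> b"
    if "a \<in> carrier Q" "b \<in> carrier Q" "c \<in> carrier Q" for a b c
  proof -
    have "(a \<oplus>\<^bsub>Q\<^esub> b \<oplus>\<^bsub>Q\<^esub> c) \<oplus>\<^bsub>Q\<^esub> \<ominus>\<^bsub>Q\<^esub> a \<oplus>\<^bsub>Q\<^esub> \<ominus>\<^bsub>Q\<^esub> b =
        c \<oplus>\<^bsub>Q\<^esub> ((a \<oplus>\<^bsub>Q\<^esub> b) \<oplus>\<^bsub>Q\<^esub> (\<ominus>\<^bsub>Q\<^esub> a \<oplus>\<^bsub>Q\<^esub> \<ominus>\<^bsub>Q\<^esub> b))"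
      using that by (simp add: Q.a_ac del: Q.minus_add)
    then show ?thesis using that Q.r_neg[of "a \<oplus>\<^bsub>Q\<^esub> b"] by (simp add: Q.minus_add)
  qed
  show ?thesis unfolding e
    using *[of "Qn (pair b 1 @ w)" "Qn (pair b 2 @ w)" "Qn (pair b 3 @ w)"] Qn_sphere[of w b]
    by (simp add: w QM_mset Q.smult_minus_one)
qed

definition normal_mon :: "letter multiset \<Rightarrow> bool" where
  "normal_mon N \<longleftrightarrow> (\<forall>b. (mk b 3, False) \<notin># N \<or> (mk b 3, True) \<notin># N)"

definition normal_span :: "sphere_poly set set" where
  "normal_span = {linext Q QM p | p. Poly_Mapping.keys p \<subseteq> Collect normal_mon}"

lemma QM_fun: "QM \<in> C \<rightarrow> carrier Q" by simp

lemma normal_span_add: "X \<in> normal_span \<Longrightarrow> Y \<in> normal_span \<Longrightarrow> X \<oplus>\<^bsub>Q\<^esub> Y \<in> normal_span"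
proof -
  assume "X \<in> normal_span" "Y \<in> normal_span"
  then obtain p q where pq: "Poly_Mapping.keys p \<subseteq> Collect normal_mon" "X = linext Q QM p"
      "Poly_Mapping.keys q \<subseteq> Collect normal_mon" "Y = linext Q QM q"
    unfolding normal_span_def by blast
  have "X \<oplus>\<^bsub>Q\<^esub> Y = linext Q QM (p + q)"
    unfolding pq by (rule Q.linext_add[OF QM_fun subset_UNIV subset_UNIV, symmetric])
  moreover have "Poly_Mapping.keys (p + q) \<subseteq> Collect normal_mon"
    using Poly_Mapping.keys_add[of p q] pq by blast
  ultimately show ?thesis unfolding normal_span_def by blast
qed

lemma normal_span_smult: "X \<in> normal_span \<Longrightarrow> c \<odot>\<^bsub>Q\<^esub> X \<in> normal_span"
proof -
  have "c \<odot>\<^bsub>Q\<^esub> linext Q QM p \<in> normal_span" if "Poly_Mapping.keys p \<subseteq> Collect normal_mon" for p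
    using that
  proof (induction rule: pm_induct)
    case zero
    have "linext Q QM 0 \<in> normal_span" unfolding normal_span_def by (rule CollectI, rule exI[of _ 0]) simp
    then show ?case by simp
  next
    case (single x d)
    have "linext Q QM (Poly_Mapping.single x (c * d)) \<in> normal_span"
      unfolding normal_span_def using single by (intro CollectI exI[of _ "Poly_Mapping.single x (c * d)"]) auto
    then show ?case by (simp add: Q.linext_single Q.smult_assoc)
  next
    case (add p q)
    have "linext Q QM p \<in> carrier Q" "linext Q QM q \<in> carrier Q"
      using Q.linext_closed[OF QM_fun] by auto
    then show ?case
      using add by (simp add: Q.linext_add[OF QM_fun] Q.smult_r_distr normal_span_add)
  qed
  then show "X \<in> normal_span \<Longrightarrow> c \<odot>\<^bsub>Q\<^esub> X \<in> normal_span" by (auto simp: normal_span_def)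
qed

text \<open>The sphere relation replaces a pair of third coordinates by 1 minus the pairs of first
  and second coordinates. Each use removes two letters of index 3, so the rewriting ends.\<close>

lemma QM_in_normal_span: "QM N \<in> normal_span"
proof (induction "size (filter_mset (\<lambda>l. ix (fst l) = 3) N)" arbitrary: N rule: less_induct)
  case less
  show ?case
  proof (cases "normal_mon N")
    case True
    then show ?thesis
      unfolding normal_span_def
      by (intro CollectI exI[of _ "Poly_Mapping.single N 1"]) (simp add: Q.linext_single)
  next
    case False
    then obtain b where b: "(mk b 3, False) \<in># N" "(mk b 3, True) \<in># N" by (auto simp: normal_mon_def)
    from multi_member_split[OF b(1)] obtain N1 where N1: "N = add_mset (mk b 3, False) N1" by auto
    then have "(mk b 3, True) \<in># N1" using b(2) by auto
    from multi_member_split[OF this] obtain N' where "N1 = add_mset (mk b 3, True) N'" by auto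
    then have N: "N = N' + mset (pair b 3)" by (simp add: N1 pair_def)
    have "ix (mk b 3) = 3" "ix (mk b 1) \<noteq> 3" "ix (mk b 2) \<noteq> 3" by simp_all
    then have "QM N' \<in> normal_span" "QM (N' + mset (pair b 1)) \<in> normal_span"
        "QM (N' + mset (pair b 2)) \<in> normal_span"
      by (intro less; simp add: N pair_def)+
    then show ?thesis unfolding N QM_sphere by (intro normal_span_add normal_span_smult)
  qed
qed

lemma carrier_normal_span:
  assumes "X \<in> carrier Q"
  obtains p where "Poly_Mapping.keys p \<subseteq> Collect normal_mon" "X = linext Q QM p"
proof -
  have "X \<in> normal_span"
    using assms
  proof (induction rule: Q_induct)
    case (bas w c)
    show ?case unfolding bas_Qn QM_mset[symmetric] by (intro normal_span_smult QM_in_normal_span)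
  qed (rule normal_span_add)
  then show ?thesis using that by (auto simp: normal_span_def)
qed

end

subsection \<open>Injectivity of the evaluation\<close>

definition monomial :: "complex^6 \<Rightarrow> letter multiset \<Rightarrow> complex" where
  "monomial x N = (\<Prod>l\<in>#N. ev x l)"

lemma monomial_simps [simp]: "monomial x {#} = 1" "monomial x (add_mset l N) = ev x l * monomial x N"
  by (simp_all add: monomial_def)

lemma monomial_mset: "monomial x (mset w) = wprod x w"
  by (induction w) simp_all

lemma ev_mult: "ev (x * y) l = ev x l * ev y l"
  by (simp add: ev_def)

lemma monomial_mult: "monomial (x * y) N = monomial x N * monomial y N"
  by (induction N) (simp_all add: ev_mult mult_ac)

lemma monomial_nonzero: "(\<And>j. x $ j \<noteq> 0) \<Longrightarrow> monomial x N \<noteq> 0"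
  by (induction N) (simp_all add: ev_def)

text \<open>The relation of a sphere eliminates \<open>z\<^sub>3 z\<^sub>3\<^sup>*\<close> (and \<open>z\<^sub>6 z\<^sub>6\<^sup>*\<close>), so in a reduced monomial the total exponent
  of \<open>z\<^sub>3\<close> and its adjoint is the absolute value of the weight \<open>wt3\<close>.\<close>

definition wt3 :: "letter multiset \<Rightarrow> bool \<Rightarrow> int" where
  "wt3 N b = int (count N (mk b 3, False)) - int (count N (mk b 3, True))"

definition on3 :: "(bool \<Rightarrow> complex) \<Rightarrow> complex^6" where
  "on3 \<phi> = (\<chi> j. if ix j = 3 then \<phi> (blk j) else 1)"

lemma on3_nth [simp]: "on3 \<phi> $ mk b i = (if i = 3 then \<phi> b else 1)"
  by (simp add: on3_def)

lemma letter_cases: obtains b i s where "(l :: letter) = (mk b i, s)"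
  by (metis mk_blk_ix prod.exhaust_sel)

lemma cnj_unit_power_int: "cmod z = 1 \<Longrightarrow> cnj z = z powi (- 1)"
  by (simp add: power_int_minus inverse_complex_def complex_norm_square[symmetric] complex_eq_iff
      cmod_power2[symmetric])

lemma monomial_on3_unit:
  assumes "\<And>b. cmod (\<phi> b) = 1"
  shows "monomial (on3 \<phi>) N = (\<Prod>b\<in>UNIV. \<phi> b powi wt3 N b)"
proof (induction N)
  case empty
  show ?case by (simp add: wt3_def)
next
  case (add l N)
  have nz: "\<phi> b \<noteq> 0" for b using assms[of b] by auto
  obtain b i s where l: "l = (mk b i, s)" by (rule letter_cases)
  have w: "wt3 (add_mset l N) = (\<lambda>c. wt3 N c + (if c = b \<and> i = 3 then (if s then - 1 else 1) else 0))"
    by (auto simp: wt3_def l fun_eq_iff)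
  show ?case
  proof (cases "i = 3")
    case False
    then have "ev (on3 \<phi>) l = 1" by (simp add: ev_def l)
    then show ?thesis using False by (simp add: w add)
  next
    case True
    have "ev (on3 \<phi>) l = \<phi> b powi (if s then - 1 else 1)"
      using cnj_unit_power_int[OF assms[of b]] True by (simp add: ev_def l)
    then show ?thesis using True nz by (cases b) (simp_all add: w add UNIV_bool power_int_add)
  qed
qed

text \<open>The right-hand side depends on \<open>N\<close> only through \<open>wt3 N\<close>. A
  rescaling of the third coordinates by reals is therefore a common factor of all normal monomials
  of a given weight.\<close>

lemma (in sphere) monomial_on3_real:
  assumes "normal_mon N"
  shows "monomial (on3 (\<lambda>b. of_real (r b))) N = (\<Prod>b\<in>UNIV. of_real (r b) ^ nat \<bar>wt3 N b\<bar>)"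
proof -
  have m: "monomial (on3 (\<lambda>b. of_real (r b))) N =
      (\<Prod>b\<in>UNIV. of_real (r b) ^ (count N (mk b 3, False) + count N (mk b 3, True)))" for N
  proof (induction N)
    case (add l N)
    obtain b i s where l: "l = (mk b i, s)" by (rule letter_cases)
    show ?case
      by (cases "i = 3"; cases b; cases s) (simp_all add: add l ev_def UNIV_bool)
  qed simp
  have "nat \<bar>wt3 N b\<bar> = count N (mk b 3, False) + count N (mk b 3, True)" for b
  proof -
    have "count N (mk b 3, False) = 0 \<or> count N (mk b 3, True) = 0"
      using assms by (auto simp: normal_mon_def not_in_iff)
    then show ?thesis by (auto simp: wt3_def)
  qed
  then show ?thesis by (simp add: m)
qed

text \<open>The bound 1/2 keeps the radius left for the third coordinate positive, as 1 - 1/4 - 1/4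
  > 0, and survives coordinatewise products. Zero is excluded so that no monomial vanishes here; the
  third coordinates carry only a phase.\<close>

definition polydisc :: "(complex^6) set" where
  "polydisc = {u. \<forall>b i. if i = 3 then cmod (u $ mk b i) = 1 else 0 < cmod (u $ mk b i) \<and> cmod (u $ mk b i) \<le> 1 / 2}"

definition radius :: "complex^6 \<Rightarrow> bool \<Rightarrow> real" where
  "radius u b = sqrt (1 - (cmod (u $ mk b 1))\<^sup>2 - (cmod (u $ mk b 2))\<^sup>2)"

lemma polydiscD:
  assumes "u \<in> polydisc"
  shows "cmod (u $ mk b 3) = 1" "i \<noteq> 3 \<Longrightarrow> 0 < cmod (u $ mk b i)" "i \<noteq> 3 \<Longrightarrow> cmod (u $ mk b i) \<le> 1 / 2"
proof -
  have *: "if i = 3 then cmod (u $ mk b i) = 1 else 0 < cmod (u $ mk b i) \<and> cmod (u $ mk b i) \<le> 1 / 2" for i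
    using assms unfolding polydisc_def by blast
  show "cmod (u $ mk b 3) = 1" "i \<noteq> 3 \<Longrightarrow> 0 < cmod (u $ mk b i)" "i \<noteq> 3 \<Longrightarrow> cmod (u $ mk b i) \<le> 1 / 2"
    using *[of 3] *[of i] by (simp_all split: if_splits)
qed

lemma polydisc_mult: "u \<in> polydisc \<Longrightarrow> v \<in> polydisc \<Longrightarrow> u * v \<in> polydisc"
proof -
  assume u: "u \<in> polydisc" and v: "v \<in> polydisc"
  have "if i = 3 then cmod ((u * v) $ mk b i) = 1
    else 0 < cmod ((u * v) $ mk b i) \<and> cmod ((u * v) $ mk b i) \<le> 1 / 2" for b i
  proof (cases "i = 3")
    case False
    have "cmod (u $ mk b i) * cmod (v $ mk b i) \<le> 1 / 2 * (1 / 2)"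
      using polydiscD(3)[OF u False, of b] polydiscD(3)[OF v False, of b] by (intro mult_mono) auto
    then show ?thesis
      using False polydiscD(2)[OF u False, of b] polydiscD(2)[OF v False, of b] by (simp add: norm_mult)
  qed (simp add: norm_mult polydiscD(1)[OF u] polydiscD(1)[OF v])
  then show ?thesis unfolding polydisc_def by blast
qed

lemma polydisc_nonzero: "u \<in> polydisc \<Longrightarrow> u $ j \<noteq> 0"
  using polydiscD(1)[of u "blk j"] polydiscD(2)[of u "ix j" "blk j"] mk_blk_ix[of j]
  by (cases "ix j = 3") auto

lemma radius_pos:
  assumes "u \<in> polydisc"
  shows "radius u b > 0" and "(radius u b)\<^sup>2 = 1 - (cmod (u $ mk b 1))\<^sup>2 - (cmod (u $ mk b 2))\<^sup>2"
proof -
  have "(cmod (u $ mk b i))\<^sup>2 \<le> (1 / 2)\<^sup>2" if "i \<noteq> 3" for i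
    using polydiscD(3)[OF assms that] by (intro power_mono) auto
  from this[of 1] this[of 2] show "radius u b > 0"
      "(radius u b)\<^sup>2 = 1 - (cmod (u $ mk b 1))\<^sup>2 - (cmod (u $ mk b 2))\<^sup>2"
    by (simp_all add: radius_def power2_eq_square)
qed

lemma sphere_point:
  assumes "u \<in> polydisc" "\<And>b. cmod (\<phi> b) = 1"
  shows "u * on3 (\<lambda>b. of_real (radius u b)) * on3 \<phi> \<in> spheres"
proof -
  have u3: "cmod (u $ mk b 3) = 1" for b using assms(1) by (simp add: polydisc_def)
  have "complex_of_real ((cmod (u $ mk b 1))\<^sup>2 + (cmod (u $ mk b 2))\<^sup>2 + (radius u b)\<^sup>2) = 1" for b
    by (simp add: radius_pos(2)[OF assms(1)])
  moreover have "cmod (u $ mk b 3 * of_real (radius u b) * \<phi> b) = radius u b" for b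
    using radius_pos(1)[OF assms(1), of b] u3[of b] assms(2)[of b] by (simp add: norm_mult)
  ultimately show ?thesis
    by (simp add: spheres_def sum_3 complex_norm_square[symmetric] del: complex_cnj_mult)
qed

text \<open>Varying a single coordinate recovers its two exponents: a real value determines their
  sum, unit values their difference. For the third coordinates, equality of weights together with
  normality is enough.\<close>

lemma (in sphere) normal_mon_eqI:
  assumes N: "normal_mon N" "normal_mon N'" and wt: "wt3 N = wt3 N'"
    and eq: "\<And>u. u \<in> polydisc \<Longrightarrow> monomial u N = monomial u N'"
  shows "N = N'"
proof (rule multiset_eqI)
  fix l :: letter
  obtain b i s where l: "l = (mk b i, s)" by (rule letter_cases)
  show "count N l = count N' l"
  proof (cases "i = 3")
    case True
    have "wt3 N b = wt3 N' b" using wt by simp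
    then show ?thesis using N True
      by (cases s) (auto simp: l wt3_def normal_mon_def not_in_iff dest!: spec[of _ b])
  next
    case False
    define u0 :: "complex^6" where "u0 = (\<chi> j. if ix j = 3 then 1 else 1 / 2)"
    have u0: "u0 \<in> polydisc" by (simp add: polydisc_def u0_def)
    define h :: "complex \<Rightarrow> complex^6" where "h z = (\<chi> j. if j = mk b i then z else 1)" for z
    have h_nth: "h z $ mk b' i' = (if b' = b \<and> i' = i then z else 1)" for z b' i'
      by (simp add: h_def)
    have mh: "monomial (h z) N = z ^ count N (mk b i, False) * cnj z ^ count N (mk b i, True)" for z N
    proof (induction N)
      case (add m N)
      obtain b' i' s' where m: "m = (mk b' i', s')" by (rule letter_cases)
      show ?case by (cases "b' = b \<and> i' = i"; cases s') (auto simp: add m ev_def h_nth)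
    qed simp
    have eqh: "monomial (h z) N = monomial (h z) N'" if "0 < cmod z" "cmod z \<le> 1" for z
    proof -
      have "u0 * h z \<in> polydisc"
        using that False by (auto simp: polydisc_def u0_def h_def norm_mult)
      from eq[OF this] eq[OF u0] monomial_nonzero[of u0 N', OF polydisc_nonzero[OF u0]] show ?thesis
        by (simp add: monomial_mult)
    qed
    let ?p = "count N (mk b i, False)" and ?q = "count N (mk b i, True)"
    let ?p' = "count N' (mk b i, False)" and ?q' = "count N' (mk b i, True)"
    \<comment> \<open>At a real value the coordinate and its adjoint agree, so only the total
      exponent is seen.\<close>
    have "(1 / 2 :: complex) ^ (?p + ?q) = (1 / 2) ^ (?p' + ?q')"
      using eqh[of "1 / 2"] by (simp add: mh power_add)
    then have "cmod ((1 / 2 :: complex) ^ (?p + ?q)) = cmod ((1 / 2) ^ (?p' + ?q'))" by simp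
    then have "(1 / 2 :: real) ^ (?p + ?q) = (1 / 2) ^ (?p' + ?q')" by (simp add: norm_power norm_divide)
    then have sum: "?p + ?q = ?p' + ?q'" by (subst (asm) power_inject_exp') simp_all
    define d where "d = real ?p - real ?q - (real ?p' - real ?q')"
    have cis_eq: "cis (t * d) = 1" for t
    proof -
      have mc: "monomial (h (cis t)) N = cis (t * (real (count N (mk b i, False)) - real (count N (mk b i, True))))" for N
        unfolding mh by (simp add: cis_cnj Complex.DeMoivre cis_mult algebra_simps)
      have "cis (t * d) = monomial (h (cis t)) N * cnj (monomial (h (cis t)) N')"
        unfolding mc by (simp add: d_def cis_cnj cis_mult algebra_simps)
      also have "\<dots> = 1" using eqh[of "cis t"] unfolding mc by (simp add: cis_cnj cis_mult)
      finally show ?thesis .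
    qed
    have "d = 0"
    proof (rule ccontr)
      assume "d \<noteq> 0"
      then have "cis ((pi / d) * d) = -1" by simp
      then show False using cis_eq[of "pi / d"] by simp
    qed
    then show ?thesis using sum by (cases s) (simp_all add: l d_def)
  qed
qed

lemma powi_distinct:
  fixes m m' :: "bool \<Rightarrow> int"
  assumes "m \<noteq> m'"
  shows "\<exists>\<phi>. (\<forall>b. cmod (\<phi> b) = 1) \<and> (\<Prod>b\<in>UNIV. \<phi> b powi m b) \<noteq> (\<Prod>b\<in>UNIV. \<phi> b powi m' b)"
proof -
  obtain b where b: "m b \<noteq> m' b" using assms by auto
  \<comment> \<open>Chosen so that the two characters take opposite values at the phase
    \<open>cis t\<close>.\<close>
  define t where "t = pi / real_of_int (m b - m' b)"
  define \<phi> where "\<phi> = (\<lambda>c. if c = b then cis t else 1)"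
  have p: "(\<Prod>c\<in>UNIV. \<phi> c powi n c) = cis (t * real_of_int (n b))" for n
    by (cases b) (simp_all add: \<phi>_def UNIV_bool cis_power_int mult.commute)
  have "t * real_of_int (m b) = t * real_of_int (m' b) + t * real_of_int (m b - m' b)"
    by (simp add: algebra_simps)
  also have "t * real_of_int (m b - m' b) = pi" using b by (simp add: t_def)
  finally have "cis (t * real_of_int (m b)) = - cis (t * real_of_int (m' b))"
    by (simp flip: cis_mult)
  moreover have "z \<noteq> - z" if "z \<noteq> 0" for z :: complex
    using that by (simp add: eq_neg_iff_add_eq_0 flip: mult_2)
  ultimately have "cis (t * real_of_int (m b)) \<noteq> cis (t * real_of_int (m' b))"
    using cis_neq_zero by metis
  then show ?thesis by (intro exI[of _ \<phi>]) (simp add: p, simp add: \<phi>_def)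
qed

text \<open>The moduli of the third coordinates depend on the others, but their phases are free, and
  these separate the classes of equal \<open>wt3\<close>. Within a class the radii contribute one
  common nonzero factor; once it is cancelled, the monomials are distinct characters of the
  multiplicative polydisc.\<close>

lemma (in sphere) normal_monomials_independent:
  assumes F: "finite F" "\<And>N. N \<in> F \<Longrightarrow> normal_mon N"
    and zero: "\<And>x. x \<in> spheres \<Longrightarrow> (\<Sum>N\<in>F. a N * monomial x N) = 0"
    and N: "N \<in> F"
  shows "a N = 0"
proof -
  define Fm where "Fm m = {N \<in> F. wt3 N = m}" for m
  have cls: "(\<Sum>N\<in>Fm m. a N * monomial u N) = 0" if u: "u \<in> polydisc" and m: "m \<in> wt3 ` F" for u m
  proof -
    let ?r = "\<lambda>b. complex_of_real (radius u b)"
    define S where "S m = (\<Sum>N\<in>Fm m. a N * monomial (u * on3 ?r) N)" for m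
    have "S m = 0"
    proof (rule characters_independent[of "wt3 ` F" "\<lambda>_. 1" "{\<phi>. \<forall>b. cmod (\<phi> b) = 1}"
          "\<lambda>\<phi> \<psi> b. \<phi> b * \<psi> b" "\<lambda>m \<phi>. \<Prod>b\<in>UNIV. \<phi> b powi m b"])
      show "(\<Sum>m\<in>wt3 ` F. S m * (\<Prod>b\<in>UNIV. \<phi> b powi m b)) = 0"
        if "\<phi> \<in> {\<phi>. \<forall>b. cmod (\<phi> b) = 1}" for \<phi>
      proof -
        have \<phi>: "\<And>b. cmod (\<phi> b) = 1" using that by auto
        have "(\<Sum>m\<in>wt3 ` F. S m * (\<Prod>b\<in>UNIV. \<phi> b powi m b)) =
            (\<Sum>m\<in>wt3 ` F. \<Sum>N\<in>Fm m. a N * monomial (u * on3 ?r * on3 \<phi>) N)"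
          unfolding S_def sum_distrib_right
          by (intro sum.cong refl, subst monomial_mult[of "u * on3 ?r"])
            (simp add: Fm_def monomial_on3_unit[OF \<phi>])
        also have "\<dots> = (\<Sum>N\<in>F. a N * monomial (u * on3 ?r * on3 \<phi>) N)"
          unfolding Fm_def by (rule sum.image_gen[OF F(1), symmetric])
        also have "\<dots> = 0" by (rule zero[OF sphere_point[OF u \<phi>]])
        finally show ?thesis .
      qed
      show "\<exists>g\<in>{\<phi>. \<forall>b. cmod (\<phi> b) = 1}. (\<Prod>b\<in>UNIV. g b powi i b) \<noteq> (\<Prod>b\<in>UNIV. g b powi j b)"
        if "i \<noteq> j" for i j :: "bool \<Rightarrow> int"
        using powi_distinct[OF that] by blast
    qed (use F m in \<open>auto simp: norm_mult power_int_mult_distrib prod.distrib\<close>)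
    moreover have "S m = (\<Sum>N\<in>Fm m. a N * monomial u N) * (\<Prod>b\<in>UNIV. ?r b ^ nat \<bar>m b\<bar>)"
      unfolding S_def sum_distrib_right
      by (intro sum.cong refl)
        (use F(2) in \<open>auto simp: Fm_def monomial_mult[of u] monomial_on3_real mult.assoc\<close>)
    moreover have "(\<Prod>b\<in>UNIV. ?r b ^ nat \<bar>m b\<bar>) \<noteq> 0"
      using radius_pos(1)[OF u] by (simp add: less_imp_neq[symmetric])
    ultimately show ?thesis by simp
  qed
  define u0 :: "complex^6" where "u0 = (\<chi> j. if ix j = 3 then 1 else 1 / 2)"
  have u0: "u0 \<in> polydisc" by (simp add: polydisc_def u0_def)
  show ?thesis
  proof (rule characters_independent[of "Fm (wt3 N)" u0 polydisc "(*)" "\<lambda>N u. monomial u N"])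
    show "\<exists>u\<in>polydisc. monomial u N1 \<noteq> monomial u N2"
      if "N1 \<in> Fm (wt3 N)" "N2 \<in> Fm (wt3 N)" "N1 \<noteq> N2" for N1 N2
      using normal_mon_eqI[of N1 N2] that F(2) by (auto simp: Fm_def)
    show "monomial u0 M \<noteq> 0" for M by (rule monomial_nonzero) (rule polydisc_nonzero[OF u0])
    show "(\<Sum>M\<in>Fm (wt3 N). a M * monomial u M) = 0" if "u \<in> polydisc" for u
      by (rule cls[OF that]) (use N in auto)
  qed (use F N u0 in \<open>auto simp: Fm_def polydisc_mult monomial_mult\<close>)
qed

context sphere
begin

lemma Psi_QM: "x \<in> spheres \<Longrightarrow> Psi x (QM N) = monomial x N"
  using Psi_Qn[of x] QM_mset monomial_mset by (metis ex_mset)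

lemma Psi_injective:
  assumes X: "X \<in> carrier Q" and zero: "\<And>x. x \<in> spheres \<Longrightarrow> Psi x X = 0"
  shows "X = \<zero>\<^bsub>Q\<^esub>"
proof -
  obtain p where p: "Poly_Mapping.keys p \<subseteq> Collect normal_mon" "X = linext Q QM p"
    using carrier_normal_span[OF X] .
  have lin: "Psi x (linext Q QM p) = (\<Sum>N\<in>Poly_Mapping.keys p. Poly_Mapping.lookup p N * monomial x N)"
    if x: "x \<in> spheres" for x
  proof -
    have "finite S \<Longrightarrow> Psi x (finsum Q (\<lambda>N. Poly_Mapping.lookup p N \<odot>\<^bsub>Q\<^esub> QM N) S) =
        (\<Sum>N\<in>S. Poly_Mapping.lookup p N * monomial x N)" for S
    proof (induction S rule: finite_induct)
      case empty
      show ?case using lin_map_zero[OF Psi_lin_map[OF x] Q_calg calg_complex] by simp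
    next
      case (insert N S)
      then show ?case
        using Q.finsum_closed[of "\<lambda>N. Poly_Mapping.lookup p N \<odot>\<^bsub>Q\<^esub> QM N" S]
        by (subst Q.finsum_insert) (simp_all add: Psi_add[OF x] Psi_smult[OF x] Psi_QM[OF x])
    qed
    then show ?thesis unfolding linext_def by simp
  qed
  have "Poly_Mapping.lookup p N = 0" if "N \<in> Poly_Mapping.keys p" for N
    by (rule normal_monomials_independent[of "Poly_Mapping.keys p"])
      (use p zero lin that in auto)
  then have "p = 0" by (metis in_keys_iff lookup_zero poly_mapping_eqI)
  then show ?thesis by (simp add: p(2))
qed

lemma Psi_eqI:
  assumes "X \<in> carrier Q" "Y \<in> carrier Q" "\<And>x. x \<in> spheres \<Longrightarrow> Psi x X = Psi x Y"
  shows "X = Y"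
proof -
  have "X \<oplus>\<^bsub>Q\<^esub> (- 1) \<odot>\<^bsub>Q\<^esub> Y = \<zero>\<^bsub>Q\<^esub>"
    using assms by (intro Psi_injective) (simp_all add: Psi_add Psi_smult)
  then show ?thesis using assms(1,2) by (simp add: Q.smult_minus_one)
      (metis Q.add.inv_equality Q.minus_minus Q.add.inv_closed)
qed

end

section \<open>The coaction\<close>

context calg
begin

lemma lsum_add:
  "(\<And>i. i \<in> set xs \<Longrightarrow> f i \<in> carrier A) \<Longrightarrow> (\<And>i. i \<in> set xs \<Longrightarrow> g i \<in> carrier A) \<Longrightarrow>
    lsum A (map (\<lambda>i. f i \<oplus> g i) xs) = lsum A (map f xs) \<oplus> lsum A (map g xs)"
proof (induction xs)
  case (Cons i xs)
  have "lsum A (map f xs) \<in> carrier A" "lsum A (map g xs) \<in> carrier A"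
    using Cons.prems by (auto intro!: lsum_closed)
  then show ?case using Cons by (simp add: a_ac)
qed simp

lemma lsum_zero: "lsum A (map (\<lambda>i. \<zero>) xs) = \<zero>"
  by (induction xs) auto

lemma lsum_swap:
  assumes "\<And>i k. i \<in> set xs \<Longrightarrow> k \<in> set ys \<Longrightarrow> f i k \<in> carrier A"
  shows "lsum A (map (\<lambda>i. lsum A (map (f i) ys)) xs) = lsum A (map (\<lambda>k. lsum A (map (\<lambda>i. f i k) xs)) ys)"
  using assms
proof (induction xs)
  case Nil
  show ?case by (simp add: lsum_zero)
next
  case (Cons i xs)
  have "lsum A (map (\<lambda>k. f i k \<oplus> lsum A (map (\<lambda>i. f i k) xs)) ys) =
      lsum A (map (f i) ys) \<oplus> lsum A (map (\<lambda>k. lsum A (map (\<lambda>i. f i k) xs)) ys)"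
    using Cons.prems by (intro lsum_add) (auto intro!: lsum_closed)
  then show ?case using Cons by simp
qed

lemma lsum_mult_right:
  "a \<in> carrier A \<Longrightarrow> (\<And>i. i \<in> set xs \<Longrightarrow> f i \<in> carrier A) \<Longrightarrow>
    lsum A (map f xs) \<otimes> a = lsum A (map (\<lambda>i. f i \<otimes> a) xs)"
proof (induction xs)
  case (Cons i xs)
  have "lsum A (map f xs) \<in> carrier A" using Cons.prems by (intro lsum_closed) auto
  then show ?case using Cons by (simp add: l_distr)
qed simp

lemma lsum_smult:
  "(\<And>i. i \<in> set xs \<Longrightarrow> f i \<in> carrier A) \<Longrightarrow>
    c \<odot> lsum A (map f xs) = lsum A (map (\<lambda>i. c \<odot> f i) xs)"
proof (induction xs)
  case (Cons i xs)
  have "lsum A (map f xs) \<in> carrier A" using Cons.prems by (intro lsum_closed) auto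
  then show ?case using Cons by (simp add: smult_r_distr)
qed simp

lemma lsum_mult_lsum:
  assumes "\<And>i. i \<in> set xs \<Longrightarrow> f i \<in> carrier A" "\<And>k. k \<in> set ys \<Longrightarrow> g k \<in> carrier A"
  shows "lsum A (map f xs) \<otimes> lsum A (map g ys) =
    lsum A (map (\<lambda>i. lsum A (map (\<lambda>k. f i \<otimes> g k) ys)) xs)"
proof -
  have "lsum A (map g ys) \<in> carrier A" using assms by (auto intro!: lsum_closed)
  then have "lsum A (map f xs) \<otimes> lsum A (map g ys) = lsum A (map (\<lambda>i. f i \<otimes> lsum A (map g ys)) xs)"
    using assms by (intro lsum_mult_right) auto
  also have "\<dots> = lsum A (map (\<lambda>i. lsum A (map (\<lambda>k. f i \<otimes> g k) ys)) xs)"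
    by (intro arg_cong[where f = "lsum A"] map_cong refl lsum_mult_left) (use assms in auto)
  finally show ?thesis .
qed

lemma finsum_nat_3:
  "(\<And>k. f k \<in> carrier A) \<Longrightarrow> finsum A f {1..3::nat} = f 1 \<oplus> f 2 \<oplus> f 3"
proof -
  assume f: "\<And>k. f k \<in> carrier A"
  have "{1..3::nat} = {1, 2, 3}" by auto
  then show ?thesis using f by (simp add: finsum_insert a_assoc)
qed

end

section \<open>Weights and deformation phases of the matrix coordinates\<close>

abbreviation three :: "3 list" where "three \<equiv> [1, 2, 3]"

definition eps1 :: "3 \<Rightarrow> int" where "eps1 i = (if i = 1 then 1 else if i = 2 then 0 else - 1)"
definition eps2 :: "3 \<Rightarrow> int" where "eps2 i = (if i = 1 then 0 else if i = 2 then 1 else - 1)"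

text \<open>The determinant of the weights with components \<open>eps1\<close> and
  \<open>eps2\<close>; it is 1 on the cyclic pairs (1,2), (2,3), (3,1).\<close>

definition wedge :: "3 \<Rightarrow> 3 \<Rightarrow> int" where
  "wedge i k = eps1 i * eps2 k - eps2 i * eps1 k"

definition ucoord :: "bool \<Rightarrow> 3 \<Rightarrow> 3 \<Rightarrow> complex^3^3 \<Rightarrow> complex" where
  "ucoord s i k = (\<lambda>U. if U \<in> SU3 then if s then cnj (U $ i $ k) else U $ i $ k else 0)"

definition uwt :: "bool \<Rightarrow> 3 \<Rightarrow> 3 \<Rightarrow> int^4" where
  "uwt s i k = (\<chi> n. (if s then - 1 else 1) *
     (if n = 1 then - eps1 i else if n = 2 then - eps2 i else if n = 3 then eps1 k else eps2 k))"

lemma torus_act_nth: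
  "torus_act x U $ i $ k = torus_char (uwt False i k) x * U $ i $ k"
proof -
  have t: "torus_exp a b $ i $ j = (if i = j then cis (2 * pi * (eps1 i * a + eps2 i * b)) else 0)"
    for a b :: real and i j
    using exhaust_3[of i] by (auto simp: torus_exp_nth eps1_def eps2_def)
  have "torus_act x U $ i $ k = cis (2 * pi * (eps1 i * (- (x $ 1)) + eps2 i * (- (x $ 2)))) * U $ i $ k *
      cis (2 * pi * (eps1 k * (x $ 3) + eps2 k * (x $ 4)))"
    by (simp add: torus_act_def matrix_matrix_mult_def t if_distrib[of "\<lambda>x. x * _"]
        if_distrib[of "\<lambda>x. _ * x"] sum.delta sum.delta' cong: if_cong)
  then show ?thesis
    by (simp add: torus_char_def sum_4 uwt_def cis_mult mult_ac mult.left_commute[of "U $ i $ k"])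
      (simp add: cis_mult algebra_simps)
qed

lemma ucoord_False_ws: "ucoord False i k \<in> weight_space (uwt False i k)"
proof -
  have "continuous_on SU3 (ucoord False i k)"
    by (rule continuous_on_eq[of _ "\<lambda>U. U $ i $ k"]) (auto simp: ucoord_def intro!: continuous_intros)
  then show ?thesis
    by (auto simp: weight_space_iff ucoord_def torus_act_SU3 torus_act_nth)
qed

lemma ucoord_True: "ucoord True i k = (\<lambda>U. cnj (ucoord False i k U))"
  by (auto simp: ucoord_def)

lemma uwt_True: "uwt True i k = - uwt False i k"
  by (simp add: uwt_def vec_eq_iff)

lemma ucoord_ws: "ucoord s i k \<in> weight_space (uwt s i k)"
  using ucoord_False_ws weight_space_cnj[OF ucoord_False_ws]
  by (cases s) (simp_all add: ucoord_True uwt_True)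

lemma deform_phase_uwt:
  "deform_phase \<theta> (uwt s i k) (uwt s' i' k') =
    cis (pi * \<theta> * ((if s then - 1 else 1) * (if s' then - 1 else 1) * of_int (wedge k k' - wedge i i')))"
  by (cases s; cases s') (simp_all add: deform_phase_def uwt_def wedge_def algebra_simps)

lemma deform_phase_swap: "deform_phase \<theta> n m * deform_phase \<theta> m n = 1"
  by (simp add: deform_phase_def cis_mult algebra_simps)

lemma deform_phase_add: "deform_phase \<theta> n (m + m') = deform_phase \<theta> n m * deform_phase \<theta> n m'"
  by (simp add: deform_phase_def cis_mult algebra_simps)

definition tgt :: "letter \<Rightarrow> 3 \<Rightarrow> letter" where
  "tgt l k = (mk (blk (fst l)) k, snd l)"

definition uc :: "letter \<Rightarrow> 3 \<Rightarrow> complex^3^3 \<Rightarrow> complex" where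
  "uc l k = ucoord (snd l) (ix (fst l)) k"

definition uw :: "letter \<Rightarrow> 3 \<Rightarrow> int^4" where
  "uw l k = uwt (snd l) (ix (fst l)) k"

lemma uc_ws: "uc l k \<in> weight_space (uw l k)"
  by (simp add: uc_def uw_def ucoord_ws)

text \<open>All conditions on \<open>\<theta>'\<close> are condensed in \<open>matrix_form\<close>:
  the three parameters of the mixed block become \<open>lam False True\<close> and its shifts by
  \<theta> in either direction, which are the values prescribed by the wedge.\<close>

locale quantum_sphere = sphere \<theta>' + rieffel_completion \<theta> H \<iota>
  for \<theta>' :: "real^6^6" and \<theta> :: real and H :: "('h, 'm) normed_star_alg_scheme"
    and \<iota> :: "(complex^3^3 \<Rightarrow> complex) \<Rightarrow> 'h" +
  fixes lam :: "bool \<Rightarrow> bool \<Rightarrow> real"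
  assumes matrix_form: "\<theta>' $ mk b i $ mk b' k = lam b b' - \<theta> * of_int (wedge i k)"
begin

text \<open>The deformation phase is the wedge of the column indices minus that of the row indices.
  The columns are the indices of the target letters and the rows those of the source letters, so
  this difference turns the target phase into the source phase; the block term is the same on both
  sides.\<close>

lemma deform_phase_cphase: "deform_phase \<theta> (uw l k) (uw m k') * cphase (tgt l k) (tgt m k') = cphase l m"
proof -
  obtain b i s where l: "l = (mk b i, s)" by (rule letter_cases)
  obtain b' i' s' where m: "m = (mk b' i', s')" by (rule letter_cases)
  show ?thesis
    by (simp add: l m uw_def tgt_def deform_phase_uwt cphase_def cis_mult sg_def matrix_form algebra_simps)
qed

sublocale T: tensor_prod H Q
  by (simp add: tensor_prod_def H.calg_axioms Q_calg)

abbreviation TA :: "('h \<times> sphere_poly set \<Rightarrow>\<^sub>0 complex) set star_alg" where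
  "TA \<equiv> tensor H Q"

sublocale TA: calg TA by (rule T.tensor_calg)

section \<open>Construction of the coaction as an algebra homomorphism\<close>

definition delta_term :: "letter \<Rightarrow> 3 \<Rightarrow> ('h \<times> sphere_poly set \<Rightarrow>\<^sub>0 complex) set" where
  "delta_term l k = tens H Q (\<iota> (uc l k)) (bas [tgt l k])"

definition delta_gen :: "letter \<Rightarrow> ('h \<times> sphere_poly set \<Rightarrow>\<^sub>0 complex) set" where
  "delta_gen l = lsum TA (map (delta_term l) three)"

definition delta_word :: "letter list \<Rightarrow> ('h \<times> sphere_poly set \<Rightarrow>\<^sub>0 complex) set" where
  "delta_word w = foldr (\<lambda>l X. delta_gen l \<otimes>\<^bsub>TA\<^esub> X) w \<one>\<^bsub>TA\<^esub>"

lemma bas_closed [simp]: "bas w \<in> carrier Q"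
  by simp

lemma iota_uc [simp]: "\<iota> (uc l k) \<in> carrier H"
  by (rule iota_ws_closed[OF uc_ws])

lemma delta_term_closed [simp]: "delta_term l k \<in> carrier TA"
  by (simp add: delta_term_def T.tens_closed)

lemma delta_gen_closed [simp]: "delta_gen l \<in> carrier TA"
  unfolding delta_gen_def by (rule TA.lsum_closed) auto

lemma delta_word_simps [simp]: "delta_word [] = \<one>\<^bsub>TA\<^esub>" "delta_word (l # w) = delta_gen l \<otimes>\<^bsub>TA\<^esub> delta_word w"
  by (simp_all add: delta_word_def)

lemma delta_word_closed [simp]: "delta_word w \<in> carrier TA"
  by (induction w) auto

lemma delta_word_append: "delta_word (v @ w) = delta_word v \<otimes>\<^bsub>TA\<^esub> delta_word w"
  by (induction v) (simp_all add: TA.m_assoc)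

lemma uc_mult_ws: "(\<lambda>U. uc l k U * uc m k' U) \<in> weight_space (uw l k + uw m k')"
  by (intro weight_space_mult uc_ws)

lemma delta_term_mult:
  "delta_term l k \<otimes>\<^bsub>TA\<^esub> delta_term m k' = deform_phase \<theta> (uw l k) (uw m k') \<odot>\<^bsub>TA\<^esub>
    tens H Q (\<iota> (\<lambda>U. uc l k U * uc m k' U)) (bas [tgt l k, tgt m k'])"
  using iota_ws_closed[OF uc_mult_ws, of l k m k']
  by (simp add: delta_term_def T.tens_mult iota_mult[OF uc_ws uc_ws] bas_mult T.tens_smult_left)

lemma bas_comm: "bas [l, m] = (cphase l m)\<^sup>2 \<odot>\<^bsub>Q\<^esub> bas [m, l]"
  using comm_rel_in[of l m] by (simp add: coset_smult, subst coset_eq_iff) (simp_all add: comm_rel_def)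

text \<open>The pointwise product of coordinate functions is commutative, so only phases have to be
  compared: those from the deformed products and that from exchanging the target letters combine to
  the square of the source phase.\<close>

lemma delta_term_comm: "delta_term l k \<otimes>\<^bsub>TA\<^esub> delta_term m k' = (cphase l m)\<^sup>2 \<odot>\<^bsub>TA\<^esub> (delta_term m k' \<otimes>\<^bsub>TA\<^esub> delta_term l k)"
proof -
  let ?X = "tens H Q (\<iota> (\<lambda>U. uc l k U * uc m k' U)) (bas [tgt m k', tgt l k])"
  let ?d = "deform_phase \<theta> (uw l k) (uw m k')" and ?d' = "deform_phase \<theta> (uw m k') (uw l k)"
  have i: "\<iota> (\<lambda>U. uc l k U * uc m k' U) \<in> carrier H" by (rule iota_ws_closed[OF uc_mult_ws])
  have X: "?X \<in> carrier TA" using i by (simp add: T.tens_closed)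
  have "delta_term l k \<otimes>\<^bsub>TA\<^esub> delta_term m k' = (?d * (cphase (tgt l k) (tgt m k'))\<^sup>2) \<odot>\<^bsub>TA\<^esub> ?X"
    using i X by (simp add: delta_term_mult bas_comm[of "tgt l k"] T.tens_smult_right TA.smult_assoc)
  also have "?d * (cphase (tgt l k) (tgt m k'))\<^sup>2 = (cphase l m)\<^sup>2 * ?d'"
  proof -
    have "(cphase l m)\<^sup>2 * ?d' = (?d * ?d') * (?d * (cphase (tgt l k) (tgt m k'))\<^sup>2)"
      unfolding deform_phase_cphase[of l k m k', symmetric] by (simp add: power2_eq_square mult_ac)
    then show ?thesis by (simp add: deform_phase_swap)
  qed
  also have "((cphase l m)\<^sup>2 * ?d') \<odot>\<^bsub>TA\<^esub> ?X = (cphase l m)\<^sup>2 \<odot>\<^bsub>TA\<^esub> (delta_term m k' \<otimes>\<^bsub>TA\<^esub> delta_term l k)"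
    using X by (simp add: delta_term_mult TA.smult_assoc mult.commute[of "uc m k' _"])
  finally show ?thesis .
qed

lemma delta_gen_comm: "delta_gen l \<otimes>\<^bsub>TA\<^esub> delta_gen m = (cphase l m)\<^sup>2 \<odot>\<^bsub>TA\<^esub> (delta_gen m \<otimes>\<^bsub>TA\<^esub> delta_gen l)"
proof -
  have "delta_gen l \<otimes>\<^bsub>TA\<^esub> delta_gen m = lsum TA (map (\<lambda>k. lsum TA (map (\<lambda>k'. delta_term l k \<otimes>\<^bsub>TA\<^esub> delta_term m k') three)) three)"
    unfolding delta_gen_def by (rule TA.lsum_mult_lsum) auto
  also have "\<dots> = lsum TA (map (\<lambda>k'. lsum TA (map (\<lambda>k. delta_term l k \<otimes>\<^bsub>TA\<^esub> delta_term m k') three)) three)"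
    by (rule TA.lsum_swap) auto
  also have "\<dots> = lsum TA (map (\<lambda>k'. lsum TA (map (\<lambda>k. (cphase l m)\<^sup>2 \<odot>\<^bsub>TA\<^esub> (delta_term m k' \<otimes>\<^bsub>TA\<^esub> delta_term l k)) three)) three)"
    by (simp only: delta_term_comm[of l _ m])
  also have "\<dots> = (cphase l m)\<^sup>2 \<odot>\<^bsub>TA\<^esub>
      lsum TA (map (\<lambda>k'. lsum TA (map (\<lambda>k. delta_term m k' \<otimes>\<^bsub>TA\<^esub> delta_term l k) three)) three)"
    by (subst TA.lsum_smult, force intro!: TA.lsum_closed)
      (intro arg_cong[where f = "lsum TA"] map_cong refl TA.lsum_smult[symmetric], auto)
  also have "lsum TA (map (\<lambda>k'. lsum TA (map (\<lambda>k. delta_term m k' \<otimes>\<^bsub>TA\<^esub> delta_term l k) three)) three) = delta_gen m \<otimes>\<^bsub>TA\<^esub> delta_gen l"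
    unfolding delta_gen_def by (rule TA.lsum_mult_lsum[symmetric]) auto
  finally show ?thesis .
qed

lemma one_U_ws: "(\<lambda>U. if U \<in> SU3 then c else 0) \<in> weight_space 0"
  using weight_space_smult[OF weight_space_one, of c] by (simp add: if_distrib[of "\<lambda>x. c * x"] cong: if_cong)

lemma iota_const: "\<iota> (\<lambda>U. if U \<in> SU3 then c else 0) = c \<odot>\<^bsub>H\<^esub> \<one>\<^bsub>H\<^esub>"
  using iota_smult[OF weight_space_deformed[OF weight_space_one], of c] iota_one
  by (simp add: if_distrib[of "\<lambda>x. c * x"] cong: if_cong)

lemma lsum_iota:
  assumes "\<And>i. i \<in> set xs \<Longrightarrow> f i \<in> carrier P"
  shows "lsum H (map (\<lambda>i. \<iota> (f i)) xs) = \<iota> (\<lambda>U. sum_list (map (\<lambda>i. f i U) xs))"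
    and "(\<lambda>U. sum_list (map (\<lambda>i. f i U) xs)) \<in> carrier P"
proof -
  have "lsum H (map (\<lambda>i. \<iota> (f i)) xs) = \<iota> (\<lambda>U. sum_list (map (\<lambda>i. f i U) xs)) \<and>
      (\<lambda>U. sum_list (map (\<lambda>i. f i U) xs)) \<in> carrier P"
    using assms
  proof (induction xs)
    case Nil
    then show ?case using weight_space_deformed[OF zero_weight_space] iota_const[of 0] by simp
  next
    case (Cons i xs)
    then show ?case by (simp add: iota_add deformed_add)
  qed
  then show "lsum H (map (\<lambda>i. \<iota> (f i)) xs) = \<iota> (\<lambda>U. sum_list (map (\<lambda>i. f i U) xs))"
    "(\<lambda>U. sum_list (map (\<lambda>i. f i U) xs)) \<in> carrier P" by auto
qed

lemma bas_sphere: "lsum Q (map (\<lambda>k. bas (pair b k)) three) = \<one>\<^bsub>Q\<^esub>"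
proof -
  have "\<one>\<^bsub>Q\<^esub> = bas (pair b 1) \<oplus>\<^bsub>Q\<^esub> bas (pair b 2) \<oplus>\<^bsub>Q\<^esub> bas (pair b 3)"
    using Qn_sphere[of "[]" b] by (simp add: Qn_Nil) (simp add: Qn_def)
  then show ?thesis by (simp add: Q.a_assoc)
qed

lemma tens_zero_left: "y \<in> carrier Q \<Longrightarrow> tens H Q \<zero>\<^bsub>H\<^esub> y = \<zero>\<^bsub>TA\<^esub>"
  using lin_map_zero[of "\<lambda>x. tens H Q x y" H TA] T.bilin_tens H.calg_axioms TA.calg_axioms
  by (auto simp: bilin_def)

text \<open>The columns of a matrix in SU(3) are orthonormal, so the sum over the row index leaves
  only \<open>k = k'\<close>, where the phase is 1. With \<open>b = b'\<close> this yields the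
  sphere relation for the images; with different blocks it yields the coinvariance of the two
  generators.\<close>

lemma delta_gen_contract:
  "lsum TA (map (\<lambda>i. delta_gen (mk b i, s) \<otimes>\<^bsub>TA\<^esub> delta_gen (mk b' i, \<not> s)) three) =
    tens H Q \<one>\<^bsub>H\<^esub> (lsum Q (map (\<lambda>k. bas [(mk b k, s), (mk b' k, \<not> s)]) three))"
proof -
  \<comment> \<open>The deformation phase of a coordinate and an adjoint coordinate in the same row.
    It does not depend on \<open>i\<close>, because the wedge of \<open>i\<close> with itself is 0,
    so it can be taken out of the sum.\<close>
  define d where "d k k' = cis (- (pi * \<theta> * of_int (wedge k k')))" for k k'
  define V where "V k k' = bas [(mk b k, s), (mk b' k', \<not> s)]" for k k'
  define f where "f i k k' = (\<lambda>U. uc (mk b i, s) k U * uc (mk b' i, \<not> s) k' U)" for i k k'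
  define F where "F k k' i = delta_term (mk b i, s) k \<otimes>\<^bsub>TA\<^esub> delta_term (mk b' i, \<not> s) k'" for k k' i
  have V: "V k k' \<in> carrier Q" for k k' by (simp add: V_def)
  have fP: "f i k k' \<in> carrier P" for i k k'
    unfolding f_def by (rule weight_space_deformed[OF uc_mult_ws])
  have Fc [simp]: "F k k' i \<in> carrier TA" for k k' i by (simp add: F_def)
  have F: "F k k' i = tens H Q (\<iota> (f i k k')) (d k k' \<odot>\<^bsub>Q\<^esub> V k k')" for k k' i
    using iota_closed[OF fP] V
    by (simp add: F_def delta_term_mult f_def[symmetric] T.tens_smult_right uw_def tgt_def V_def d_def
        deform_phase_uwt) (simp add: wedge_def algebra_simps)
  have inner: "lsum TA (map (F k k') three) =
      (if k = k' then tens H Q \<one>\<^bsub>H\<^esub> (V k k') else \<zero>\<^bsub>TA\<^esub>)" for k k'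
  proof -
    have "lsum TA (map (F k k') three) = tens H Q (lsum H (map (\<lambda>i. \<iota> (f i k k')) three)) (d k k' \<odot>\<^bsub>Q\<^esub> V k k')"
      using iota_closed[OF fP] V by (simp add: F T.tens_add_left T.tens_closed)
    also have "lsum H (map (\<lambda>i. \<iota> (f i k k')) three) = \<iota> (\<lambda>U. sum_list (map (\<lambda>i. f i k k' U) three))"
      by (rule lsum_iota) (rule fP)
    also have "(\<lambda>U. sum_list (map (\<lambda>i. f i k k' U) three)) = (\<lambda>U. if U \<in> SU3 then if k = k' then 1 else 0 else 0)"
    proof
      fix U
      show "sum_list (map (\<lambda>i. f i k k' U) three) = (if U \<in> SU3 then if k = k' then 1 else 0 else 0)"
        using SU3_cols[of U k' k] SU3_cols[of U k k'] by (cases s) (auto simp: f_def uc_def ucoord_def sum_3 mult.commute add.assoc)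
    qed
    also have "\<iota> \<dots> = (if k = k' then 1 else 0) \<odot>\<^bsub>H\<^esub> \<one>\<^bsub>H\<^esub>" by (rule iota_const)
    finally show ?thesis using V
      by (cases "k = k'") (simp_all add: d_def wedge_def T.tens_smult_left T.tens_closed tens_zero_left)
  qed
  have "lsum TA (map (\<lambda>i. delta_gen (mk b i, s) \<otimes>\<^bsub>TA\<^esub> delta_gen (mk b' i, \<not> s)) three) =
      lsum TA (map (\<lambda>i. lsum TA (map (\<lambda>k. lsum TA (map (\<lambda>k'. F k k' i) three)) three)) three)"
    unfolding delta_gen_def F_def
    by (intro arg_cong[where f = "lsum TA"] map_cong refl TA.lsum_mult_lsum) auto
  also have "\<dots> = lsum TA (map (\<lambda>k. lsum TA (map (\<lambda>i. lsum TA (map (\<lambda>k'. F k k' i) three)) three)) three)"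
    by (rule TA.lsum_swap) auto
  also have "\<dots> = lsum TA (map (\<lambda>k. lsum TA (map (\<lambda>k'. lsum TA (map (F k k') three)) three)) three)"
    by (intro arg_cong[where f = "lsum TA"] map_cong refl TA.lsum_swap) auto
  also have "\<dots> = lsum TA (map (\<lambda>k. tens H Q \<one>\<^bsub>H\<^esub> (V k k)) three)"
    unfolding inner using V by (simp add: T.tens_closed)
  also have "\<dots> = tens H Q \<one>\<^bsub>H\<^esub> (lsum Q (map (\<lambda>k. V k k) three))"
    by (rule lin_map_lsum[symmetric])
      (use T.bilin_tens V in \<open>auto simp: bilin_def Q_calg TA.calg_axioms\<close>)
  finally show ?thesis by (simp only: V_def)
qed

lemma delta_gen_sphere:
  "lsum TA (map (\<lambda>i. delta_gen (mk b i, False) \<otimes>\<^bsub>TA\<^esub> delta_gen (mk b i, True)) three) = \<one>\<^bsub>TA\<^esub>"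
  using delta_gen_contract[of b False b] bas_sphere[of b] by (simp only: pair_def not_False_eq_True T.tens_one)

lemma delta_word_vanish:
  assumes "s \<in> rels"
  shows "linext TA delta_word (sng a 1 \<otimes>\<^bsub>R\<^esub> s \<otimes>\<^bsub>R\<^esub> sng b 1) = \<zero>\<^bsub>TA\<^esub>"
proof -
  have f: "delta_word \<in> carrier WM \<rightarrow> carrier TA" by simp
  note L = linext_lin_map[OF TA.calg_axioms f]
  have sing: "linext TA delta_word (sng w c) = c \<odot>\<^bsub>TA\<^esub> delta_word w" for w c
    using TA.linext_single[of delta_word w c] by simp
  note diff = linext_diff[OF TA.calg_axioms f]
  have add: "linext TA delta_word (p + q) = linext TA delta_word p \<oplus>\<^bsub>TA\<^esub> linext TA delta_word q" for p q
    using lin_map_add[OF L, of p q] by simp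
  from assms show ?thesis
  proof (cases rule: rels_cases)
    case (1 l m)
    have "delta_word (a @ l # m # b) = delta_word a \<otimes>\<^bsub>TA\<^esub> ((delta_gen l \<otimes>\<^bsub>TA\<^esub> delta_gen m) \<otimes>\<^bsub>TA\<^esub> delta_word b)"
      by (simp add: delta_word_append TA.m_assoc)
    also have "\<dots> = (cphase l m)\<^sup>2 \<odot>\<^bsub>TA\<^esub> delta_word (a @ m # l # b)"
      unfolding delta_gen_comm[of l m]
      by (simp add: delta_word_append TA.m_assoc TA.smult_mult_l TA.smult_mult_r)
    finally show ?thesis
      by (simp add: 1 comm_rel_def mult_diff_left mult_diff_right diff sing TA.minus_self)
  next
    case (2 d)
    let ?P = "\<lambda>i. delta_gen (mk d i, False) \<otimes>\<^bsub>TA\<^esub> delta_gen (mk d i, True)"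
    have "delta_word (a @ pair d i @ b) = delta_word a \<otimes>\<^bsub>TA\<^esub> (?P i \<otimes>\<^bsub>TA\<^esub> delta_word b)" for i
      by (simp add: delta_word_append pair_def TA.m_assoc)
    then have "delta_word (a @ pair d 1 @ b) \<oplus>\<^bsub>TA\<^esub> delta_word (a @ pair d 2 @ b) \<oplus>\<^bsub>TA\<^esub> delta_word (a @ pair d 3 @ b) =
        delta_word a \<otimes>\<^bsub>TA\<^esub> (lsum TA (map ?P three) \<otimes>\<^bsub>TA\<^esub> delta_word b)"
      by (simp add: TA.l_distr TA.r_distr TA.a_assoc)
    also have "\<dots> = delta_word (a @ b)" unfolding delta_gen_sphere by (simp add: delta_word_append)
    finally show ?thesis
      by (simp add: 2 sphere_rel_def mult_diff_left mult_diff_right mult_add_left mult_add_right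
          diff add sing TA.minus_self)
  qed
qed

definition delta where "delta = qlift TA delta_word"

lemma delta_alg_hom: "delta \<in> alg_hom Q TA"
  unfolding delta_def
  by (rule qlift_alg_hom[OF TA.calg_axioms]) (simp_all add: delta_word_vanish delta_word_append)

lemma delta_bas: "delta (bas w) = delta_word w"
  unfolding delta_def by (rule qlift_bas[OF TA.calg_axioms]) (simp_all add: delta_word_vanish)

lemma delta_letter: "delta (bas [l]) = delta_gen l"
  by (simp add: delta_bas)

lemma alg_hom_eqI:
  assumes "F \<in> alg_hom Q Z" "G \<in> alg_hom Q Z" "calg Z"
    and "\<And>l. F (bas [l]) = G (bas [l])" and "X \<in> carrier Q"
  shows "F X = G X"
proof (rule lin_map_eqI[OF alg_hom_lin_map[OF assms(1)] alg_hom_lin_map[OF assms(2)] assms(3)])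
  show "F (bas w) = G (bas w)" for w
  proof (induction w)
    case Nil
    show ?case using alg_hom_one[OF assms(1)] alg_hom_one[OF assms(2)] coset_one by simp
  next
    case (Cons l w)
    have "bas (l # w) = bas [l] \<otimes>\<^bsub>Q\<^esub> bas w" by (simp add: bas_mult)
    then show ?case
      using alg_hom_mult[OF assms(1), of "bas [l]" "bas w"] alg_hom_mult[OF assms(2), of "bas [l]" "bas w"]
        Cons assms(4) by simp
  qed
qed (use assms in auto)

end

lemma nat_index_3:
  obtains s where "s \<in> {1..3::nat}" "of_nat s = (i :: 3)"
  using exhaust_3[of i] that[of 1] that[of 2] that[of 3] by auto

lemma SU3_coord_eq: "SU3_coord a c = ucoord False (of_nat a) (of_nat c)"
  by (auto simp: SU3_coord_def ucoord_def)

section \<open>Coassociativity, the counit law and uniqueness of the coaction\<close>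

locale quantum_coaction = quantum_SU3 \<theta> H \<iota> K \<kappa> \<Delta> \<epsilon> + quantum_sphere \<theta>' \<theta> H \<iota> lam
  for \<theta> :: real and H :: "('h, 'm) normed_star_alg_scheme"
    and \<iota> :: "(complex^3^3 \<Rightarrow> complex) \<Rightarrow> 'h"
    and K :: "('k, 'n) normed_star_alg_scheme"
    and \<kappa> :: "('h \<times> 'h \<Rightarrow>\<^sub>0 complex) set \<Rightarrow> 'k"
    and \<Delta> :: "'h \<Rightarrow> 'k"
    and \<epsilon> :: "'h \<Rightarrow> complex"
    and \<theta>' :: "real^6^6" and lam :: "bool \<Rightarrow> bool \<Rightarrow> real"
begin

lemma K_star_algebra: "star_algebra K" and kappa_star_hom: "\<kappa> \<in> star_hom (tensor H H) K"
  using K_completion by (auto simp: cstar_completion_def cstar_algebra_def)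

sublocale K: calg K by (rule star_algebra_calg[OF K_star_algebra])
sublocale HH: tensor_prod H H by (simp add: tensor_prod_def H.calg_axioms)
sublocale KQ: tensor_prod K Q by (simp add: tensor_prod_def K.calg_axioms Q_calg)

abbreviation KA :: "('k \<times> sphere_poly set \<Rightarrow>\<^sub>0 complex) set star_alg" where
  "KA \<equiv> tensor K Q"

sublocale KA: calg KA by (rule KQ.tensor_calg)

lemma kappa_alg_hom: "\<kappa> \<in> alg_hom (tensor H H) K"
  and comult_alg_hom: "\<Delta> \<in> alg_hom H K" and counit_alg_hom: "\<epsilon> \<in> alg_hom H complex_star_alg"
  using kappa_star_hom comult_hom counit_hom by (auto simp: star_hom_def)

lemmas kappa_lin_map = alg_hom_lin_map[OF kappa_alg_hom]
lemmas comult_lin_map = alg_hom_lin_map[OF comult_alg_hom]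
lemmas counit_lin_map = alg_hom_lin_map[OF counit_alg_hom]

definition kappa_tens :: "'h \<Rightarrow> 'h \<Rightarrow> 'k" where "kappa_tens a b = \<kappa> (tens H H a b)"

lemma kappa_tens_closed [simp]: "a \<in> carrier H \<Longrightarrow> b \<in> carrier H \<Longrightarrow> kappa_tens a b \<in> carrier K"
  unfolding kappa_tens_def by (rule lin_map_closed[OF kappa_lin_map HH.tens_closed])

lemma kappa_tens_mult:
  "a \<in> carrier H \<Longrightarrow> b \<in> carrier H \<Longrightarrow> a' \<in> carrier H \<Longrightarrow> b' \<in> carrier H \<Longrightarrow>
    kappa_tens a b \<otimes>\<^bsub>K\<^esub> kappa_tens a' b' = kappa_tens (a \<otimes>\<^bsub>H\<^esub> a') (b \<otimes>\<^bsub>H\<^esub> b')"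
  unfolding kappa_tens_def by (simp add: HH.tens_closed HH.tens_mult flip: alg_hom_mult[OF kappa_alg_hom])

lemma kappa_tens_one: "kappa_tens \<one>\<^bsub>H\<^esub> \<one>\<^bsub>H\<^esub> = \<one>\<^bsub>K\<^esub>"
  unfolding kappa_tens_def by (simp add: HH.tens_one alg_hom_one[OF kappa_alg_hom])

lemma kappa_tens_lin:
  assumes "h \<in> carrier H" shows "kappa_tens h \<in> lin_map H K" "(\<lambda>x. kappa_tens x h) \<in> lin_map H K"
  using HH.bilin_tens assms lin_map_comp[OF _ kappa_lin_map, of _ H] unfolding kappa_tens_def bilin_def by auto

lemma kappa_tens_star:
  "a \<in> carrier H \<Longrightarrow> b \<in> carrier H \<Longrightarrow> star K (kappa_tens a b) = kappa_tens (star H a) (star H b)"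
proof -
  assume ab: "a \<in> carrier H" "b \<in> carrier H"
  then have "\<kappa> (star (tensor H H) (tens H H a b)) = star K (\<kappa> (tens H H a b))"
    using kappa_star_hom HH.tens_closed by (auto simp: star_hom_def)
  then show ?thesis using HH.tens_star[OF H_star_algebra H_star_algebra ab] by (simp add: kappa_tens_def)
qed

lemma tens_KA_lin:
  "x \<in> carrier K \<Longrightarrow> tens K Q x \<in> lin_map Q KA" "y \<in> carrier Q \<Longrightarrow> (\<lambda>x. tens K Q x y) \<in> lin_map K KA"
  using KQ.bilin_tens unfolding bilin_def by auto

text \<open>For fixed \<open>h\<close>, the inner linear map on the right-hand side of the
  coassociativity law.\<close>

definition lift_delta :: "'h \<Rightarrow> ('h \<times> sphere_poly set \<Rightarrow>\<^sub>0 complex) set \<Rightarrow>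
    ('k \<times> sphere_poly set \<Rightarrow>\<^sub>0 complex) set" where
  "lift_delta h = tensor_lift KA (\<lambda>h' b'. tens K Q (kappa_tens h h') b')"

lemma lift_delta_bilin: "h \<in> carrier H \<Longrightarrow> bilin H Q KA (\<lambda>h' b'. tens K Q (kappa_tens h h') b')"
  unfolding bilin_def
  using tens_KA_lin kappa_tens_lin(1) lin_map_comp[OF kappa_tens_lin(1) tens_KA_lin(2)] by auto

lemma lift_delta_tens:
  "h \<in> carrier H \<Longrightarrow> h' \<in> carrier H \<Longrightarrow> b \<in> carrier Q \<Longrightarrow> lift_delta h (tens H Q h' b) = tens K Q (kappa_tens h h') b"
  unfolding lift_delta_def by (rule T.tensor_lift_tens[OF KA.calg_axioms lift_delta_bilin])

lemma lift_delta_lin_map: "h \<in> carrier H \<Longrightarrow> lift_delta h \<in> lin_map TA KA"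
  unfolding lift_delta_def by (rule T.tensor_lift_lin_map[OF KA.calg_axioms lift_delta_bilin])

lemmas lift_delta_closed = lin_map_closed[OF lift_delta_lin_map]
lemmas lift_delta_add = lin_map_add[OF lift_delta_lin_map]

lemma lift_delta_lin_left:
  assumes X: "X \<in> carrier TA" shows "(\<lambda>h. lift_delta h X) \<in> lin_map H KA"
proof -
  have "lift_delta (h \<oplus>\<^bsub>H\<^esub> h') X = lift_delta h X \<oplus>\<^bsub>KA\<^esub> lift_delta h' X" if "h \<in> carrier H" "h' \<in> carrier H" for h h'
    using X
  proof (induction rule: T.tensor_induct)
    case (tens x y)
    then show ?case using that
      by (simp add: lift_delta_tens lin_map_add[OF kappa_tens_lin(2)] KQ.tens_add_left)
  next
    case (add X Y)
    then show ?case using that by (simp add: lift_delta_add lift_delta_closed KA.a_ac)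
  qed
  moreover have "lift_delta (c \<odot>\<^bsub>H\<^esub> h) X = c \<odot>\<^bsub>KA\<^esub> lift_delta h X" if "h \<in> carrier H" for h c
    using X
  proof (induction rule: T.tensor_induct)
    case (tens x y)
    then show ?case using that
      by (simp add: lift_delta_tens lin_map_smult[OF kappa_tens_lin(2)] KQ.tens_smult_left)
  next
    case (add X Y)
    then show ?case using that by (simp add: lift_delta_add lift_delta_closed KA.smult_r_distr)
  qed
  ultimately show ?thesis using X by (auto simp: lin_map_def lift_delta_closed)
qed

text \<open>Multiplicativity in both arguments together makes the right-hand side of coassociativity
  an algebra homomorphism, so that law has to be checked only on letters.\<close>

lemma lift_delta_mult:
  assumes h: "h \<in> carrier H" "h' \<in> carrier H" and X: "X \<in> carrier TA" and Y: "Y \<in> carrier TA"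
  shows "lift_delta (h \<otimes>\<^bsub>H\<^esub> h') (X \<otimes>\<^bsub>TA\<^esub> Y) = lift_delta h X \<otimes>\<^bsub>KA\<^esub> lift_delta h' Y"
  using X
proof (induction rule: T.tensor_induct)
  case (tens x y)
  show ?case using Y
  proof (induction rule: T.tensor_induct)
    case t2: (tens x' y')
    show ?case using h tens t2 by (simp add: T.tens_mult lift_delta_tens KQ.tens_mult kappa_tens_mult)
  next
    case (add Y Y')
    then show ?case using h tens T.tens_closed
      by (simp add: TA.r_distr lift_delta_add lift_delta_closed KA.r_distr)
  qed
next
  case (add X X')
  then show ?case using h Y by (simp add: TA.l_distr lift_delta_add lift_delta_closed KA.l_distr)
qed

lemma lift_delta_one: "lift_delta \<one>\<^bsub>H\<^esub> \<one>\<^bsub>TA\<^esub> = \<one>\<^bsub>KA\<^esub>"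
  by (simp add: lift_delta_tens kappa_tens_one KQ.tens_one flip: T.tens_one)

lemma delta_closed: "X \<in> carrier Q \<Longrightarrow> delta X \<in> carrier TA"
  using lin_map_closed[OF alg_hom_lin_map[OF delta_alg_hom]] .

lemma comult_bilin: "bilin H Q KA (\<lambda>h b. tens K Q (\<Delta> h) b)"
  unfolding bilin_def
  using tens_KA_lin lin_map_closed[OF comult_lin_map] lin_map_comp[OF comult_lin_map tens_KA_lin(2)] by auto

lemma lift_delta_delta_bilin: "bilin H Q KA (\<lambda>h b. lift_delta h (delta b))"
  unfolding bilin_def
  using lift_delta_lin_left delta_closed lin_map_comp[OF alg_hom_lin_map[OF delta_alg_hom] lift_delta_lin_map] by auto

lemma comult_lift_alg_hom: "tensor_lift KA (\<lambda>h b. tens K Q (\<Delta> h) b) \<in> alg_hom TA KA"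
  by (rule T.tensor_lift_alg_hom[OF KA.calg_axioms comult_bilin])
    (simp_all add: lin_map_closed[OF comult_lin_map] alg_hom_mult[OF comult_alg_hom] KQ.tens_mult
      alg_hom_one[OF comult_alg_hom] KQ.tens_one)

lemma lift_delta_delta_lift_alg_hom: "tensor_lift KA (\<lambda>h b. lift_delta h (delta b)) \<in> alg_hom TA KA"
  by (rule T.tensor_lift_alg_hom[OF KA.calg_axioms lift_delta_delta_bilin])
    (simp_all add: alg_hom_mult[OF delta_alg_hom] lift_delta_mult delta_closed alg_hom_one[OF delta_alg_hom] lift_delta_one)

lemma iota_ucoord [simp]: "\<iota> (ucoord s i k) \<in> carrier H"
  by (rule iota_ws_closed[OF ucoord_ws])

lemma iota_ucoord_True: "\<iota> (ucoord True i k) = star H (\<iota> (ucoord False i k))"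
  by (simp add: ucoord_True iota_star[OF weight_space_deformed[OF ucoord_False_ws]])

text \<open>The plain coordinates are given; the adjoint ones follow because \<open>\<Delta>\<close>
  and \<open>\<kappa>\<close> preserve the involutions.\<close>

lemma comult_ucoord:
  "\<Delta> (\<iota> (ucoord s i k)) = lsum K (map (\<lambda>m. kappa_tens (\<iota> (ucoord s i m)) (\<iota> (ucoord s m k))) three)"
proof -
  obtain a c where ac: "a \<in> {1..3::nat}" "of_nat a = i" "c \<in> {1..3::nat}" "of_nat c = k"
    by (metis nat_index_3)
  have F: "\<Delta> (\<iota> (ucoord False i k)) =
      kappa_tens (\<iota> (ucoord False i 1)) (\<iota> (ucoord False 1 k)) \<oplus>\<^bsub>K\<^esub>
      kappa_tens (\<iota> (ucoord False i 2)) (\<iota> (ucoord False 2 k)) \<oplus>\<^bsub>K\<^esub>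
      kappa_tens (\<iota> (ucoord False i 3)) (\<iota> (ucoord False 3 k))"
    using comult_coord[OF ac(1,3)] ac by (subst (asm) K.finsum_nat_3) (simp_all add: SU3_coord_eq flip: kappa_tens_def)
  show ?thesis
  proof (cases s)
    case False
    then show ?thesis by (simp add: F K.a_assoc)
  next
    case True
    have st: "star K (x \<oplus>\<^bsub>K\<^esub> y) = star K x \<oplus>\<^bsub>K\<^esub> star K y" if "x \<in> carrier K" "y \<in> carrier K" for x y
      using K_star_algebra that unfolding star_algebra_def by blast
    have "\<Delta> (star H (\<iota> (ucoord False i k))) = star K (\<Delta> (\<iota> (ucoord False i k)))"
      using comult_hom by (simp add: star_hom_def)
    then show ?thesis using True
      by (simp add: F st kappa_tens_star iota_ucoord_True)
        (subst K.a_assoc, simp_all flip: iota_ucoord_True)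
  qed
qed

lemma counit_ucoord: "\<epsilon> (\<iota> (ucoord s i k)) = (if i = k then 1 else 0)"
proof -
  obtain a c where ac: "a \<in> {1..3::nat}" "of_nat a = i" "c \<in> {1..3::nat}" "of_nat c = k"
    by (metis nat_index_3)
  have "a = c \<longleftrightarrow> i = k" using ac by (auto simp: atLeastAtMost_iff le_Suc_eq numeral_3_eq_3)
  then have F: "\<epsilon> (\<iota> (ucoord False i k)) = (if i = k then 1 else 0)"
    using counit_coord[OF ac(1,3)] ac by (simp add: SU3_coord_eq)
  have "\<epsilon> (star H (\<iota> (ucoord False i k))) = cnj (\<epsilon> (\<iota> (ucoord False i k)))"
    using counit_hom by (simp add: star_hom_def)
  then show ?thesis by (cases s) (simp_all add: F iota_ucoord_True)
qed

lemma tgt_simps [simp]: "tgt (tgt l k) m = tgt l m" "uc (tgt l k) m = ucoord (snd l) k m"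
  by (simp_all add: tgt_def uc_def)

text \<open>Both sides are algebra homomorphisms. On a letter each is a double sum of the same
  terms, and they differ only in the order of summation.\<close>

lemma coassoc:
  assumes "X \<in> carrier Q"
  shows "tensor_lift KA (\<lambda>h b. tens K Q (\<Delta> h) b) (delta X) =
    tensor_lift KA (\<lambda>h b. lift_delta h (delta b)) (delta X)"
proof (rule alg_hom_eqI[OF alg_hom_comp[OF delta_alg_hom comult_lift_alg_hom]
      alg_hom_comp[OF delta_alg_hom lift_delta_delta_lift_alg_hom] KA.calg_axioms _ assms])
  fix l
  let ?g = "\<lambda>k m. tens K Q (kappa_tens (\<iota> (uc l m)) (\<iota> (ucoord (snd l) m k))) (bas [tgt l k])"
  have g: "?g k m \<in> carrier KA" for k m by (simp add: KQ.tens_closed)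
  have "tensor_lift KA (\<lambda>h b. tens K Q (\<Delta> h) b) (delta_gen l) =
      lsum KA (map (\<lambda>k. tensor_lift KA (\<lambda>h b. tens K Q (\<Delta> h) b) (delta_term l k)) three)"
    unfolding delta_gen_def
    by (rule lin_map_lsum[OF alg_hom_lin_map[OF comult_lift_alg_hom]]) (simp_all add: TA.calg_axioms KA.calg_axioms)
  also have "\<dots> = lsum KA (map (\<lambda>k. lsum KA (map (?g k) three)) three)"
  proof (intro arg_cong[where f = "lsum KA"] map_cong refl)
    fix k
    have "tensor_lift KA (\<lambda>h b. tens K Q (\<Delta> h) b) (delta_term l k) = tens K Q (\<Delta> (\<iota> (uc l k))) (bas [tgt l k])"
      unfolding delta_term_def by (rule T.tensor_lift_tens[OF KA.calg_axioms comult_bilin]) simp_all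
    also have "\<dots> = lsum KA (map (?g k) three)"
      unfolding uc_def comult_ucoord
      by (rule lin_map_lsum[OF tens_KA_lin(2)]) (simp_all add: K.calg_axioms KA.calg_axioms)
    finally show "tensor_lift KA (\<lambda>h b. tens K Q (\<Delta> h) b) (delta_term l k) = lsum KA (map (?g k) three)" .
  qed
  also have "\<dots> = lsum KA (map (\<lambda>m. lsum KA (map (\<lambda>k. ?g k m) three)) three)"
    by (rule KA.lsum_swap) (rule g)
  also have "\<dots> = lsum KA (map (\<lambda>m. tensor_lift KA (\<lambda>h b. lift_delta h (delta b)) (delta_term l m)) three)"
  proof (intro arg_cong[where f = "lsum KA"] map_cong refl)
    fix m
    have "tensor_lift KA (\<lambda>h b. lift_delta h (delta b)) (delta_term l m) = lift_delta (\<iota> (uc l m)) (delta_gen (tgt l m))"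
      unfolding delta_term_def
      by (subst T.tensor_lift_tens[OF KA.calg_axioms lift_delta_delta_bilin]) (simp_all add: delta_bas)
    also have "\<dots> = lsum KA (map (\<lambda>k. lift_delta (\<iota> (uc l m)) (delta_term (tgt l m) k)) three)"
      unfolding delta_gen_def by (rule lin_map_lsum[OF lift_delta_lin_map]) (simp_all add: TA.calg_axioms KA.calg_axioms)
    also have "\<dots> = lsum KA (map (\<lambda>k. ?g k m) three)"
      unfolding delta_term_def by (simp add: lift_delta_tens)
    finally show "lsum KA (map (\<lambda>k. ?g k m) three) = tensor_lift KA (\<lambda>h b. lift_delta h (delta b)) (delta_term l m)" ..
  qed
  also have "\<dots> = tensor_lift KA (\<lambda>h b. lift_delta h (delta b)) (delta_gen l)"
    unfolding delta_gen_def
    by (rule lin_map_lsum[OF alg_hom_lin_map[OF lift_delta_delta_lift_alg_hom], symmetric])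
      (simp_all add: TA.calg_axioms KA.calg_axioms)
  finally show "tensor_lift KA (\<lambda>h b. tens K Q (\<Delta> h) b) (delta (bas [l])) =
      tensor_lift KA (\<lambda>h b. lift_delta h (delta b)) (delta (bas [l]))"
    by (simp only: delta_letter)
qed

lemma counit_bilin: "bilin H Q Q (\<lambda>h b. \<epsilon> h \<odot>\<^bsub>Q\<^esub> b)"
  unfolding bilin_def lin_map_def
  by (auto simp: Q.smult_r_distr Q.smult_l_distr mult.commute lin_map_add[OF counit_lin_map]
      lin_map_smult[OF counit_lin_map] simp flip: Q.smult_assoc)

lemma counit_lift_alg_hom: "tensor_lift Q (\<lambda>h b. \<epsilon> h \<odot>\<^bsub>Q\<^esub> b) \<in> alg_hom TA Q"
  by (rule T.tensor_lift_alg_hom[OF Q_calg counit_bilin])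
    (simp_all add: alg_hom_mult[OF counit_alg_hom] alg_hom_one[OF counit_alg_hom] Q.smult_mult_l
      Q.smult_mult_r mult.commute flip: Q.smult_assoc)

lemma counit_law:
  assumes "X \<in> carrier Q" shows "tensor_lift Q (\<lambda>h b. \<epsilon> h \<odot>\<^bsub>Q\<^esub> b) (delta X) = X"
proof -
  have id: "(\<lambda>x. x) \<in> alg_hom Q Q" by (auto simp: alg_hom_def ring_hom_def)
  have "tensor_lift Q (\<lambda>h b. \<epsilon> h \<odot>\<^bsub>Q\<^esub> b) (delta X) = (\<lambda>x. x) X"
  proof (rule alg_hom_eqI[OF alg_hom_comp[OF delta_alg_hom counit_lift_alg_hom] id Q_calg _ assms])
    fix l :: letter
    obtain b i s where l: "l = (mk b i, s)" by (rule letter_cases)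
    have "tensor_lift Q (\<lambda>h b. \<epsilon> h \<odot>\<^bsub>Q\<^esub> b) (delta_gen l) =
        lsum Q (map (\<lambda>k. tensor_lift Q (\<lambda>h b. \<epsilon> h \<odot>\<^bsub>Q\<^esub> b) (delta_term l k)) three)"
      unfolding delta_gen_def
      by (rule lin_map_lsum[OF alg_hom_lin_map[OF counit_lift_alg_hom]]) (simp_all add: TA.calg_axioms Q_calg)
    also have "(\<lambda>k. tensor_lift Q (\<lambda>h b. \<epsilon> h \<odot>\<^bsub>Q\<^esub> b) (delta_term l k)) =
        (\<lambda>k. (if i = k then 1 else 0) \<odot>\<^bsub>Q\<^esub> bas [(mk b k, s)])"
      by (auto simp: delta_term_def T.tensor_lift_tens[OF Q_calg counit_bilin] uc_def counit_ucoord tgt_def l fun_eq_iff)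
    also have "lsum Q (map \<dots> three) = bas [l]"
      using exhaust_3[of i] by (auto simp: l)
    finally show "tensor_lift Q (\<lambda>h b. \<epsilon> h \<odot>\<^bsub>Q\<^esub> b) (delta (bas [l])) = bas [l]"
      by (simp only: delta_letter)
  qed
  then show ?thesis by simp
qed

lemma left_coaction_delta: "left_coaction H K \<kappa> \<Delta> \<epsilon> Q delta"
  unfolding left_coaction_def
  using delta_alg_hom coassoc counit_law unfolding lift_delta_def kappa_tens_def by auto

text \<open>The natural-number indices, with the shift by 3 for the second sphere, run through all
  pairs of block and index. As the adjoints are prescribed too, every letter is covered.\<close>

lemma extends_generators_iff:
  "extends_generators H \<iota> \<theta>' \<delta> \<longleftrightarrow> (\<forall>l. \<delta> (bas [l]) = delta_gen l)"
proof -
  have z: "sphere_z \<theta>' s = bas [(mk False (of_nat s), False)]"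
    "sphere_z \<theta>' (s + 3) = bas [(mk True (of_nat s), False)]" if "s \<in> {1..3}" for s
    using that by (auto simp: sphere_z_eq mk_def atLeastAtMost_iff le_Suc_eq numeral_3_eq_3)
  have zs: "star Q (bas [(j, False)]) = bas [(j, True)]" for j
    by (simp add: star_bas wstar_def flip_def)
  have fs: "finsum TA f {1..3::nat} = delta_gen (mk b (of_nat s), t)"
    if "\<And>k. k \<in> {1..3} \<Longrightarrow> f k = tens H Q (\<iota> (ucoord t (of_nat s) (of_nat k))) (bas [(mk b (of_nat k), t)])"
    for f b t and s :: nat
  proof -
    let ?f = "\<lambda>k::nat. delta_term (mk b (of_nat s), t) (of_nat k)"
    have "finsum TA f {1..3::nat} = finsum TA ?f {1..3}"
      by (rule TA.finsum_cong') (auto simp: that delta_term_def uc_def tgt_def T.tens_closed)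
    also have "\<dots> = delta_gen (mk b (of_nat s), t)"
      by (subst TA.finsum_nat_3) (simp_all add: delta_gen_def TA.a_assoc)
    finally show ?thesis .
  qed
  have "extends_generators H \<iota> \<theta>' \<delta> \<longleftrightarrow> (\<forall>s\<in>{1..3::nat}. \<forall>b t.
      \<delta> (bas [(mk b (of_nat s), t)]) = delta_gen (mk b (of_nat s), t))"
    unfolding extends_generators_def A_eq Let_def
  proof (rule ball_cong[OF refl])
    fix s :: nat assume s: "s \<in> {1..3}"
    have r: "finsum TA (\<lambda>k. tens H Q (\<iota> (SU3_coord s k)) (sphere_z \<theta>' k)) {1..3} = delta_gen (mk False (of_nat s), False)"
      "finsum TA (\<lambda>k. tens H Q (\<iota> (SU3_coord s k)) (sphere_z \<theta>' (k + 3))) {1..3} = delta_gen (mk True (of_nat s), False)"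
      "finsum TA (\<lambda>k. tens H Q (star H (\<iota> (SU3_coord s k))) (star Q (sphere_z \<theta>' k))) {1..3} =
        delta_gen (mk False (of_nat s), True)"
      "finsum TA (\<lambda>k. tens H Q (star H (\<iota> (SU3_coord s k))) (star Q (sphere_z \<theta>' (k + 3)))) {1..3} =
        delta_gen (mk True (of_nat s), True)"
      by (rule fs; simp only: z zs SU3_coord_eq iota_ucoord_True)+
    show "(\<delta> (sphere_z \<theta>' s) = finsum TA (\<lambda>k. tens H Q (\<iota> (SU3_coord s k)) (sphere_z \<theta>' k)) {1..3} \<and>
      \<delta> (sphere_z \<theta>' (s + 3)) = finsum TA (\<lambda>k. tens H Q (\<iota> (SU3_coord s k)) (sphere_z \<theta>' (k + 3))) {1..3} \<and>
      \<delta> (star Q (sphere_z \<theta>' s)) =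
        finsum TA (\<lambda>k. tens H Q (star H (\<iota> (SU3_coord s k))) (star Q (sphere_z \<theta>' k))) {1..3} \<and>
      \<delta> (star Q (sphere_z \<theta>' (s + 3))) =
        finsum TA (\<lambda>k. tens H Q (star H (\<iota> (SU3_coord s k))) (star Q (sphere_z \<theta>' (k + 3)))) {1..3}) =
      (\<forall>b t. \<delta> (bas [(mk b (of_nat s), t)]) = delta_gen (mk b (of_nat s), t))"
      unfolding r z[OF s] zs by (auto simp: all_bool_eq)
  qed
  also have "\<dots> \<longleftrightarrow> (\<forall>l. \<delta> (bas [l]) = delta_gen l)"
  proof (intro iffI allI ballI)
    fix l :: letter
    assume *: "\<forall>s\<in>{1..3::nat}. \<forall>b t. \<delta> (bas [(mk b (of_nat s), t)]) = delta_gen (mk b (of_nat s), t)"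
    obtain b i t where l: "l = (mk b i, t)" by (rule letter_cases)
    obtain s where "s \<in> {1..3::nat}" "of_nat s = i" by (rule nat_index_3)
    then show "\<delta> (bas [l]) = delta_gen l" using * l by blast
  qed auto
  finally show ?thesis .
qed

text \<open>An algebra homomorphism is fixed by its values on letters, so the claims about every
  admissible coaction reduce to the one constructed here.\<close>

lemma coaction_unique:
  assumes "left_coaction H K \<kappa> \<Delta> \<epsilon> Q \<delta>" "extends_generators H \<iota> \<theta>' \<delta>" "X \<in> carrier Q"
  shows "\<delta> X = delta X"
  by (rule alg_hom_eqI[OF _ delta_alg_hom TA.calg_axioms _ assms(3)])
    (use assms in \<open>auto simp: left_coaction_def extends_generators_iff delta_letter\<close>)

end

section \<open>Coinvariants are functions on orbits\<close>

lemma (in calg) lsum_concat: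
  "(\<And>xs. xs \<in> set xss \<Longrightarrow> set xs \<subseteq> carrier A) \<Longrightarrow> lsum A (concat xss) = lsum A (map (lsum A) xss)"
proof (induction xss)
  case (Cons xs xss)
  have "set (concat xss) \<subseteq> carrier A" using Cons.prems by auto
  then show ?case using Cons by (simp add: lsum_append)
qed simp

definition orbit_map :: "complex^3^3 \<Rightarrow> complex^6 \<Rightarrow> complex^6" where
  "orbit_map U x = (\<chi> j. \<Sum>k\<in>UNIV. U $ ix j $ k * x $ mk (blk j) k)"

lemma orbit_map_nth [simp]: "orbit_map U x $ mk b i = (\<Sum>k\<in>UNIV. U $ i $ k * x $ mk b k)"
  by (simp add: orbit_map_def)

lemma SU3_inner:
  assumes "U \<in> SU3"
  shows "(\<Sum>i\<in>UNIV. (\<Sum>k\<in>UNIV. U $ i $ k * y k) * cnj (\<Sum>k\<in>UNIV. U $ i $ k * x k)) =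
    (\<Sum>k\<in>UNIV. y k * cnj (x k))"
proof -
  have "(\<Sum>i\<in>UNIV. (\<Sum>k\<in>UNIV. U $ i $ k * y k) * cnj (\<Sum>k\<in>UNIV. U $ i $ k * x k)) =
      (\<Sum>i\<in>UNIV. \<Sum>k\<in>UNIV. \<Sum>l\<in>UNIV. y k * cnj (x l) * (cnj (U $ i $ l) * U $ i $ k))"
    by (simp add: sum_product mult_ac)
  also have "\<dots> = (\<Sum>k\<in>UNIV. \<Sum>l\<in>UNIV. \<Sum>i\<in>UNIV. y k * cnj (x l) * (cnj (U $ i $ l) * U $ i $ k))"
    by (subst sum.swap, rule sum.cong[OF refl], rule sum.swap)
  also have "\<dots> = (\<Sum>k\<in>UNIV. \<Sum>l\<in>UNIV. y k * cnj (x l) * (if l = k then 1 else 0))"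
    by (simp only: sum_distrib_left[symmetric] SU3_cols[OF assms])
  finally show ?thesis by (simp add: if_distrib[of "\<lambda>x. _ * x"] sum.delta cong: if_cong)
qed

lemma orbit_map_spheres: "U \<in> SU3 \<Longrightarrow> x \<in> spheres \<Longrightarrow> orbit_map U x \<in> spheres"
  unfolding spheres_def mem_Collect_eq orbit_map_nth by (subst SU3_inner) auto

lemma ev_orbit_map:
  "U \<in> SU3 \<Longrightarrow> ev (orbit_map U x) l = sum_list (map (\<lambda>k. uc l k U * ev x (tgt l k)) three)"
  by (cases l rule: letter_cases)
    (auto simp: ev_def uc_def ucoord_def tgt_def sum_3 add.assoc)

context quantum_sphere
begin

text \<open>The summands \<open>(f, n, u)\<close> of the coaction on a word: a function \<open>f\<close> of weight \<open>n\<close> and a target word \<open>u\<close>.\<close>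

fun terms :: "letter list \<Rightarrow> ((complex^3^3 \<Rightarrow> complex) \<times> (int^4) \<times> letter list) list" where
  "terms [] = [(\<lambda>U. if U \<in> SU3 then 1 else 0, 0, [])]"
| "terms (l # w) = concat (map (\<lambda>k. map (\<lambda>(f, n, u). (\<lambda>U. uc l k U * f U, uw l k + n, tgt l k # u))
    (terms w)) three)"

definition term_val :: "(complex^3^3 \<Rightarrow> complex) \<times> (int^4) \<times> letter list \<Rightarrow>
    ('h \<times> sphere_poly set \<Rightarrow>\<^sub>0 complex) set" where
  "term_val = (\<lambda>(f, n, u). tens H Q (\<iota> f) (Qn u))"

text \<open>The second clause extends the phase identity for two letters to a letter and a whole
  summand. It follows by induction because the deformation phase is multiplicative in its second
  weight.\<close>

lemma terms_weight:
  "(f, n, u) \<in> set (terms w) \<Longrightarrow> f \<in> weight_space n \<and>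
    (\<forall>l k. deform_phase \<theta> (uw l k) n * prod_list (map (cphase (tgt l k)) u) = prod_list (map (cphase l) w))"
proof (induction w arbitrary: f n u)
  case Nil
  then show ?case using weight_space_one by (simp add: deform_phase_def)
next
  case (Cons l w)
  then obtain k g m u' where t: "(g, m, u') \<in> set (terms w)" "f = (\<lambda>U. uc l k U * g U)"
      "n = uw l k + m" "u = tgt l k # u'"
    by auto
  have "deform_phase \<theta> (uw l' k') n * prod_list (map (cphase (tgt l' k')) u) =
      (deform_phase \<theta> (uw l' k') (uw l k) * cphase (tgt l' k') (tgt l k)) *
      (deform_phase \<theta> (uw l' k') m * prod_list (map (cphase (tgt l' k')) u'))" for l' k'
    by (simp add: t deform_phase_add mult_ac)
  then show ?case using Cons.IH[OF t(1)] weight_space_mult[OF uc_ws, of g m l k] by (simp add: t deform_phase_cphase)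
qed

lemma term_val_closed: "t \<in> set (terms w) \<Longrightarrow> term_val t \<in> carrier TA"
  by (cases t) (auto simp: term_val_def T.tens_closed iota_ws_closed dest!: terms_weight)

lemma Qn_Cons: "bas [l] \<otimes>\<^bsub>Q\<^esub> Qn u = prod_list (map (cphase l) u) \<odot>\<^bsub>Q\<^esub> Qn (l # u)"
  using Qn_mult[of "[l]" u] by (simp add: Qn_def[of "[l]"])

lemma delta_term_term_val:
  assumes "(f, n, u) \<in> set (terms w)"
  shows "delta_term l k \<otimes>\<^bsub>TA\<^esub> term_val (f, n, u) = prod_list (map (cphase l) w) \<odot>\<^bsub>TA\<^esub>
    term_val (\<lambda>U. uc l k U * f U, uw l k + n, tgt l k # u)"
proof -
  note t = terms_weight[OF assms]
  have f: "f \<in> weight_space n" using t by simp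
  have i: "\<iota> f \<in> carrier H" "\<iota> (\<lambda>U. uc l k U * f U) \<in> carrier H"
    using iota_ws_closed[OF f] iota_ws_closed[OF weight_space_mult[OF uc_ws f]] by auto
  have "delta_term l k \<otimes>\<^bsub>TA\<^esub> term_val (f, n, u) =
      (deform_phase \<theta> (uw l k) n * prod_list (map (cphase (tgt l k)) u)) \<odot>\<^bsub>TA\<^esub>
      tens H Q (\<iota> (\<lambda>U. uc l k U * f U)) (Qn (tgt l k # u))"
    using i by (simp add: delta_term_def term_val_def T.tens_mult iota_mult[OF uc_ws f] Qn_Cons
        T.tens_smult_left T.tens_smult_right T.tens_closed mult.commute flip: TA.smult_assoc)
  then show ?thesis using t by (simp add: term_val_def)
qed

text \<open>Once the source word and the target words are both Weyl-ordered, no phase is left in the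
  coaction: its coefficients are ordinary products of coordinate functions.\<close>

lemma delta_word_terms: "delta_word w = wphase w \<odot>\<^bsub>TA\<^esub> lsum TA (map term_val (terms w))"
proof (induction w)
  case Nil
  show ?case by (simp add: term_val_def iota_one Qn_Nil T.tens_one)
next
  case (Cons l w)
  let ?c = "prod_list (map (cphase l) w)" and ?L = "lsum TA (map term_val (terms w))"
  let ?up = "\<lambda>k (f, n, u). (\<lambda>U. uc l k U * f U, uw l k + n, tgt l k # u)"
  have up: "?up k t \<in> set (terms (l # w))" if "t \<in> set (terms w)" "k \<in> set three" for k t
    using that by auto
  have upv: "term_val (?up k t) \<in> carrier TA" if "t \<in> set (terms w)" "k \<in> set three" for k t
    by (rule term_val_closed[OF up[OF that]])
  have ups: "set (map term_val (map (?up k) (terms w))) \<subseteq> carrier TA" if "k \<in> set three" for k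
    unfolding set_map image_image by (rule image_subsetI) (rule upv[OF _ that])
  have L: "?L \<in> carrier TA" by (rule TA.lsum_closed) (auto intro: term_val_closed)
  have lk: "delta_term l k \<otimes>\<^bsub>TA\<^esub> ?L = ?c \<odot>\<^bsub>TA\<^esub> lsum TA (map term_val (map (?up k) (terms w)))"
    if k: "k \<in> set three" for k
  proof -
    have "delta_term l k \<otimes>\<^bsub>TA\<^esub> ?L = lsum TA (map (\<lambda>t. delta_term l k \<otimes>\<^bsub>TA\<^esub> term_val t) (terms w))"
      by (rule TA.lsum_mult_left) (auto intro: term_val_closed)
    also have "\<dots> = lsum TA (map (\<lambda>t. ?c \<odot>\<^bsub>TA\<^esub> term_val (?up k t)) (terms w))"
      by (intro arg_cong[where f = "lsum TA"] map_cong refl) (auto simp: delta_term_term_val)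
    also have "\<dots> = ?c \<odot>\<^bsub>TA\<^esub> lsum TA (map (\<lambda>t. term_val (?up k t)) (terms w))"
      by (rule TA.lsum_smult[symmetric]) (rule upv[OF _ k])
    finally show ?thesis by (simp add: o_def)
  qed
  have cl: "lsum TA (map term_val (map (?up k) (terms w))) \<in> carrier TA" if "k \<in> set three" for k
    by (rule TA.lsum_closed[OF ups[OF that]])
  have "delta_gen l \<otimes>\<^bsub>TA\<^esub> ?L = lsum TA (map (\<lambda>k. delta_term l k \<otimes>\<^bsub>TA\<^esub> ?L) three)"
    unfolding delta_gen_def by (rule TA.lsum_mult_right) (use L in auto)
  also have "\<dots> = lsum TA (map (\<lambda>k. ?c \<odot>\<^bsub>TA\<^esub> lsum TA (map term_val (map (?up k) (terms w)))) three)"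
    by (intro arg_cong[where f = "lsum TA"] map_cong refl lk)
  also have "\<dots> = ?c \<odot>\<^bsub>TA\<^esub> lsum TA (map (\<lambda>k. lsum TA (map term_val (map (?up k) (terms w)))) three)"
    by (rule TA.lsum_smult[symmetric]) (rule cl)
  also have "lsum TA (map (\<lambda>k. lsum TA (map term_val (map (?up k) (terms w)))) three) =
      lsum TA (map term_val (terms (l # w)))"
  proof -
    have "map term_val (terms (l # w)) = concat (map (\<lambda>k. map term_val (map (?up k) (terms w))) three)"
      by simp
    moreover have "lsum TA (concat (map (\<lambda>k. map term_val (map (?up k) (terms w))) three)) =
        lsum TA (map (lsum TA) (map (\<lambda>k. map term_val (map (?up k) (terms w))) three))"
    proof (rule TA.lsum_concat)
      fix xs assume "xs \<in> set (map (\<lambda>k. map term_val (map (?up k) (terms w))) three)"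
      then obtain k where "k \<in> set three" "xs = map term_val (map (?up k) (terms w))"
        unfolding set_map by blast
      then show "set xs \<subseteq> carrier TA" using ups by blast
    qed
    ultimately show ?thesis by (simp only: map_map o_def)
  qed
  finally have "delta_gen l \<otimes>\<^bsub>TA\<^esub> ?L = ?c \<odot>\<^bsub>TA\<^esub> lsum TA (map term_val (terms (l # w)))" .
  moreover have "lsum TA (map term_val (terms (l # w))) \<in> carrier TA"
    by (rule TA.lsum_closed) (auto intro: term_val_closed simp del: terms.simps)
  ultimately show ?case using L
    by (simp add: Cons.IH TA.smult_mult_r mult.commute flip: TA.smult_assoc del: terms.simps)
qed

text \<open>Expanding the product of the transformed coordinates distributes over the column index
  exactly as \<open>terms\<close> does, so the coefficients are those of the classical
  action.\<close>

lemma terms_sum: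
  assumes "U \<in> SU3"
  shows "sum_list (map (\<lambda>(f, n, u). wprod x u * f U) (terms w)) = wprod (orbit_map U x) w"
proof (induction w)
  case Nil
  show ?case using assms by simp
next
  case (Cons l w)
  have "sum_list (map ((\<lambda>(f, n, u). wprod x u * f U) \<circ> (\<lambda>(f, n, u). (\<lambda>U. uc l k U * f U, uw l k + n, tgt l k # u)))
      (terms w)) = uc l k U * ev x (tgt l k) * wprod (orbit_map U x) w" for k
    unfolding Cons.IH[symmetric] sum_list_const_mult[symmetric]
    by (intro arg_cong[where f = sum_list] map_cong refl) (auto simp: mult_ac)
  then show ?case
    by (simp add: ev_orbit_map[OF assms, of x l] distrib_right add.assoc)
qed

text \<open>The slice map: evaluation at \<open>x\<close> in the second tensor factor. It turns an
  equation in the tensor product into one in \<open>H\<close>.\<close>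

definition slice :: "complex^6 \<Rightarrow> ('h \<times> sphere_poly set \<Rightarrow>\<^sub>0 complex) set \<Rightarrow> 'h" where
  "slice x = tensor_lift H (\<lambda>h b. Psi x b \<odot>\<^bsub>H\<^esub> h)"

context
  fixes x :: "complex^6"
  assumes x: "x \<in> spheres"
begin

lemma slice_bilin: "bilin H Q H (\<lambda>h b. Psi x b \<odot>\<^bsub>H\<^esub> h)"
  unfolding bilin_def lin_map_def
  by (auto simp: H.smult_r_distr H.smult_l_distr Psi_add[OF x] Psi_smult[OF x] mult.commute
      simp flip: H.smult_assoc)

lemma slice_tens: "h \<in> carrier H \<Longrightarrow> b \<in> carrier Q \<Longrightarrow> slice x (tens H Q h b) = Psi x b \<odot>\<^bsub>H\<^esub> h"
  unfolding slice_def by (rule T.tensor_lift_tens[OF H.calg_axioms slice_bilin])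

lemma slice_lin_map: "slice x \<in> lin_map TA H"
  unfolding slice_def by (rule T.tensor_lift_lin_map[OF H.calg_axioms slice_bilin])

definition orbit_fun :: "sphere_poly set \<Rightarrow> complex^3^3 \<Rightarrow> complex" where
  "orbit_fun X = (\<lambda>U. if U \<in> SU3 then Psi (orbit_map U x) X else 0)"

lemma slice_delta_word:
  fixes w :: "letter list"
  defines "F \<equiv> (\<lambda>U. if U \<in> SU3 then wprod (orbit_map U x) w else 0)"
  shows "F \<in> carrier P \<and> slice x (delta_word w) = wphase w \<odot>\<^bsub>H\<^esub> \<iota> F"
proof -
  let ?f = "\<lambda>t U. wprod x (snd (snd t)) * fst t U"
  have ws: "fst t \<in> weight_space (fst (snd t))" if "t \<in> set (terms w)" for t
    using terms_weight[of "fst t" "fst (snd t)" "snd (snd t)" w] that by simp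
  have fP: "?f t \<in> carrier P" if "t \<in> set (terms w)" for t
    using deformed_smult[OF weight_space_deformed[OF ws[OF that]]] by simp
  have "slice x (delta_word w) = wphase w \<odot>\<^bsub>H\<^esub> slice x (lsum TA (map term_val (terms w)))"
    unfolding delta_word_terms
    by (rule lin_map_smult[OF slice_lin_map]) (auto intro!: TA.lsum_closed term_val_closed)
  also have "slice x (lsum TA (map term_val (terms w))) = lsum H (map (\<lambda>t. slice x (term_val t)) (terms w))"
    by (rule lin_map_lsum[OF slice_lin_map]) (auto simp: TA.calg_axioms H.calg_axioms term_val_closed)
  also have "\<dots> = lsum H (map (\<lambda>t. \<iota> (?f t)) (terms w))"
  proof (intro arg_cong[where f = "lsum H"] map_cong refl)
    fix t assume t: "t \<in> set (terms w)"
    show "slice x (term_val t) = \<iota> (?f t)"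
      unfolding iota_smult[OF weight_space_deformed[OF ws[OF t]]]
      using iota_ws_closed[OF ws[OF t]] by (simp add: term_val_def case_prod_unfold slice_tens Psi_Qn[OF x])
  qed
  also have "\<dots> = \<iota> (\<lambda>U. sum_list (map (\<lambda>t. ?f t U) (terms w)))"
    by (rule lsum_iota(1)) (rule fP)
  finally have s: "slice x (delta_word w) = wphase w \<odot>\<^bsub>H\<^esub> \<iota> (\<lambda>U. sum_list (map (\<lambda>t. ?f t U) (terms w)))" .
  have "(\<lambda>U. sum_list (map (\<lambda>t. ?f t U) (terms w))) = F"
  proof
    fix U
    show "sum_list (map (\<lambda>t. ?f t U) (terms w)) = F U"
    proof (cases "U \<in> SU3")
      case True
      then show ?thesis using terms_sum[OF True, of x w] by (simp add: F_def case_prod_unfold)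
    next
      case False
      have "map (\<lambda>t. ?f t U) (terms w) = map (\<lambda>t. 0) (terms w)"
        using ws False by (intro map_cong refl) (auto simp: weight_space_iff)
      then have "sum_list (map (\<lambda>t. ?f t U) (terms w)) = sum_list (map (\<lambda>t. 0) (terms w))"
        by (simp only:)
      then show ?thesis using False by (simp only: F_def) simp
    qed
  qed
  then show ?thesis using s lsum_iota(2)[of "terms w" ?f, OF fP] by simp
qed

lemma slice_delta:
  assumes "X \<in> carrier Q"
  shows "orbit_fun X \<in> carrier P \<and> slice x (delta X) = \<iota> (orbit_fun X)"
  using assms
proof (induction rule: Q_induct)
  case (bas w c)
  define F where "F = (\<lambda>U. if U \<in> SU3 then wprod (orbit_map U x) w else 0)"
  have F: "F \<in> carrier P" "slice x (delta_word w) = wphase w \<odot>\<^bsub>H\<^esub> \<iota> F"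
    using slice_delta_word[of w] by (auto simp: F_def)
  have "orbit_fun (c \<odot>\<^bsub>Q\<^esub> bas w) = (\<lambda>U. (c * wphase w) * F U)"
    by (auto simp: orbit_fun_def F_def Psi_smult[OF orbit_map_spheres[OF _ x]] Psi_bas[OF orbit_map_spheres[OF _ x]])
  moreover have "slice x (delta (c \<odot>\<^bsub>Q\<^esub> bas w)) = (c * wphase w) \<odot>\<^bsub>H\<^esub> \<iota> F"
    using iota_closed[OF F(1)]
    by (simp add: lin_map_smult[OF alg_hom_lin_map[OF delta_alg_hom]] delta_bas lin_map_smult[OF slice_lin_map]
        F(2) H.smult_assoc)
  ultimately show ?case using F(1) by (simp add: iota_smult deformed_smult)
next
  case (add X Y)
  have "orbit_fun (X \<oplus>\<^bsub>Q\<^esub> Y) = (\<lambda>U. orbit_fun X U + orbit_fun Y U)"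
    using add by (auto simp: orbit_fun_def Psi_add[OF orbit_map_spheres[OF _ x]])
  moreover have "slice x (delta (X \<oplus>\<^bsub>Q\<^esub> Y)) = slice x (delta X) \<oplus>\<^bsub>H\<^esub> slice x (delta Y)"
    using add lin_map_closed[OF alg_hom_lin_map[OF delta_alg_hom]]
    by (simp add: lin_map_add[OF alg_hom_lin_map[OF delta_alg_hom]] lin_map_add[OF slice_lin_map])
  ultimately show ?case using add by (simp add: iota_add deformed_add)
qed

text \<open>The slice of the coaction is the image under \<open>\<iota>\<close> of the pullback to
  SU(3) along the orbit of \<open>x\<close>, and the slice of the right-hand side of
  \<open>inv\<close> is that of a constant. Injectivity of \<open>\<iota>\<close> makes the pullback
  constant.\<close>

lemma coinvariant_Psi:
  assumes X: "X \<in> carrier Q" and inv: "delta X = tens H Q \<one>\<^bsub>H\<^esub> X" and U: "U \<in> SU3"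
  shows "Psi (orbit_map U x) X = Psi x X"
proof -
  have "\<iota> (orbit_fun X) = \<iota> (\<lambda>U. if U \<in> SU3 then Psi x X else 0)"
    using slice_delta[OF X] X by (simp add: inv slice_tens iota_const)
  from iota_inj[OF _ weight_space_deformed[OF one_U_ws] this, of U] show ?thesis
    using slice_delta[OF X] U by (simp add: orbit_fun_def)
qed

end

end

section \<open>Invariant functions on the product of the spheres\<close>

definition hinner :: "bool \<Rightarrow> complex^6 \<Rightarrow> complex" where
  "hinner t x = (\<Sum>k\<in>UNIV. ev x (mk False k, t) * ev x (mk True k, \<not> t))"

lemma hinner_True: "hinner True x = (\<Sum>k\<in>UNIV. cnj (x $ mk False k) * x $ mk True k)"
  and hinner_False: "hinner False x = cnj (hinner True x)"
  by (simp_all add: hinner_def ev_def)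

definition normal_pt :: "complex \<Rightarrow> real \<Rightarrow> complex^6" where
  "normal_pt p r = (\<chi> j. if blk j then if ix j = 1 then p else if ix j = 2 then of_real r else 0
     else if ix j = 1 then 1 else 0)"

lemma normal_pt_nth [simp]:
  "normal_pt p r $ mk b i = (if b then if i = 1 then p else if i = 2 then of_real r else 0
     else if i = 1 then 1 else 0)"
  by (simp add: normal_pt_def)

lemma normal_pt_spheres: "r\<^sup>2 = 1 - (cmod p)\<^sup>2 \<Longrightarrow> normal_pt p r \<in> spheres"
proof -
  assume r: "r\<^sup>2 = 1 - (cmod p)\<^sup>2"
  have "complex_of_real ((cmod p)\<^sup>2 + r\<^sup>2) = 1" by (simp add: r)
  then have "p * cnj p + of_real r * of_real r = 1"
    by (simp add: complex_norm_square[symmetric] power2_eq_square[of "complex_of_real r", symmetric])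
  then show ?thesis by (auto simp: spheres_def sum_3)
qed

text \<open>The rows of \<open>U\<close> are the conjugates of \<open>z\<close> and
  \<open>v\<close>, and the cross product \<open>cr z v\<close> without conjugation. By Lagrange's
  identity both the determinant and the squared length of the third row are 1, and that row
  annihilates \<open>z\<close> and \<open>v\<close> as a triple product with a repeated
  vector.\<close>

lemma orthonormal_completion:
  fixes z v :: "complex^3"
  assumes "(\<Sum>k\<in>UNIV. cnj (z $ k) * z $ k) = 1" "(\<Sum>k\<in>UNIV. cnj (v $ k) * v $ k) = 1"
    and "(\<Sum>k\<in>UNIV. cnj (z $ k) * v $ k) = 0"
  obtains U where "U \<in> SU3"
    "\<And>y. (\<Sum>k\<in>UNIV. U $ 1 $ k * y $ k) = (\<Sum>k\<in>UNIV. cnj (z $ k) * y $ k)"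
    "\<And>y. (\<Sum>k\<in>UNIV. U $ 2 $ k * y $ k) = (\<Sum>k\<in>UNIV. cnj (v $ k) * y $ k)"
    "\<And>a c. (\<Sum>k\<in>UNIV. U $ 3 $ k * (a * z $ k + c * v $ k)) = 0"
proof -
  define cr where "cr a b k = (if k = 1 then a $ 2 * b $ 3 - a $ 3 * b $ 2
    else if k = 2 then a $ 3 * b $ 1 - a $ 1 * b $ 3 else a $ 1 * b $ 2 - a $ 2 * b $ 1)"
    for a b :: "complex^3" and k :: 3
  define U :: "complex^3^3" where
    "U = (\<chi> i k. if i = 1 then cnj (z $ k) else if i = 2 then cnj (v $ k) else cr z v k)"
  have zz: "cnj (z $ 1) * z $ 1 + cnj (z $ 2) * z $ 2 + cnj (z $ 3) * z $ 3 = 1"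
    and vv: "cnj (v $ 1) * v $ 1 + cnj (v $ 2) * v $ 2 + cnj (v $ 3) * v $ 3 = 1"
    and zv: "cnj (z $ 1) * v $ 1 + cnj (z $ 2) * v $ 2 + cnj (z $ 3) * v $ 3 = 0"
    using assms by (simp_all add: sum_3)
  have vz: "cnj (v $ 1) * z $ 1 + cnj (v $ 2) * z $ 2 + cnj (v $ 3) * z $ 3 = 0"
    using arg_cong[OF zv, of cnj] by (simp add: mult.commute)
  have lagrange: "(z2 * v3 - z3 * v2) * (y2 * w3 - y3 * w2) + (z3 * v1 - z1 * v3) * (y3 * w1 - y1 * w3) +
      (z1 * v2 - z2 * v1) * (y1 * w2 - y2 * w1) =
      (y1 * z1 + y2 * z2 + y3 * z3) * (w1 * v1 + w2 * v2 + w3 * v3) -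
      (y1 * v1 + y2 * v2 + y3 * v3) * (w1 * z1 + w2 * z2 + w3 * z3)"
    for z1 z2 z3 v1 v2 v3 y1 y2 y3 w1 w2 w3 :: complex
    by (simp add: algebra_simps)
  note lag = lagrange[of "z $ 2" "v $ 3" "z $ 3" "v $ 2" "cnj (z $ 2)" "cnj (v $ 3)" "cnj (z $ 3)" "cnj (v $ 2)"
      "v $ 1" "z $ 1" "cnj (v $ 1)" "cnj (z $ 1)", unfolded zz vv zv vz]
  have "det U = 1"
    using lag by (simp add: det_3 U_def cr_def algebra_simps)
  moreover have "U ** adj U = mat 1"
  proof -
    have "(\<Sum>k\<in>UNIV. U $ i $ k * cnj (U $ j $ k)) = (if i = j then 1 else 0)" for i j
      using exhaust_3[of i] exhaust_3[of j] zz vv zv vz lag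
      by (elim disjE) (simp_all add: sum_3 U_def cr_def algebra_simps)
    then show ?thesis by (simp add: vec_eq_iff matrix_matrix_mult_def mat_def)
  qed
  ultimately have "U \<in> SU3" by (simp add: SU3_iff)
  then show ?thesis
    by (rule that) (simp_all add: U_def sum_3 cr_def algebra_simps)
qed

text \<open>Supplies the second vector in the degenerate case where the two points of the spheres
  are proportional. Unless the first two coordinates of \<open>z\<close> vanish, it is their
  conjugate pair turned by a right angle and normalised.\<close>

lemma orthogonal_unit:
  fixes z :: "complex^3"
  obtains v :: "complex^3" where "(\<Sum>k\<in>UNIV. cnj (v $ k) * v $ k) = 1" "(\<Sum>k\<in>UNIV. cnj (z $ k) * v $ k) = 0"
proof (cases "z $ 1 = 0 \<and> z $ 2 = 0")
  case True
  then show ?thesis using that[of "\<chi> k. if k = 1 then 1 else 0"] by (simp add: sum_3)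
next
  case False
  define n where "n = sqrt ((cmod (z $ 1))\<^sup>2 + (cmod (z $ 2))\<^sup>2)"
  have n2: "n\<^sup>2 = (cmod (z $ 1))\<^sup>2 + (cmod (z $ 2))\<^sup>2" by (simp add: n_def)
  have n0: "n \<noteq> 0" using False by (auto simp: n_def add_nonneg_eq_0_iff)
  let ?v = "(\<chi> k. if k = 1 then - cnj (z $ 2) / of_real n else if k = 2 then cnj (z $ 1) / of_real n else 0) :: complex^3"
  have "z $ 2 * cnj (z $ 2) + z $ 1 * cnj (z $ 1) = complex_of_real (n\<^sup>2)"
    unfolding n2 by (simp only: of_real_add complex_norm_square add.commute)
  then have "z $ 2 * cnj (z $ 2) + z $ 1 * cnj (z $ 1) = of_real n * of_real n"
    by (simp add: power2_eq_square)
  then have "(\<Sum>k\<in>UNIV. cnj (?v $ k) * ?v $ k) = 1"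
    using n0 by (simp add: sum_3 add_divide_distrib[symmetric])
  then show ?thesis by (rule that) (simp add: sum_3)
qed

text \<open>Pythagoras: the differences are the coordinates of the component of the second unit
  vector orthogonal to the first.\<close>

lemma hinner_defect:
  assumes x: "x \<in> spheres"
  shows "(\<Sum>k\<in>UNIV. (cmod (x $ mk True k - hinner True x * x $ mk False k))\<^sup>2) = 1 - (cmod (hinner True x))\<^sup>2"
proof -
  let ?p = "hinner True x"
  let ?d = "\<lambda>k. x $ mk True k - ?p * x $ mk False k"
  have s: "(\<Sum>k\<in>UNIV. x $ mk b k * cnj (x $ mk b k)) = 1" for b
    using x by (simp add: spheres_def)
  have zw: "(\<Sum>k\<in>UNIV. cnj (x $ mk False k) * x $ mk True k) = ?p" by (simp add: hinner_True)
  have wz: "(\<Sum>k\<in>UNIV. cnj (x $ mk True k) * x $ mk False k) = cnj ?p"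
    unfolding hinner_True by (simp add: mult.commute)
  have "complex_of_real (\<Sum>k\<in>UNIV. (cmod (?d k))\<^sup>2) = (\<Sum>k\<in>UNIV. ?d k * cnj (?d k))"
    by (simp only: of_real_sum complex_norm_square)
  also have "\<dots> = (\<Sum>k\<in>UNIV. x $ mk True k * cnj (x $ mk True k)) -
      ?p * (\<Sum>k\<in>UNIV. cnj (x $ mk True k) * x $ mk False k) -
      cnj ?p * (\<Sum>k\<in>UNIV. cnj (x $ mk False k) * x $ mk True k) +
      ?p * cnj ?p * (\<Sum>k\<in>UNIV. x $ mk False k * cnj (x $ mk False k))"
    by (simp add: sum_3 algebra_simps)
  also have "\<dots> = 1 - ?p * cnj ?p" unfolding s zw wz by simp
  also have "\<dots> = complex_of_real (1 - (cmod ?p)\<^sup>2)"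
    by (simp only: of_real_diff of_real_1 complex_norm_square)
  finally show ?thesis by (simp only: of_real_eq_iff)
qed

text \<open>The second basis vector is the orthogonal component divided by \<open>r\<close>. This
  has length 1 for either sign of \<open>r\<close>, so both normal forms are reached from the same
  point.\<close>

lemma normal_pt_orbit:
  assumes x: "x \<in> spheres" and r: "r\<^sup>2 = 1 - (cmod (hinner True x))\<^sup>2"
  obtains U where "U \<in> SU3" "orbit_map U x = normal_pt (hinner True x) r"
proof -
  define z w :: "complex^3" where "z = (\<chi> k. x $ mk False k)" and "w = (\<chi> k. x $ mk True k)"
  define p where "p = hinner True x"
  have zz: "(\<Sum>k\<in>UNIV. cnj (z $ k) * z $ k) = 1" and ww: "(\<Sum>k\<in>UNIV. cnj (w $ k) * w $ k) = 1"
    and zw: "(\<Sum>k\<in>UNIV. cnj (z $ k) * w $ k) = p"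
    using x by (simp_all add: spheres_def z_def w_def p_def hinner_True mult.commute)
  have wz: "(\<Sum>k\<in>UNIV. cnj (w $ k) * z $ k) = cnj p"
    unfolding zw[symmetric] by (simp add: mult.commute)
  define d where "d k = w $ k - p * z $ k" for k
  have dr: "(\<Sum>k\<in>UNIV. (cmod (d k))\<^sup>2) = r\<^sup>2"
    using hinner_defect[OF x] by (simp add: d_def z_def w_def p_def r)
  have "complex_of_real (\<Sum>k\<in>UNIV. (cmod (d k))\<^sup>2) = (\<Sum>k\<in>UNIV. cnj (d k) * d k)"
    by (simp only: of_real_sum complex_norm_square mult.commute)
  then have dd: "(\<Sum>k\<in>UNIV. cnj (d k) * d k) = of_real r * of_real r"
    unfolding dr by (simp add: power2_eq_square)
  have zd: "(\<Sum>k\<in>UNIV. cnj (z $ k) * d k) = 0"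
  proof -
    have "(\<Sum>k\<in>UNIV. cnj (z $ k) * d k) = (\<Sum>k\<in>UNIV. cnj (z $ k) * w $ k) - p * (\<Sum>k\<in>UNIV. cnj (z $ k) * z $ k)"
      by (simp add: d_def sum_3 algebra_simps)
    then show ?thesis by (simp add: zz zw)
  qed
  obtain v :: "complex^3" where v: "(\<Sum>k\<in>UNIV. cnj (v $ k) * v $ k) = 1" "(\<Sum>k\<in>UNIV. cnj (z $ k) * v $ k) = 0"
    and wv: "\<And>k. w $ k = p * z $ k + of_real r * v $ k"
  proof (cases "r = 0")
    case True
    have "(\<Sum>k\<in>UNIV. (cmod (d k))\<^sup>2) = 0" using dr True by simp
    then have "d k = 0" for k by (simp add: sum_nonneg_eq_0_iff)
    then show ?thesis using orthogonal_unit[of z] that True by (auto simp: d_def)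
  next
    case False
    show ?thesis
    proof (rule that[of "\<chi> k. d k / of_real r"])
      show "(\<Sum>k\<in>UNIV. cnj ((\<chi> k. d k / of_real r) $ k) * (\<chi> k. d k / of_real r) $ k) = 1"
        using dd False by (simp flip: sum_divide_distrib)
      show "(\<Sum>k\<in>UNIV. cnj (z $ k) * (\<chi> k. d k / of_real r) $ k) = 0"
        using zd by (simp flip: sum_divide_distrib)
    qed (use False in \<open>simp add: d_def\<close>)
  qed
  have vz: "(\<Sum>k\<in>UNIV. cnj (v $ k) * z $ k) = 0"
    using arg_cong[OF v(2), of cnj] by (simp add: mult.commute)
  have vw: "(\<Sum>k\<in>UNIV. cnj (v $ k) * w $ k) = of_real r"
  proof -
    have "(\<Sum>k\<in>UNIV. cnj (v $ k) * w $ k) =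
        p * (\<Sum>k\<in>UNIV. cnj (v $ k) * z $ k) + of_real r * (\<Sum>k\<in>UNIV. cnj (v $ k) * v $ k)"
      by (simp add: wv sum_3 algebra_simps)
    then show ?thesis by (simp add: v vz)
  qed
  obtain U where U: "U \<in> SU3"
    "\<And>y. (\<Sum>k\<in>UNIV. U $ 1 $ k * y $ k) = (\<Sum>k\<in>UNIV. cnj (z $ k) * y $ k)"
    "\<And>y. (\<Sum>k\<in>UNIV. U $ 2 $ k * y $ k) = (\<Sum>k\<in>UNIV. cnj (v $ k) * y $ k)"
    "\<And>a c. (\<Sum>k\<in>UNIV. U $ 3 $ k * (a * z $ k + c * v $ k)) = 0"
    by (rule orthonormal_completion[OF zz v]) blast
  have U3: "(\<Sum>k\<in>UNIV. U $ 3 $ k * z $ k) = 0" "(\<Sum>k\<in>UNIV. U $ 3 $ k * w $ k) = 0"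
    using U(4)[of 1 0] U(4)[of p "of_real r"] by (simp_all add: wv)
  have "orbit_map U x $ mk b i = normal_pt p r $ mk b i" for b i
  proof -
    have "orbit_map U x $ mk b i = (\<Sum>k\<in>UNIV. U $ i $ k * (if b then w else z) $ k)"
      by (simp add: z_def w_def)
    also have "\<dots> = normal_pt p r $ mk b i"
      using exhaust_3[of i] by (cases b) (auto simp: U U3 zz zw vw vz)
    finally show ?thesis .
  qed
  then have "orbit_map U x = normal_pt p r" by (metis mk_blk_ix vec_eq_iff)
  then show ?thesis using U(1) that by (simp add: p_def)
qed

section \<open>Generated subalgebras and commutativity\<close>

lemma gen_subalgebra_closed:
  assumes "calg A" "S \<subseteq> carrier A"
  shows "subalgebra A (gen_subalgebra A S)" and "S \<subseteq> gen_subalgebra A S"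
proof -
  interpret calg A by fact
  have "subalgebra A (carrier A)" by (auto simp: subalgebra_def)
  then show "subalgebra A (gen_subalgebra A S)"
    using assms(2) unfolding gen_subalgebra_def subalgebra_def by blast
  show "S \<subseteq> gen_subalgebra A S" by (auto simp: gen_subalgebra_def)
qed

lemma gen_subalgebra_minimal: "subalgebra A B \<Longrightarrow> S \<subseteq> B \<Longrightarrow> gen_subalgebra A S \<subseteq> B"
  by (auto simp: gen_subalgebra_def)

lemma (in calg) subalgebra_centralizer:
  assumes "S \<subseteq> carrier A"
  shows "subalgebra A {x \<in> carrier A. \<forall>s\<in>S. x \<otimes> s = s \<otimes> x}"
proof -
  have "x \<otimes> y \<otimes> s = s \<otimes> (x \<otimes> y)"
    if "x \<in> carrier A" "y \<in> carrier A" "s \<in> carrier A" "x \<otimes> s = s \<otimes> x" "y \<otimes> s = s \<otimes> y" for x y s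
    using that by (metis m_assoc)
  then show ?thesis using assms
    by (auto simp: subalgebra_def l_distr r_distr smult_mult_l smult_mult_r subset_iff)
qed

text \<open>A centraliser is a subalgebra. Applied to the generators, this shows that everything
  generated commutes with them; applied to the generated subalgebra, that it commutes with
  itself.\<close>

lemma gen_subalgebra_commute:
  assumes "calg A" "S \<subseteq> carrier A" "\<And>s t. s \<in> S \<Longrightarrow> t \<in> S \<Longrightarrow> s \<otimes>\<^bsub>A\<^esub> t = t \<otimes>\<^bsub>A\<^esub> s"
    and "a \<in> gen_subalgebra A S" "b \<in> gen_subalgebra A S"
  shows "a \<otimes>\<^bsub>A\<^esub> b = b \<otimes>\<^bsub>A\<^esub> a"
proof -
  interpret calg A by fact
  let ?G = "gen_subalgebra A S"
  have G: "?G \<subseteq> carrier A" using gen_subalgebra_closed(1)[OF assms(1,2)] by (auto simp: subalgebra_def)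
  have "?G \<subseteq> {x \<in> carrier A. \<forall>s\<in>S. x \<otimes>\<^bsub>A\<^esub> s = s \<otimes>\<^bsub>A\<^esub> x}"
    by (rule gen_subalgebra_minimal[OF subalgebra_centralizer]) (use assms in auto)
  then have "?G \<subseteq> {x \<in> carrier A. \<forall>s\<in>?G. x \<otimes>\<^bsub>A\<^esub> s = s \<otimes>\<^bsub>A\<^esub> x}"
    by (intro gen_subalgebra_minimal subalgebra_centralizer G) (use assms(2) in force)
  then show ?thesis using assms(4,5) by blast
qed

section \<open>The algebra of coinvariants\<close>

context quantum_sphere
begin

lemma lam_diag [simp]: "lam b b = 0"
  using matrix_form[of b 1 b 1] by (simp add: wedge_def)

lemma lam_swap: "lam b' b = - lam b b'"
  using matrix_form[of b 1 b' 1] matrix_form[of b' 1 b 1] skew_nth[of "mk b 1" "mk b' 1"]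
  by (simp add: wedge_def)

definition inner_gen :: "bool \<Rightarrow> sphere_poly set" where
  "inner_gen t = lsum Q (map (\<lambda>k. bas [(mk False k, t), (mk True k, \<not> t)]) three)"

lemma inner_gen_closed [simp]: "inner_gen t \<in> carrier Q"
  unfolding inner_gen_def by (rule Q.lsum_closed) auto

lemma delta_inner_gen: "delta (inner_gen t) = tens H Q \<one>\<^bsub>H\<^esub> (inner_gen t)"
proof -
  have "delta (inner_gen t) = lsum TA (map (\<lambda>k. delta (bas [(mk False k, t), (mk True k, \<not> t)])) three)"
    unfolding inner_gen_def
    by (rule lin_map_lsum[OF alg_hom_lin_map[OF delta_alg_hom]]) (simp_all add: Q_calg TA.calg_axioms)
  also have "\<dots> = lsum TA (map (\<lambda>k. delta_gen (mk False k, t) \<otimes>\<^bsub>TA\<^esub> delta_gen (mk True k, \<not> t)) three)"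
    by (simp add: delta_bas)
  finally show ?thesis unfolding delta_gen_contract inner_gen_def .
qed

text \<open>The common \<open>wphase\<close> of the two-letter words in \<open>inner_gen t\<close>.
  The letters have opposite signs and equal indices, so the wedge vanishes and the value depends
  neither on the index nor on \<open>t\<close>.\<close>

definition inner_phase :: complex where "inner_phase = cis (- (pi * lam False True))"

text \<open>On words with equally many adjoint and other letters, left multiplication by \<^term>\<open>inner_gen t\<close>
  produces a phase that does not depend on the word.\<close>

definition sign_sum :: "letter list \<Rightarrow> real" where "sign_sum w = sum_list (map sg w)"

inductive_set balanced :: "sphere_poly set set" where
  bas: "sign_sum w = 0 \<Longrightarrow> c \<odot>\<^bsub>Q\<^esub> bas w \<in> balanced"
| add: "X \<in> balanced \<Longrightarrow> Y \<in> balanced \<Longrightarrow> X \<oplus>\<^bsub>Q\<^esub> Y \<in> balanced"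

lemma balanced_closed: "X \<in> balanced \<Longrightarrow> X \<in> carrier Q"
  by (induction rule: balanced.induct) auto

lemma balanced_smult: "X \<in> balanced \<Longrightarrow> c \<odot>\<^bsub>Q\<^esub> X \<in> balanced"
proof (induction rule: balanced.induct)
  case (bas w d)
  then show ?case using balanced.bas[of w "c * d"] by (simp add: Q.smult_assoc)
next
  case (add X Y)
  then show ?case by (simp add: Q.smult_r_distr balanced_closed balanced.add)
qed

text \<open>The two letters have the same index and opposite signs, so their wedge terms cancel. The
  block terms leave \<open>lam False b - lam True b\<close>, which by antisymmetry is
  \<open>lam False True\<close> for either block \<open>b\<close>.\<close>

lemma cross_inner_gen: "cross [(mk False k, t), (mk True k, \<not> t)] w =
    cis (pi * (if t then - 1 else 1) * lam False True * sign_sum w)"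
proof (induction w)
  case (Cons l w)
  obtain b i s where l: "l = (mk b i, s)" by (rule letter_cases)
  have "cphase (mk False k, t) l * cphase (mk True k, \<not> t) l = cis (pi * (if t then - 1 else 1) * lam False True * sg l)"
    using lam_swap[of False True]
    by (cases b; cases t; cases s) (simp_all add: l cphase_def cis_mult matrix_form sg_def algebra_simps)
  then have "cross [(mk False k, t), (mk True k, \<not> t)] (l # w) =
      cis (pi * (if t then - 1 else 1) * lam False True * sg l) *
      cross [(mk False k, t), (mk True k, \<not> t)] w"
    by (simp add: mult_ac)
  then show ?case unfolding Cons.IH by (simp add: cis_mult sign_sum_def algebra_simps)
qed (simp add: sign_sum_def)

text \<open>For sign sum 0 the phase against the word is 1, so only the constant
  \<open>inner_phase\<close> remains. Each new pair has one letter of each kind, so the sign sum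
  stays 0 and the step can be repeated.\<close>

lemma inner_gen_mult_balanced:
  assumes "X \<in> balanced" and x: "x \<in> spheres"
  shows "inner_gen t \<otimes>\<^bsub>Q\<^esub> X \<in> balanced \<and> Psi x (inner_gen t \<otimes>\<^bsub>Q\<^esub> X) = inner_phase * hinner t x * Psi x X"
  using assms(1)
proof (induction rule: balanced.induct)
  case (bas w c)
  let ?v = "\<lambda>k. [(mk False k, t), (mk True k, \<not> t)]"
  have e: "inner_gen t \<otimes>\<^bsub>Q\<^esub> (c \<odot>\<^bsub>Q\<^esub> bas w) = c \<odot>\<^bsub>Q\<^esub> bas (?v 1 @ w) \<oplus>\<^bsub>Q\<^esub> c \<odot>\<^bsub>Q\<^esub> bas (?v 2 @ w) \<oplus>\<^bsub>Q\<^esub> c \<odot>\<^bsub>Q\<^esub> bas (?v 3 @ w)"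
    by (simp add: inner_gen_def Q.l_distr Q.smult_mult_r bas_mult Q.a_assoc Q.smult_r_distr)
  have d: "sign_sum (?v k @ w) = 0" for k using bas by (simp add: sign_sum_def sg_def)
  have ph: "wphase (?v k @ w) = inner_phase * wphase w" for k
  proof -
    have "wphase (?v k) = inner_phase" by (simp add: cphase_def inner_phase_def sg_def matrix_form wedge_def)
    then show ?thesis unfolding wphase_append cross_inner_gen using bas by simp
  qed
  have "inner_gen t \<otimes>\<^bsub>Q\<^esub> (c \<odot>\<^bsub>Q\<^esub> bas w) \<in> balanced" unfolding e by (intro balanced.add balanced.bas d)
  moreover have "Psi x (inner_gen t \<otimes>\<^bsub>Q\<^esub> (c \<odot>\<^bsub>Q\<^esub> bas w)) = inner_phase * hinner t x * Psi x (c \<odot>\<^bsub>Q\<^esub> bas w)"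
    unfolding e by (simp only: Psi_add[OF x] Psi_smult[OF x] Psi_bas[OF x] bas_closed Q.a_closed Q.smult_closed ph)
      (simp add: hinner_def sum_3 algebra_simps)
  ultimately show ?case by simp
next
  case (add X Y)
  then show ?case
    by (simp add: Q.r_distr balanced_closed balanced.add Psi_add[OF x] distrib_left)
qed

section \<open>Polynomials in the inner product realised by the generated subalgebra\<close>

definition inner_alg :: "sphere_poly set set" where
  "inner_alg = gen_subalgebra Q {\<one>\<^bsub>Q\<^esub>, inner_gen True, inner_gen False}"

lemma inner_alg_subalgebra: "subalgebra Q inner_alg" and inner_alg_gens: "{\<one>\<^bsub>Q\<^esub>, inner_gen True, inner_gen False} \<subseteq> inner_alg"
  unfolding inner_alg_def by (rule gen_subalgebra_closed[OF Q_calg], simp)+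

lemma inner_alg_closed: "X \<in> inner_alg \<Longrightarrow> X \<in> carrier Q"
  using inner_alg_subalgebra by (auto simp: subalgebra_def)

text \<open>The realising element is required to be balanced as well, so that a further
  multiplication by a generator again multiplies the function by an inner product up to a
  constant.\<close>

definition realised :: "(complex^6 \<Rightarrow> complex) \<Rightarrow> bool" where
  "realised F \<longleftrightarrow> (\<exists>Y\<in>inner_alg \<inter> balanced. \<forall>x\<in>spheres. Psi x Y = F x)"

lemma realised_one: "realised (\<lambda>x. 1)"
proof -
  have "\<one>\<^bsub>Q\<^esub> \<in> balanced" using balanced.bas[of "[]" 1] coset_one by (simp add: sign_sum_def)
  moreover have "Psi x \<one>\<^bsub>Q\<^esub> = 1" if "x \<in> spheres" for x
    using Psi_bas[OF that, of "[]"] coset_one by simp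
  ultimately show ?thesis using inner_alg_gens unfolding realised_def by blast
qed

lemma realised_add: "realised F \<Longrightarrow> realised G \<Longrightarrow> realised (\<lambda>x. F x + G x)"
proof -
  assume "realised F" "realised G"
  then obtain X Y where "X \<in> inner_alg \<inter> balanced" "Y \<in> inner_alg \<inter> balanced" "\<forall>x\<in>spheres. Psi x X = F x" "\<forall>x\<in>spheres. Psi x Y = G x"
    unfolding realised_def by blast
  then show ?thesis unfolding realised_def
    using inner_alg_subalgebra by (intro bexI[of _ "X \<oplus>\<^bsub>Q\<^esub> Y"]) (auto simp: Psi_add balanced_closed balanced.add subalgebra_def)
qed

lemma realised_smult: "realised F \<Longrightarrow> realised (\<lambda>x. c * F x)"
proof -
  assume "realised F"
  then obtain X where "X \<in> inner_alg \<inter> balanced" "\<forall>x\<in>spheres. Psi x X = F x"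
    unfolding realised_def by blast
  then show ?thesis unfolding realised_def
    using inner_alg_subalgebra by (intro bexI[of _ "c \<odot>\<^bsub>Q\<^esub> X"]) (auto simp: Psi_smult balanced_closed balanced_smult subalgebra_def)
qed

lemma realised_hinner: "realised F \<Longrightarrow> realised (\<lambda>x. hinner t x * F x)"
proof -
  assume "realised F"
  then obtain X where X: "X \<in> inner_alg" "X \<in> balanced" "\<forall>x\<in>spheres. Psi x X = F x"
    unfolding realised_def by blast
  have "inner_gen t \<in> inner_alg" using inner_alg_gens by (cases t) auto
  then have "inner_gen t \<otimes>\<^bsub>Q\<^esub> X \<in> inner_alg" using inner_alg_subalgebra X by (auto simp: subalgebra_def)
  moreover have "inner_gen t \<otimes>\<^bsub>Q\<^esub> X \<in> balanced"
    \<comment> \<open>The rule asks for a point of the spheres; for the membership claim any point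
      serves.\<close>
    using inner_gen_mult_balanced[OF X(2) normal_pt_spheres[of 1 0], of t] by simp
  moreover have "\<forall>x\<in>spheres. Psi x (inner_gen t \<otimes>\<^bsub>Q\<^esub> X) = inner_phase * (hinner t x * F x)"
    using inner_gen_mult_balanced[OF X(2)] X(3) by (simp add: mult.assoc)
  ultimately have "realised (\<lambda>x. inner_phase * (hinner t x * F x))" unfolding realised_def by blast
  moreover have "inner_phase \<noteq> 0" by (simp add: inner_phase_def)
  ultimately show ?thesis
    using realised_smult[of "\<lambda>x. inner_phase * (hinner t x * F x)" "inverse inner_phase"] by (simp flip: mult.assoc)
qed

lemma realised_zero: "realised (\<lambda>x. 0)"
  using realised_smult[OF realised_one, of 0] by simp

text \<open>The first factor is the value of r^2 on normal forms; this lets even powers of the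
  radius be absorbed.\<close>

lemma realised_defect: "realised F \<Longrightarrow> realised (\<lambda>x. (1 - hinner True x * hinner False x) * F x)"
  using realised_add[OF _ realised_smult[OF realised_hinner[OF realised_hinner], of F "- 1" True False], of F]
  by (simp add: algebra_simps)

text \<open>\<open>F\<close> and \<open>G\<close> collect the even and the odd powers of
  \<open>r\<close>; both signs of \<open>r\<close> are allowed, with the same \<open>F\<close> and
  \<open>G\<close>. That they are polynomials in the inner product and its conjugate is expressed by
  \<open>realised\<close>.\<close>

definition splits :: "sphere_poly set \<Rightarrow> bool" where
  "splits X \<longleftrightarrow> (\<exists>F G. realised F \<and> realised G \<and> (\<forall>x\<in>spheres. \<forall>r. r\<^sup>2 = 1 - (cmod (hinner True x))\<^sup>2 \<longrightarrow>
    Psi (normal_pt (hinner True x) r) X = F x + of_real r * G x))"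

lemma ev_pair: "ev y (j, s) = (if s then cnj (y $ j) else y $ j)"
  by (simp add: ev_def)

text \<open>A polynomial on normal forms is a polynomial in the inner product, its conjugate and \<open>r\<close>, and
  \<open>r\<^sup>2\<close> is again a polynomial in the first two.\<close>

lemma wprod_normal_pt:
  "\<exists>F G. realised F \<and> realised G \<and> (\<forall>x\<in>spheres. \<forall>r. r\<^sup>2 = 1 - (cmod (hinner True x))\<^sup>2 \<longrightarrow>
    wprod (normal_pt (hinner True x) r) w = F x + of_real r * G x)"
proof (induction w)
  case Nil
  show ?case using realised_one realised_zero
    by - (rule exI[of _ "\<lambda>x. 1"], rule exI[of _ "\<lambda>x. 0"], simp)
next
  case (Cons l w)
  then obtain F G where FG: "realised F" "realised G"
    and eq: "\<And>x r. x \<in> spheres \<Longrightarrow> r\<^sup>2 = 1 - (cmod (hinner True x))\<^sup>2 \<Longrightarrow>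
      wprod (normal_pt (hinner True x) r) w = F x + of_real r * G x"
    by blast
  obtain b i s where l: "l = (mk b i, s)" by (rule letter_cases)
  \<comment> \<open>The coordinates of the normal form are 1, 0, 0 on the first sphere and p, r, 0
    on the second.\<close>
  consider (one) "\<not> b" "i = 1" | (zero) "\<not> b" "i \<noteq> 1 \<or> i = 3" | (zero') "b" "i = 3"
    | (inner) "b" "i = 1" | (rad) "b" "i = 2"
    using exhaust_3[of i] by auto
  then show ?case
  proof cases
    case one
    then show ?thesis using FG eq
      by - (rule exI[of _ F], rule exI[of _ G],
        simp add: l ev_pair)
  next
    case zero
    then show ?thesis using realised_zero
      by - (rule exI[of _ "\<lambda>x. 0"], rule exI[of _ "\<lambda>x. 0"],
        auto simp: l ev_pair)
  next
    case zero'
    then show ?thesis using realised_zero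
      by - (rule exI[of _ "\<lambda>x. 0"], rule exI[of _ "\<lambda>x. 0"],
        auto simp: l ev_pair)
  next
    case inner
    then show ?thesis using realised_hinner[OF FG(1), of "\<not> s"] realised_hinner[OF FG(2), of "\<not> s"] eq
      by - (rule exI[of _ "\<lambda>x. hinner (\<not> s) x * F x"], rule exI[of _ "\<lambda>x. hinner (\<not> s) x * G x"],
        cases s, auto simp: l ev_pair hinner_False algebra_simps)
  next
    case rad
    have r2: "complex_of_real r * of_real r = 1 - hinner True x * hinner False x"
      if "r\<^sup>2 = 1 - (cmod (hinner True x))\<^sup>2" for r x
      using arg_cong[OF that, of complex_of_real]
      by (simp only: of_real_diff of_real_1 complex_norm_square hinner_False) (simp add: power2_eq_square)
    have "of_real r * (F x + of_real r * G x) =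
        (1 - hinner True x * hinner False x) * G x + of_real r * F x"
      if "r\<^sup>2 = 1 - (cmod (hinner True x))\<^sup>2" for r x
      unfolding r2[OF that, symmetric] by (simp add: algebra_simps)
    then show ?thesis using realised_defect[OF FG(2)] FG(1) eq rad
      by - (rule exI[of _ "\<lambda>x. (1 - hinner True x * hinner False x) * G x"], rule exI[of _ F],
        simp add: l ev_pair)
  qed
qed

lemma splits_carrier:
  assumes "X \<in> carrier Q" shows "splits X"
  using assms
proof (induction rule: Q_induct)
  case (bas w c)
  obtain F G where FG: "realised F" "realised G"
    and eq: "\<And>x r. x \<in> spheres \<Longrightarrow> r\<^sup>2 = 1 - (cmod (hinner True x))\<^sup>2 \<Longrightarrow>
      wprod (normal_pt (hinner True x) r) w = F x + of_real r * G x"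
    using wprod_normal_pt[of w] by blast
  show ?case unfolding splits_def
    using realised_smult[OF FG(1), of "c * wphase w"] realised_smult[OF FG(2), of "c * wphase w"] eq
    by - (rule exI[of _ "\<lambda>x. c * wphase w * F x"], rule exI[of _ "\<lambda>x. c * wphase w * G x"],
        simp add: Psi_smult normal_pt_spheres Psi_bas algebra_simps)
next
  case (add X Y)
  then obtain F G F' G' where FG: "realised F" "realised G" "realised F'" "realised G'"
    and eq: "\<And>x r. x \<in> spheres \<Longrightarrow> r\<^sup>2 = 1 - (cmod (hinner True x))\<^sup>2 \<Longrightarrow>
      Psi (normal_pt (hinner True x) r) X = F x + of_real r * G x \<and>
      Psi (normal_pt (hinner True x) r) Y = F' x + of_real r * G' x"
    unfolding splits_def by metis
  show ?case unfolding splits_def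
    using realised_add[OF FG(1,3)] realised_add[OF FG(2,4)] eq add
    by - (rule exI[of _ "\<lambda>x. F x + F' x"], rule exI[of _ "\<lambda>x. G x + G' x"],
        simp add: Psi_add normal_pt_spheres algebra_simps)
qed

lemma invariant_in_inner_alg:
  assumes X: "X \<in> carrier Q"
    and inv: "\<And>x U. x \<in> spheres \<Longrightarrow> U \<in> SU3 \<Longrightarrow> Psi (orbit_map U x) X = Psi x X"
  shows "X \<in> inner_alg"
proof -
  obtain F G where FG: "realised F" "realised G"
    and eq: "\<And>x r. x \<in> spheres \<Longrightarrow> r\<^sup>2 = 1 - (cmod (hinner True x))\<^sup>2 \<Longrightarrow>
      Psi (normal_pt (hinner True x) r) X = F x + of_real r * G x"
    using splits_carrier[OF X] unfolding splits_def by blast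
  have *: "Psi x X = F x + of_real r * G x"
    if x: "x \<in> spheres" and r: "r\<^sup>2 = 1 - (cmod (hinner True x))\<^sup>2" for x r
  proof -
    obtain U where "U \<in> SU3" "orbit_map U x = normal_pt (hinner True x) r"
      by (rule normal_pt_orbit[OF x r])
    then show ?thesis using inv[OF x] eq[OF x r] by metis
  qed
  have "Psi x X = F x" if x: "x \<in> spheres" for x
  proof -
    \<comment> \<open>The Cauchy-Schwarz inequality for two unit vectors, obtained here from the
      length of the orthogonal component; it makes the radius real.\<close>
    have "0 \<le> 1 - (cmod (hinner True x))\<^sup>2"
      unfolding hinner_defect[OF x, symmetric] by (intro sum_nonneg) simp
    define r where "r = sqrt (1 - (cmod (hinner True x))\<^sup>2)"
    have r: "r\<^sup>2 = 1 - (cmod (hinner True x))\<^sup>2"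
      using \<open>0 \<le> 1 - (cmod (hinner True x))\<^sup>2\<close> by (simp add: r_def)
    have "(- r)\<^sup>2 = 1 - (cmod (hinner True x))\<^sup>2" using r by simp
    \<comment> \<open>Adding the formulas for \<open>r\<close> and \<open>- r\<close> cancels the
      odd part and leaves twice \<open>F x\<close>.\<close>
    from arg_cong2[where f = "(+)", OF *[OF x r] *[OF x this]] show ?thesis by simp
  qed
  moreover obtain Y where Y: "Y \<in> inner_alg" "\<And>x. x \<in> spheres \<Longrightarrow> Psi x Y = F x"
    using FG(1) unfolding realised_def by blast
  ultimately have "X = Y" by (intro Psi_eqI[OF X inner_alg_closed]) simp_all
  then show ?thesis using Y(1) by simp
qed

end

section \<open>The coinvariants: involution, generators and commutativity\<close>

lemma (in quantum_sphere) inner_alg_star: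
  assumes "X \<in> carrier Q" "delta X = tens H Q \<one>\<^bsub>H\<^esub> X"
  shows "star Q X \<in> inner_alg"
  using assms
  \<comment> \<open>The evaluations of \<open>star Q X\<close> are the conjugates of those of
    \<open>X\<close>, so they are constant on orbits as well.\<close>
  by (intro invariant_in_inner_alg) (simp_all add: star_closed_Q Psi_star orbit_map_spheres coinvariant_Psi)

text \<open>One inclusion passes through invariant functions on the spheres. For the other, the
  coinvariants of an algebra homomorphism form a subalgebra, and it contains the generators.\<close>

lemma (in quantum_sphere) coinvariants_inner_alg: "{X \<in> carrier Q. delta X = tens H Q \<one>\<^bsub>H\<^esub> X} = inner_alg"
proof
  show "{X \<in> carrier Q. delta X = tens H Q \<one>\<^bsub>H\<^esub> X} \<subseteq> inner_alg"
    using invariant_in_inner_alg coinvariant_Psi by blast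
  note L = alg_hom_lin_map[OF delta_alg_hom]
  have "subalgebra Q {X \<in> carrier Q. delta X = tens H Q \<one>\<^bsub>H\<^esub> X}"
    unfolding subalgebra_def
    using lin_map_zero[OF L Q_calg TA.calg_axioms]
      lin_map_zero[of "tens H Q \<one>\<^bsub>H\<^esub>" Q TA] T.bilin_tens Q_calg TA.calg_axioms
    by (auto simp: lin_map_add[OF L] lin_map_smult[OF L] alg_hom_mult[OF delta_alg_hom] T.tens_add_right
        T.tens_smult_right T.tens_mult bilin_def)
  then show "inner_alg \<subseteq> {X \<in> carrier Q. delta X = tens H Q \<one>\<^bsub>H\<^esub> X}"
    unfolding inner_alg_def
    by (rule gen_subalgebra_minimal)
      (use alg_hom_one[OF delta_alg_hom] delta_inner_gen in \<open>auto simp: T.tens_one\<close>)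
qed

text \<open>Both products evaluate to the square of \<open>inner_phase\<close> times the product of
  the two inner products, which is symmetric, and the evaluations separate the elements of the
  algebra.\<close>

lemma (in quantum_sphere) inner_gen_commute: "inner_gen t \<otimes>\<^bsub>Q\<^esub> inner_gen t' = inner_gen t' \<otimes>\<^bsub>Q\<^esub> inner_gen t"
proof (rule Psi_eqI)
  have one: "\<one>\<^bsub>Q\<^esub> \<in> balanced" using balanced.bas[of "[]" 1] coset_one by (simp add: sign_sum_def)
  have gZ: "inner_gen t \<in> balanced" for t
    using inner_gen_mult_balanced[OF one normal_pt_spheres[of 1 0], of t] by simp
  have P: "Psi x (inner_gen t \<otimes>\<^bsub>Q\<^esub> inner_gen t') = inner_phase * hinner t x * Psi x (inner_gen t')" if "x \<in> spheres" for x t t'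
    using inner_gen_mult_balanced[OF gZ that] by simp
  have P1: "Psi x (inner_gen t) = inner_phase * hinner t x" if "x \<in> spheres" for x t
    using inner_gen_mult_balanced[OF one that, of t] Psi_bas[OF that, of "[]"] coset_one by simp
  show "Psi x (inner_gen t \<otimes>\<^bsub>Q\<^esub> inner_gen t') = Psi x (inner_gen t' \<otimes>\<^bsub>Q\<^esub> inner_gen t)" if "x \<in> spheres" for x
    using that by (simp add: P P1)
qed simp_all

lemma (in quantum_sphere) inner_alg_commute: "a \<in> inner_alg \<Longrightarrow> b \<in> inner_alg \<Longrightarrow> a \<otimes>\<^bsub>Q\<^esub> b = b \<otimes>\<^bsub>Q\<^esub> a"
  unfolding inner_alg_def by (rule gen_subalgebra_commute[OF Q_calg]) (auto simp: inner_gen_commute)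

lemma (in quantum_sphere) inner_gen_sphere_z:
  "inner_gen True = star Q (sphere_z \<theta>' 1) \<otimes>\<^bsub>Q\<^esub> sphere_z \<theta>' 4 \<oplus>\<^bsub>Q\<^esub>
    star Q (sphere_z \<theta>' 2) \<otimes>\<^bsub>Q\<^esub> sphere_z \<theta>' 5 \<oplus>\<^bsub>Q\<^esub> star Q (sphere_z \<theta>' 3) \<otimes>\<^bsub>Q\<^esub> sphere_z \<theta>' 6"
  "inner_gen False = sphere_z \<theta>' 1 \<otimes>\<^bsub>Q\<^esub> star Q (sphere_z \<theta>' 4) \<oplus>\<^bsub>Q\<^esub>
    sphere_z \<theta>' 2 \<otimes>\<^bsub>Q\<^esub> star Q (sphere_z \<theta>' 5) \<oplus>\<^bsub>Q\<^esub> sphere_z \<theta>' 3 \<otimes>\<^bsub>Q\<^esub> star Q (sphere_z \<theta>' 6)"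
  by (simp_all add: inner_gen_def sphere_z_eq star_bas wstar_def flip_def bas_mult mk_def Q.a_assoc)

lemma (in quantum_coaction) coaction_theorem:
  "left_coaction H K \<kappa> \<Delta> \<epsilon> Q delta \<and> extends_generators H \<iota> \<theta>' delta"
  "left_coaction H K \<kappa> \<Delta> \<epsilon> Q \<delta> \<and> extends_generators H \<iota> \<theta>' \<delta> \<Longrightarrow>
    coinvariants H Q \<delta> = inner_alg \<and> star_subalgebra Q inner_alg \<and> (\<forall>a\<in>inner_alg. \<forall>b\<in>inner_alg. a \<otimes>\<^bsub>Q\<^esub> b = b \<otimes>\<^bsub>Q\<^esub> a)"
proof -
  show "left_coaction H K \<kappa> \<Delta> \<epsilon> Q delta \<and> extends_generators H \<iota> \<theta>' delta"
    using left_coaction_delta extends_generators_iff delta_letter by blast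
  assume "left_coaction H K \<kappa> \<Delta> \<epsilon> Q \<delta> \<and> extends_generators H \<iota> \<theta>' \<delta>"
  then have "coinvariants H Q \<delta> = {X \<in> carrier Q. delta X = tens H Q \<one>\<^bsub>H\<^esub> X}"
    unfolding coinvariants_def using coaction_unique by auto
  moreover have "star_subalgebra Q inner_alg"
    unfolding star_subalgebra_def
    using inner_alg_subalgebra inner_alg_gens inner_alg_star coinvariants_inner_alg by blast
  ultimately show "coinvariants H Q \<delta> = inner_alg \<and> star_subalgebra Q inner_alg \<and>
      (\<forall>a\<in>inner_alg. \<forall>b\<in>inner_alg. a \<otimes>\<^bsub>Q\<^esub> b = b \<otimes>\<^bsub>Q\<^esub> a)"
    using coinvariants_inner_alg inner_alg_commute by simp
qed

theorem theorem6p1: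
  fixes \<theta> l1 l2 l3 :: real and \<theta>' :: "real^6^6"
    and H :: "('h, 'm) normed_star_alg_scheme"
    and \<iota> :: "(complex^3^3 \<Rightarrow> complex) \<Rightarrow> 'h"
    and K :: "('k, 'n) normed_star_alg_scheme"
    and \<kappa> :: "('h \<times> 'h \<Rightarrow>\<^sub>0 complex) set \<Rightarrow> 'k"
    and \<Delta> :: "'h \<Rightarrow> 'k"
    and \<epsilon> :: "'h \<Rightarrow> complex"
  assumes "quantum_SU3 \<theta> H \<iota> K \<kappa> \<Delta> \<epsilon>"
    and "transpose \<theta>' = - \<theta>'"
    and "\<theta> = - (\<theta>' $ 1 $ 2)" "\<theta> = \<theta>' $ 1 $ 3" "\<theta> = - (\<theta>' $ 2 $ 3)"
    and "\<theta> = - (\<theta>' $ 4 $ 5)" "\<theta> = \<theta>' $ 4 $ 6" "\<theta> = - (\<theta>' $ 5 $ 6)"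
    and "l1 = \<theta>' $ 1 $ 4" "l1 = \<theta>' $ 2 $ 5" "l1 = \<theta>' $ 3 $ 6"
    and "l2 = \<theta>' $ 1 $ 5" "l2 = \<theta>' $ 2 $ 6" "l2 = \<theta>' $ 3 $ 4"
    and "l3 = \<theta>' $ 1 $ 6" "l3 = \<theta>' $ 2 $ 4" "l3 = \<theta>' $ 3 $ 5"
    and "l1 - l2 = \<theta>" "- l1 + l3 = \<theta>"
  shows "let A = sphere_alg \<theta>'; z = sphere_z \<theta>' in
    (\<exists>\<delta>. left_coaction H K \<kappa> \<Delta> \<epsilon> A \<delta> \<and> extends_generators H \<iota> \<theta>' \<delta>) \<and>
    (\<forall>\<delta>. left_coaction H K \<kappa> \<Delta> \<epsilon> A \<delta> \<and> extends_generators H \<iota> \<theta>' \<delta> \<longrightarrow>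
      (let B = coinvariants H A \<delta> in
        B = gen_subalgebra A
          {\<one>\<^bsub>A\<^esub>,
           star A (z 1) \<otimes>\<^bsub>A\<^esub> z 4 \<oplus>\<^bsub>A\<^esub> star A (z 2) \<otimes>\<^bsub>A\<^esub> z 5 \<oplus>\<^bsub>A\<^esub> star A (z 3) \<otimes>\<^bsub>A\<^esub> z 6,
           z 1 \<otimes>\<^bsub>A\<^esub> star A (z 4) \<oplus>\<^bsub>A\<^esub> z 2 \<otimes>\<^bsub>A\<^esub> star A (z 5) \<oplus>\<^bsub>A\<^esub> z 3 \<otimes>\<^bsub>A\<^esub> star A (z 6)} \<and>
        star_subalgebra A B \<and>
        (\<forall>a\<in>B. \<forall>b\<in>B. a \<otimes>\<^bsub>A\<^esub> b = b \<otimes>\<^bsub>A\<^esub> a)))"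
proof -
  \<comment> \<open>The mixed block is normalised by its diagonal value \<open>l1\<close>; skew
    symmetry forces the opposite sign in the transposed block.\<close>
  define lam where "lam b b' = (if b = b' then 0 else if b then - l1 else l1)" for b b'
  interpret sphere \<theta>' by unfold_locales (rule assms(2))
  have form: "\<theta>' $ mk b i $ mk b' k = lam b b' - \<theta> * of_int (wedge i k)" for b i b' k
  proof -
    have sk: "\<theta>' $ 2 $ 1 = - (\<theta>' $ 1 $ 2)" "\<theta>' $ 3 $ 1 = - (\<theta>' $ 1 $ 3)" "\<theta>' $ 3 $ 2 = - (\<theta>' $ 2 $ 3)"
      "\<theta>' $ 5 $ 4 = - (\<theta>' $ 4 $ 5)" "\<theta>' $ 6 $ 4 = - (\<theta>' $ 4 $ 6)" "\<theta>' $ 6 $ 5 = - (\<theta>' $ 5 $ 6)"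
      "\<theta>' $ 4 $ 1 = - (\<theta>' $ 1 $ 4)" "\<theta>' $ 4 $ 2 = - (\<theta>' $ 2 $ 4)" "\<theta>' $ 4 $ 3 = - (\<theta>' $ 3 $ 4)"
      "\<theta>' $ 5 $ 1 = - (\<theta>' $ 1 $ 5)" "\<theta>' $ 5 $ 2 = - (\<theta>' $ 2 $ 5)" "\<theta>' $ 5 $ 3 = - (\<theta>' $ 3 $ 5)"
      "\<theta>' $ 6 $ 1 = - (\<theta>' $ 1 $ 6)" "\<theta>' $ 6 $ 2 = - (\<theta>' $ 2 $ 6)" "\<theta>' $ 6 $ 3 = - (\<theta>' $ 3 $ 6)"
      by (rule skew_nth)+
    \<comment> \<open>The last two hypotheses give \<open>l2 = l1 - \<theta>\<close> and
      \<open>l3 = l1 + \<theta>\<close>, which are the shifts required for index pairs of wedge 1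
      and -1.\<close>
    have up: "\<theta>' $ 1 $ 2 = - \<theta>" "\<theta>' $ 1 $ 3 = \<theta>" "\<theta>' $ 2 $ 3 = - \<theta>"
      "\<theta>' $ 4 $ 5 = - \<theta>" "\<theta>' $ 4 $ 6 = \<theta>" "\<theta>' $ 5 $ 6 = - \<theta>"
      "\<theta>' $ 1 $ 4 = l1" "\<theta>' $ 2 $ 5 = l1" "\<theta>' $ 3 $ 6 = l1"
      "\<theta>' $ 1 $ 5 = l1 - \<theta>" "\<theta>' $ 2 $ 6 = l1 - \<theta>" "\<theta>' $ 3 $ 4 = l1 - \<theta>"
      "\<theta>' $ 1 $ 6 = l1 + \<theta>" "\<theta>' $ 2 $ 4 = l1 + \<theta>" "\<theta>' $ 3 $ 5 = l1 + \<theta>"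
      using assms(3-19) by linarith+
    have mk: "mk False 1 = 1" "mk False 2 = 2" "mk False 3 = 3" "mk True 1 = 4" "mk True 2 = 5" "mk True 3 = 6"
      by (simp_all add: mk_def)
    have w: "wedge 1 1 = 0" "wedge 1 2 = 1" "wedge 1 3 = - 1" "wedge 2 1 = - 1" "wedge 2 2 = 0"
      "wedge 2 3 = 1" "wedge 3 1 = 1" "wedge 3 2 = - 1" "wedge 3 3 = 0"
      by (simp_all add: wedge_def eps1_def eps2_def)
    have l: "lam False False = 0" "lam True True = 0" "lam False True = l1" "lam True False = - l1"
      by (simp_all add: lam_def)
    have "\<forall>b b'. \<forall>i k. \<theta>' $ mk b i $ mk b' k = lam b b' - \<theta> * of_int (wedge i k)"
      by (simp only: all_bool_eq forall_3 mk w l sk up skew_diag) simp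
    then show ?thesis by blast
  qed
  have "rieffel_completion \<theta> H \<iota>"
    using assms(1) by (simp add: rieffel_completion_def quantum_SU3_def)
  then have "quantum_sphere \<theta>' \<theta> H \<iota> lam"
    by (simp add: quantum_sphere_def quantum_sphere_axioms_def sphere_axioms form)
  then interpret quantum_coaction \<theta> H \<iota> K \<kappa> \<Delta> \<epsilon> \<theta>' lam
    using assms(1) by (simp add: quantum_coaction_def)
  show ?thesis
    unfolding Let_def A_eq inner_gen_sphere_z[symmetric] inner_alg_def[symmetric]
  proof (rule conjI, goal_cases)
    case 1
    show ?case using coaction_theorem(1) by blast
  next
    case 2
    show ?case by (intro allI impI, drule coaction_theorem(2)) simp
  qed
qed

end
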